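(* Let $A$ be the path matrix of a (nonnegative weighted) planar network $D$ of order $n$, and let $1\le k\le n$. Then $$\mathrm{Imm}_{\chi^{k1^{n-k}}}(A)=\sum_{\pi\in\mathcal P_e(D)}\mathrm{wgt}(\pi)\cdot\#\{\text{standard }P(\pi)\text{-tableaux of shape }k1^{n-k}\}.$$ In particular, when $k=n$, $$\mathrm{per}(A)=\sum_{\pi\in\mathcal P_e(D)}\mathrm{wgt}(\pi)\cdot\#\{P(\pi)\text{-descent-free permutations of }\pi\}.$$
   Context: A (nonnegative weighted) planar network of order $n$ is a directed, planar, acyclic digraph $D=(V,E)$ which can be embedded in a disc so that $2n$ distinguished vertices, labeled clockwise as $s_1,\dots,s_n,t_n,\dots,t_1$, lie on the boundary of the disc, with a nonnegative real weight assigned to each edge; the sources $s_i$ have indegree $0$ and the sinks $t_i$ have outdegree $0$. The weight of a source-to-sink path is the product of the weights of its edges. The path matrix $A=(a_{i,j})_{i,j\in[n]}$ of $D$ has $a_{i,j}$ equal to the sum of weights of all paths from $s_i$ to $t_j$. A path family $\pi=(\pi_1,\dots,\pi_n)$ has type $w=w_1\cdots w_n\in\mathfrak S_n$ if $\pi_i$ is a path from $s_i$ to $t_{w_i}$ for all $i$; $\mathrm{wgt}(\pi)=\mathrm{wgt}(\pi_1)\cdots\mathrm{wgt}(\pi_n)$. $\mathcal P_e(D)$ is the set of path families in $D$ whose type is the identity. For $\pi\in\mathcal P_e(D)$, $P(\pi)$ is the poset on $\{\pi_1,\dots,\pi_n\}$ with $\pi_i<\pi_j$ if and only if $i<j$ and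 $\pi_i$, $\pi_j$ do not intersect (share no vertex). For a class function $\theta$ on $\mathfrak S_n$, $\mathrm{Imm}_\theta(A)=\sum_{w\in\mathfrak S_n}\theta(w)a_{1,w_1}\cdots a_{n,w_n}$. $\chi^\lambda$ is the irreducible character of $\mathfrak S_n$ indexed by $\lambda$ (with $\chi^{n}$ trivial), and $k1^{n-k}$ is the hook partition $(k,1,\dots,1)$. $\mathrm{per}$ is the permanent. For a poset $P$, a $P$-tableau of shape $\lambda\vdash|P|$ is a filling of a (French) Young diagram of shape $\lambda$ (row $1$ at the bottom, $\lambda_i$ boxes in row $i$) with the elements of $P$, each used once; $U_{i,j}$ is the $j$th entry of row $i$. It is row-semistrict ($P$-descent-free) if $U_{i,j}\not>_PU_{i,j+1}$ always; column-strict if $U_{i,j}<_PU_{i+1,j}$ always; standard if both. A $P$-permutation is a one-row $P$-tableau, i.e., a listing of all elements of $P$; it is descent-free if no entry is $>_P$ the next entry. "Permutation of $\pi$" means a $P(\pi)$-permutation. *)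

theory Defs
  imports
    "HOL-Analysis.Analysis"
    "HOL-Combinatorics.Combinatorics"
    "HOL-Library.Function_Algebras"
    "HOL-Library.FuncSet"
    "Graph_Theory.Digraph"
    "Graph_Theory.Arc_Walk"
begin

section \<open>Planar networks\<close>

text \<open>
  An embedding of a digraph in the closed unit disc: vertices become distinct points, arcs become
  simple curves joining their end points, and curves meet each other and the vertex points only in
  common end points.
\<close>

definition disc_embedding ::
    "('a, 'b) pre_digraph \<Rightarrow> ('a \<Rightarrow> complex) \<Rightarrow> ('b \<Rightarrow> real \<Rightarrow> complex) \<Rightarrow> bool" where
  "disc_embedding G pos \<gamma> \<longleftrightarrow>
     inj_on pos (verts G) \<and>
     pos ` verts G \<subseteq> cball 0 1 \<and>
     (\<forall>e\<in>arcs G. Path_Connected.arc (\<gamma> e) \<and> path_image (\<gamma> e) \<subseteq> cball 0 1 \<and>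
        pathstart (\<gamma> e) = pos (tail G e) \<and> pathfinish (\<gamma> e) = pos (head G e)) \<and>
     (\<forall>e\<in>arcs G. path_image (\<gamma> e) \<inter> pos ` verts G \<subseteq> pos ` {tail G e, head G e}) \<and>
     (\<forall>e\<in>arcs G. \<forall>f\<in>arcs G. e \<noteq> f \<longrightarrow>
        path_image (\<gamma> e) \<inter> path_image (\<gamma> f)
          \<subseteq> pos ` {tail G e, head G e} \<inter> pos ` {tail G f, head G f})"

text \<open>
  The listed points are distinct points of the unit circle in clockwise order: their angles strictly
  decrease, within less than one full turn.
\<close>

definition clockwise_on_circle :: "complex list \<Rightarrow> bool" where
  "clockwise_on_circle zs \<longleftrightarrow>
     (\<exists>\<alpha>s. map cis \<alpha>s = zs \<and> sorted_wrt (>) \<alpha>s \<and>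
        (\<forall>\<alpha>\<in>set \<alpha>s. \<forall>\<beta>\<in>set \<alpha>s. \<bar>\<alpha> - \<beta>\<bar> < 2 * pi))"

text \<open>
  The sources are \<open>s 1, \<dots>, s n\<close> and the sinks \<open>t 1, \<dots>, t n\<close>; values of \<open>s\<close> and \<open>t\<close> at other
  indices are irrelevant. Parallel arcs are permitted, loops are excluded by acyclicity.
\<close>

locale planar_network = fin_digraph G
  for G :: "('a, 'b) pre_digraph" (structure) +
  fixes n :: nat and s t :: "nat \<Rightarrow> 'a" and wt :: "'b \<Rightarrow> real"
  assumes acyclic: "\<not> (\<exists>c. cycle c)"
    and sources: "\<And>i. i \<in> {1..n} \<Longrightarrow> s i \<in> verts G \<and> in_degree G (s i) = 0"
    and sinks: "\<And>i. i \<in> {1..n} \<Longrightarrow> t i \<in> verts G \<and> out_degree G (t i) = 0"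
    and nonneg: "\<And>e. e \<in> arcs G \<Longrightarrow> 0 \<le> wt e"
    and planar: "\<exists>pos \<gamma>. disc_embedding G pos \<gamma> \<and>
        clockwise_on_circle (map (\<lambda>i. pos (s i)) [1..<n+1] @ map (\<lambda>i. pos (t i)) (rev [1..<n+1]))"

definition paths :: "('a, 'b) pre_digraph \<Rightarrow> 'a \<Rightarrow> 'a \<Rightarrow> 'b awalk set" where
  "paths G u v = {p. pre_digraph.apath G u p v}"

definition path_wgt :: "('b \<Rightarrow> real) \<Rightarrow> 'b awalk \<Rightarrow> real" where
  "path_wgt wt p = (\<Prod>e\<leftarrow>p. wt e)"

definition path_matrix ::
    "('a, 'b) pre_digraph \<Rightarrow> (nat \<Rightarrow> 'a) \<Rightarrow> (nat \<Rightarrow> 'a) \<Rightarrow> ('b \<Rightarrow> real) \<Rightarrow> nat \<Rightarrow> nat \<Rightarrow> real" where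
  "path_matrix G s t wt i j = (\<Sum>p\<in>paths G (s i) (t j). path_wgt wt p)"

definition path_families ::
    "('a, 'b) pre_digraph \<Rightarrow> nat \<Rightarrow> (nat \<Rightarrow> 'a) \<Rightarrow> (nat \<Rightarrow> 'a) \<Rightarrow> (nat \<Rightarrow> nat) \<Rightarrow> (nat \<Rightarrow> 'b awalk) set"
  where "path_families G n s t w = (\<Pi>\<^sub>E i\<in>{1..n}. paths G (s i) (t (w i)))"

definition family_wgt :: "nat \<Rightarrow> ('b \<Rightarrow> real) \<Rightarrow> (nat \<Rightarrow> 'b awalk) \<Rightarrow> real" where
  "family_wgt n wt \<pi> = (\<Prod>i=1..n. path_wgt wt (\<pi> i))"

text \<open>
  The strict order of the poset \<open>P(\<pi>)\<close>, whose elements are the paths \<open>\<pi> ` {1..n}\<close>. A path is a list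
  of arcs, so its start vertex is supplied to obtain its vertices.
\<close>

definition family_less ::
    "('a, 'b) pre_digraph \<Rightarrow> nat \<Rightarrow> (nat \<Rightarrow> 'a) \<Rightarrow> (nat \<Rightarrow> 'b awalk) \<Rightarrow> 'b awalk \<Rightarrow> 'b awalk \<Rightarrow> bool" where
  "family_less G n s \<pi> p q \<longleftrightarrow>
     (\<exists>i\<in>{1..n}. \<exists>j\<in>{1..n}. p = \<pi> i \<and> q = \<pi> j \<and> i < j \<and>
        set (pre_digraph.awalk_verts G (s i) p) \<inter> set (pre_digraph.awalk_verts G (s j) q) = {})"


section \<open>Tableaux\<close>

text \<open>
  A partition is the list of its parts in weakly decreasing order. Boxes \<open>(i, j)\<close> (row, column) are
  numbered from 1; row 1 is the row of length \<open>hd \<mu>\<close>.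
\<close>

definition diagram :: "nat list \<Rightarrow> (nat \<times> nat) set" where
  "diagram \<mu> = {(i, j). 1 \<le> i \<and> i \<le> length \<mu> \<and> 1 \<le> j \<and> j \<le> \<mu> ! (i - 1)}"

definition tableaux :: "nat list \<Rightarrow> 'p set \<Rightarrow> (nat \<times> nat \<Rightarrow> 'p) set" where
  "tableaux \<mu> X = {U \<in> extensional (diagram \<mu>). bij_betw U (diagram \<mu>) X}"

definition row_semistrict :: "('p \<Rightarrow> 'p \<Rightarrow> bool) \<Rightarrow> nat list \<Rightarrow> (nat \<times> nat \<Rightarrow> 'p) \<Rightarrow> bool" where
  "row_semistrict lt \<mu> U \<longleftrightarrow>
     (\<forall>i j. (i, j) \<in> diagram \<mu> \<and> (i, j + 1) \<in> diagram \<mu> \<longrightarrow> \<not> lt (U (i, j + 1)) (U (i, j)))"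

definition column_strict :: "('p \<Rightarrow> 'p \<Rightarrow> bool) \<Rightarrow> nat list \<Rightarrow> (nat \<times> nat \<Rightarrow> 'p) \<Rightarrow> bool" where
  "column_strict lt \<mu> U \<longleftrightarrow>
     (\<forall>i j. (i, j) \<in> diagram \<mu> \<and> (i + 1, j) \<in> diagram \<mu> \<longrightarrow> lt (U (i, j)) (U (i + 1, j)))"

definition standard_tableaux :: "nat list \<Rightarrow> 'p set \<Rightarrow> ('p \<Rightarrow> 'p \<Rightarrow> bool) \<Rightarrow> (nat \<times> nat \<Rightarrow> 'p) set" where
  "standard_tableaux \<mu> X lt =
     {U \<in> tableaux \<mu> X. row_semistrict lt \<mu> U \<and> column_strict lt \<mu> U}"

definition descent_free_permutations :: "'p set \<Rightarrow> ('p \<Rightarrow> 'p \<Rightarrow> bool) \<Rightarrow> 'p list set" where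
  "descent_free_permutations X lt =
     {xs \<in> permutations_of_set X. \<forall>i. i + 1 < length xs \<longrightarrow> \<not> lt (xs ! (i + 1)) (xs ! i)}"

text \<open>The partition \<open>(k, 1, \<dots>, 1)\<close> of \<open>n\<close>.\<close>

definition hook :: "nat \<Rightarrow> nat \<Rightarrow> nat list" where
  "hook n k = k # replicate (n - k) 1"


section \<open>Irreducible characters of the symmetric group\<close>

definition fun_scale :: "real \<Rightarrow> ('x \<Rightarrow> real) \<Rightarrow> 'x \<Rightarrow> real" where
  "fun_scale c v = (\<lambda>x. c * v x)"

global_interpretation fun_space: vector_space "fun_scale :: real \<Rightarrow> ('x \<Rightarrow> real) \<Rightarrow> 'x \<Rightarrow> real"
  by unfold_locales (auto simp: fun_scale_def fun_eq_iff algebra_simps)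

text \<open>
  The trace of a linear map \<open>T\<close> that leaves the finite-dimensional subspace \<open>V\<close> invariant, restricted
  to \<open>V\<close>; it does not depend on the chosen basis.
\<close>

definition trace_on :: "('x \<Rightarrow> real) set \<Rightarrow> (('x \<Rightarrow> real) \<Rightarrow> 'x \<Rightarrow> real) \<Rightarrow> real" where
  "trace_on V T =
     (let B = (SOME B. fun_space.independent B \<and> fun_space.span B = V)
      in \<Sum>b\<in>B. fun_space.representation B (T b) b)"

text \<open>
  The character indexed by \<open>\<mu>\<close> is that of the Specht module, the span of the polytabloids inside the
  permutation module on tabloids. A tabloid is the list of the row sets of a tableau with entries
  \<open>1, \<dots>, n\<close>. The real Specht modules remain irreducible over the complex numbers, so these are the
  usual complex irreducible characters; \<open>[n]\<close> gives the trivial character and \<open>replicate n 1\<close> the sign.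
\<close>

definition tabloid :: "nat list \<Rightarrow> (nat \<times> nat \<Rightarrow> nat) \<Rightarrow> nat set list" where
  "tabloid \<mu> T = map (\<lambda>i. {T (i, j) | j. (i, j) \<in> diagram \<mu>}) [1..<length \<mu> + 1]"

definition column_group :: "nat list \<Rightarrow> (nat \<times> nat \<Rightarrow> nat) \<Rightarrow> (nat \<Rightarrow> nat) set" where
  "column_group \<mu> T =
     {\<sigma>. \<sigma> permutes {1..sum_list \<mu>} \<and>
        (\<forall>i j. (i, j) \<in> diagram \<mu> \<longrightarrow> (\<exists>i'. (i', j) \<in> diagram \<mu> \<and> \<sigma> (T (i, j)) = T (i', j)))}"

definition polytabloid :: "nat list \<Rightarrow> (nat \<times> nat \<Rightarrow> nat) \<Rightarrow> nat set list \<Rightarrow> real" where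
  "polytabloid \<mu> T =
     (\<lambda>x. \<Sum>\<sigma>\<in>column_group \<mu> T. of_int (sign \<sigma>) * of_bool (tabloid \<mu> (\<sigma> \<circ> T) = x))"

definition specht_module :: "nat list \<Rightarrow> (nat set list \<Rightarrow> real) set" where
  "specht_module \<mu> = fun_space.span (polytabloid \<mu> ` tableaux \<mu> {1..sum_list \<mu>})"

text \<open>Linear extension of the action \<open>w [R\<^sub>1, R\<^sub>2, \<dots>] = [w ` R\<^sub>1, w ` R\<^sub>2, \<dots>]\<close> on tabloids.\<close>

definition perm_action :: "(nat \<Rightarrow> nat) \<Rightarrow> (nat set list \<Rightarrow> real) \<Rightarrow> nat set list \<Rightarrow> real" where
  "perm_action w v = (\<lambda>x. v (map (image (inv w)) x))"

definition irr_character :: "nat list \<Rightarrow> (nat \<Rightarrow> nat) \<Rightarrow> real" where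
  "irr_character \<mu> w = trace_on (specht_module \<mu>) (perm_action w)"


section \<open>Immanants\<close>

definition immanant :: "nat \<Rightarrow> ((nat \<Rightarrow> nat) \<Rightarrow> real) \<Rightarrow> (nat \<Rightarrow> nat \<Rightarrow> real) \<Rightarrow> real" where
  "immanant n \<theta> A = (\<Sum>w | w permutes {1..n}. \<theta> w * (\<Prod>i=1..n. A i (w i)))"

definition permanent :: "nat \<Rightarrow> (nat \<Rightarrow> nat \<Rightarrow> real) \<Rightarrow> real" where
  "permanent n A = (\<Sum>w | w permutes {1..n}. \<Prod>i=1..n. A i (w i))"

end

theory Submission
  imports Defs
begin

text \<open>
  Two paths whose end points interlace on the boundary circle must share a vertex (Fashoda theorem).
  Hence nonintersection is transitive along the indices, and the Lindstroem-Gessel-Viennot involution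
  writes a principal minor as a weighted count of the families that form a chain.

  The hook Specht module is the image, inside an exterior power of the permutation module, of the
  contraction with the all-ones functional. Exactness of this Koszul complex gives
  \<open>\<chi>\<^sub>k + \<chi>\<^sub>k\<^sub>+\<^sub>1 = Ind (triv\<^sub>k \<otimes> sgn\<^sub>n\<^sub>-\<^sub>k)\<close>, where \<open>\<chi>\<^sub>k\<close> belongs to the hook \<open>k1\<^sup>n\<^sup>-\<^sup>k\<close>. For immanants this reads
  \<open>Imm\<^sub>k + Imm\<^sub>k\<^sub>+\<^sub>1 = \<Sum>\<^sub>K det A\<^sub>K per A\<^sub>-\<^sub>K\<close> with \<open>K\<close> of size \<open>n - k\<close>, and the alternating sum over all sizes vanishes.

  On the combinatorial side, a descent-free row together with a disjoint chain is a hook tableau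
  either directly or after the least element of the chain has been moved to the front of the row.
  This yields the same recursions, first for the permanent and then for all hooks.
\<close>

section \<open>Crossing paths in the disc\<close>

text \<open>No sign-reversing involution reaches the permanent, since all its terms carry the sign
  +. Instead the alternating identity over the subsets K is solved for its term
  \<open>K = {}\<close>, which is the permanent itself. Every other term is a principal minor,
  already counted by chains, times the permanent of a strictly smaller index set. This is why
  minors, permanents and families are set up for arbitrary index sets and not only for
  \<open>{1..n}\<close>. Descent-free listings satisfy the same alternating identity for each single
  path family, so an induction over index sets matches the two sides. The two-term relation then
  carries the result from leg length p to p + 1, starting with the one-row shape. The characters are
  traces over a basis picked by choice, so basis independence has to come before any computation
  with them.\<close>

lemma cis_inj:
  assumes "cis a = cis b" "\<bar>a - b\<bar> < 2 * pi"
  shows "a = b"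
proof -
  have "cis (a - b) = 1"
    using assms(1) by (simp add: cis_divide [symmetric])
  then have "cos (a - b) = 1"
    by (metis cis.sel(1) one_complex.sel(1))
  then obtain m :: int where m: "a - b = of_int m * 2 * pi"
    using cos_one_2pi_int by auto
  with assms(2) have "\<bar>of_int m\<bar> * (2 * pi) < 1 * (2 * pi)"
    by (simp add: abs_mult)
  then have "\<bar>of_int m :: real\<bar> < 1"
    using mult_less_cancel_right_pos[of "2 * pi"] pi_gt_zero by auto
  then have "m = 0"
    by linarith
  with m show ?thesis
    by simp
qed

text \<open>Moebius map of the closed unit disc without 1 onto the closed upper half plane: the
  circle goes to the real axis and the pole is at 1. The Fashoda theorem speaks about rectangles;
  this map puts boundary points of the disc on a bottom edge.\<close>

definition cayley :: "complex \<Rightarrow> complex" where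
  "cayley w = \<i> * (1 + w) / (1 - w)"

lemma cayley_inj:
  assumes "cayley w = cayley z" "w \<noteq> 1" "z \<noteq> 1"
  shows "w = z"
  using assms by (simp add: cayley_def field_simps)

lemma Im_cayley: "Im (cayley w) = (1 - (norm w)\<^sup>2) / (norm (1 - w))\<^sup>2"
  unfolding cayley_def cmod_power2
  by (simp add: Im_divide power2_eq_square algebra_simps)

lemma Re_cayley_cis:
  assumes "sin (x / 2) \<noteq> 0"
  shows "Re (cayley (cis x)) = - cot (x / 2)"
proof -
  define y where "y = x / 2"
  have x: "x = 2 * y"
    by (simp add: y_def)
  have s: "sin y \<noteq> 0"
    using assms by (simp add: y_def)
  have sq: "(cos y)\<^sup>2 = 1 - (sin y)\<^sup>2"
    by (simp add: cos_squared_eq)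
  have d: "(1 - cos (2 * y))\<^sup>2 + (sin (2 * y))\<^sup>2 = 4 * (sin y)\<^sup>2"
    unfolding cos_double_sin sin_double power_mult_distrib sq
    by (simp add: power2_eq_square algebra_simps)
  have nn: "Re (cayley (cis x)) = - (2 * sin (2 * y)) / ((1 - cos (2 * y))\<^sup>2 + (sin (2 * y))\<^sup>2)"
    unfolding cayley_def x by (simp add: Re_divide power2_eq_square algebra_simps)
  show ?thesis
    unfolding nn d unfolding y_def[symmetric] sin_double cot_def
    using s by (simp add: field_simps power2_eq_square)
qed

text \<open>\<open>- cot (x / 2)\<close> increases strictly over the whole turn from
  \<open>- 2 * pi\<close> to 0: the difference of the two cotangents is the sine of
  \<open>(y - x) / 2\<close> over a product of two negative sines. Thus the cyclic order of boundary
  points becomes the order on the real axis.\<close>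

lemma Re_cayley_cis_less:
  assumes "- 2 * pi < x" "x < y" "y < 0"
  shows "Re (cayley (cis x)) < Re (cayley (cis y))"
proof -
  have sx: "sin (x / 2) < 0" and sy: "sin (y / 2) < 0"
    using assms using sin_gt_zero[of "- x / 2"] sin_gt_zero[of "- y / 2"] by auto
  have "0 < sin (y / 2 - x / 2)"
    using assms by (intro sin_gt_zero) auto
  then have "cos (y / 2) * sin (x / 2) < cos (x / 2) * sin (y / 2)"
    by (simp add: sin_diff algebra_simps)
  then have "cot (y / 2) < cot (x / 2)"
    using sx sy by (simp add: cot_def field_simps)
  then show ?thesis
    using sx sy by (simp add: Re_cayley_cis)
qed

text \<open>The Cayley transform with pole \<open>2 * cis e\<close> flattens the circle of radius 2.
  All four angles lie in one turn below e, so the images of the end points stand from left to right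
  as d, c, b, a and interlace on the real axis.\<close>

lemma paths_in_punctured_disc_cross:
  fixes f g :: "real \<Rightarrow> complex" and e :: real
  defines "D \<equiv> cball 0 2 - {2 * cis e}"
  assumes "path f" "path g" and sub: "path_image f \<subseteq> D" "path_image g \<subseteq> D"
    and ends: "pathstart f = 2 * cis a" "pathfinish f = 2 * cis c"
      "pathstart g = 2 * cis b" "pathfinish g = 2 * cis d"
    and order: "e > a" "a > b" "b > c" "c > d" "d > e - 2 * pi"
  shows "path_image f \<inter> path_image g \<noteq> {}"
proof -
  define M where "M z = cayley (z / (2 * cis e))" for z
  have quot: "z / (2 * cis e) \<noteq> 1" "norm (z / (2 * cis e)) \<le> 1" if "z \<in> D" for z
    using that by (auto simp: norm_divide norm_mult D_def)
  have M_inj: "w = z" if "M w = M z" "w \<in> D" "z \<in> D" for w z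
    using cayley_inj[OF that(1)[unfolded M_def] quot(1)[OF that(2)] quot(1)[OF that(3)]]
    by simp
  define V :: "complex \<Rightarrow> real ^ 2" where "V z = vector [Re (M z), Im (M z)]" for z
  have V: "V z $ 1 = Re (M z)" "V z $ 2 = Im (M z)" for z
    by (simp_all add: V_def)
  have cont: "continuous_on D V"
  proof -
    have "continuous_on D M"
      unfolding M_def cayley_def using quot(1) by (intro continuous_intros) auto
    then have "continuous_on D (\<lambda>z. if i = 1 then Re (M z) else Im (M z))" for i :: 2
      by (cases "i = 1") (auto intro!: continuous_intros)
    then have "continuous_on D (\<lambda>z. (\<chi> i. if i = 1 then Re (M z) else Im (M z)) :: real ^ 2)"
      by (intro continuous_on_vec_lambda) simp
    moreover have "V = (\<lambda>z. (\<chi> i. if i = 1 then Re (M z) else Im (M z)) :: real ^ 2)"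
      by (auto simp: fun_eq_iff vec_eq_iff forall_2 V)
    ultimately show ?thesis
      by simp
  qed
  have Vcis: "V (2 * cis x) $ 2 = 0" "V (2 * cis x) $ 1 = Re (cayley (cis (x - e)))" for x
    by (simp_all add: V M_def cis_divide Im_cayley)
  have less: "V (2 * cis x) $ 1 < V (2 * cis y) $ 1" if "d \<le> x" "x < y" "y \<le> a" for x y
    unfolding Vcis using that order by (intro Re_cayley_cis_less) auto
  have Im: "0 \<le> V z $ 2" if "z \<in> D" for z
    using quot[OF that] by (simp add: V M_def Im_cayley abs_square_le_1)
  \<comment> \<open>Both curves are reversed to suit \<open>fashoda_interlace\<close>: with g'
    running from d to b and f' from c to a, start and end points alternate from left to right as it
    requires.\<close>
  define f' where "f' = V \<circ> reversepath f"
  define g' where "g' = V \<circ> reversepath g"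
  have path: "path f'" "path g'"
    using assms unfolding f'_def g'_def
    by (intro path_continuous_image continuous_on_subset[OF cont]; simp)+
  have img: "path_image f' = V ` path_image f" "path_image g' = V ` path_image g"
    unfolding f'_def g'_def by (simp_all only: path_image_compose path_image_reversepath)
  have ends': "pathstart f' = V (2 * cis c)" "pathfinish f' = V (2 * cis a)"
    "pathstart g' = V (2 * cis d)" "pathfinish g' = V (2 * cis b)"
    by (simp_all add: f'_def g'_def pathstart_compose pathfinish_compose ends)
  have "compact (path_image f' \<union> path_image g')"
    using path by (intro compact_Un compact_path_image)
  then obtain B where B: "\<And>x. x \<in> path_image f' \<union> path_image g' \<Longrightarrow> norm x \<le> B"
    using compact_imp_bounded bounded_iff by metis
  \<comment> \<open>The images have nonnegative imaginary part, so a box with its bottom edge on the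
    real axis contains both curves and has all four end points on that edge.\<close>
  define lo :: "real^2" where "lo = vector [-B, 0]"
  define hi :: "real^2" where "hi = vector [B, B]"
  have box: "x \<in> cbox lo hi" if "x \<in> path_image f' \<union> path_image g'" for x
  proof -
    have "\<bar>x $ i\<bar> \<le> B" for i
      using B[OF that] component_le_norm_cart[of x i] by linarith
    moreover have "0 \<le> x $ 2"
      using that sub Im unfolding img by blast
    ultimately show ?thesis
      by (simp add: lo_def hi_def mem_box_cart forall_2 abs_le_iff) (simp add: minus_le_iff)
  qed
  have lo2: "lo $ 2 = 0"
    by (simp add: lo_def)
  have boxes: "path_image g' \<subseteq> cbox lo hi" "path_image f' \<subseteq> cbox lo hi"
    using box by auto
  have "pathstart g' $ 2 = lo $ 2" "pathfinish g' $ 2 = lo $ 2"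
    "pathstart f' $ 2 = lo $ 2" "pathfinish f' $ 2 = lo $ 2"
    by (simp_all only: ends' lo2 Vcis(1))
  moreover have "pathstart g' $ 1 < pathstart f' $ 1" "pathstart f' $ 1 < pathfinish g' $ 1"
    "pathfinish g' $ 1 < pathfinish f' $ 1"
    unfolding ends' using order by (auto intro!: less)
  ultimately obtain v where v: "v \<in> path_image g'" "v \<in> path_image f'"
    by (rule fashoda_interlace[OF path(2,1) boxes])
  then obtain w z where wz: "w \<in> path_image f" "z \<in> path_image g" "V w = V z"
    unfolding img by (metis imageE)
  then have "M w = M z"
    using V by (metis complex_eqI)
  then have "w = z"
    using wz sub by (rule_tac M_inj) auto
  with wz show ?thesis
    by auto
qed

definition radial_tail :: "real \<Rightarrow> complex set" where
  "radial_tail a = (\<lambda>r. of_real r * cis a) ` {1..2}"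

lemma path_image_linepath_radial:
  "path_image (linepath (2 * cis a) (cis a)) \<subseteq> radial_tail a"
  "path_image (linepath (cis a) (2 * cis a)) \<subseteq> radial_tail a"
proof -
  have "z \<in> radial_tail a" if z: "z \<in> closed_segment (cis a) (2 * cis a)" for z
  proof -
    obtain u where u: "0 \<le> u" "u \<le> 1" "z = (1 - u) *\<^sub>R cis a + u *\<^sub>R (2 * cis a)"
      using z by (auto simp: in_segment)
    then have "z = of_real (1 + u) * cis a"
      by (simp add: scaleR_conv_of_real algebra_simps)
    with u(1,2) show ?thesis
      by (auto simp: radial_tail_def intro!: image_eqI[of _ _ "1 + u"])
  qed
  then show "path_image (linepath (2 * cis a) (cis a)) \<subseteq> radial_tail a"
    "path_image (linepath (cis a) (2 * cis a)) \<subseteq> radial_tail a"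
    unfolding path_image_linepath closed_segment_commute[of "2 * cis a" "cis a"] by blast+
qed

lemma norm_radial_tail: "z \<in> radial_tail a \<Longrightarrow> 1 \<le> norm z \<and> norm z \<le> 2"
  by (auto simp: radial_tail_def norm_mult)

lemma radial_tail_eq: "z \<in> radial_tail a \<Longrightarrow> z = of_real (norm z) * cis a"
  by (auto simp: radial_tail_def norm_mult)

text \<open>Radial tails lead the two curves to the circle of radius 2, which they meet only in their
  end points. This leaves room for the pole of the Cayley transform.\<close>

lemma paths_in_disc_cross:
  fixes f g :: "real \<Rightarrow> complex"
  assumes "path f" "path g" "path_image f \<subseteq> cball 0 1" "path_image g \<subseteq> cball 0 1"
    and "pathstart f = cis a" "pathfinish f = cis c" "pathstart g = cis b" "pathfinish g = cis d"
    and order: "a > b" "b > c" "c > d" "a - d < 2 * pi"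
  shows "path_image f \<inter> path_image g \<noteq> {}"
proof -
  \<comment> \<open>The middle of the free arc from a to \<open>d + 2 * pi\<close>, which keeps the
    pole off all four directions.\<close>
  define e where "e = (a + d) / 2 + pi"
  have e: "a < e" "e - 2 * pi < d"
    using order by (simp_all add: e_def field_simps)
  have tail: "radial_tail z \<subseteq> cball 0 2 - {2 * cis e}" if "d \<le> z" "z \<le> a" for z
  proof -
    have "2 * cis e \<notin> radial_tail z"
    proof
      assume "2 * cis e \<in> radial_tail z"
      from radial_tail_eq[OF this] have "cis e = cis z"
        by (simp add: norm_mult)
      moreover have "\<bar>e - z\<bar> < 2 * pi"
        using e that by auto
      ultimately have "e = z"
        by (rule cis_inj)
      with e that show False by simp
    qed
    with norm_radial_tail show ?thesis by auto
  qed
  have disc: "cball 0 1 \<subseteq> cball 0 2 - {2 * cis e}"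
    by (auto simp: norm_mult)
  define F where "F = linepath (2 * cis a) (cis a) +++ f +++ linepath (cis c) (2 * cis c)"
  define G where "G = linepath (2 * cis b) (cis b) +++ g +++ linepath (cis d) (2 * cis d)"
  have F: "path F" "path_image F \<subseteq> path_image f \<union> radial_tail a \<union> radial_tail c"
    "pathstart F = 2 * cis a" "pathfinish F = 2 * cis c"
    using assms(1,5,6) path_image_linepath_radial unfolding F_def by (auto simp: path_image_join)
  have G: "path G" "path_image G \<subseteq> path_image g \<union> radial_tail b \<union> radial_tail d"
    "pathstart G = 2 * cis b" "pathfinish G = 2 * cis d"
    using assms(2,7,8) path_image_linepath_radial unfolding G_def by (auto simp: path_image_join)
  have "path_image F \<inter> path_image G \<noteq> {}"
  proof (rule paths_in_punctured_disc_cross[OF F(1) G(1) _ _ F(3,4) G(3,4) e(1) order(1-3) e(2)])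
    show "path_image F \<subseteq> cball 0 2 - {2 * cis e}"
    proof -
      have "radial_tail a \<subseteq> cball 0 2 - {2 * cis e}" "radial_tail c \<subseteq> cball 0 2 - {2 * cis e}"
        using order by (intro tail; simp)+
      with F(2) disc assms(3) show ?thesis by blast
    qed
    show "path_image G \<subseteq> cball 0 2 - {2 * cis e}"
    proof -
      have "radial_tail b \<subseteq> cball 0 2 - {2 * cis e}" "radial_tail d \<subseteq> cball 0 2 - {2 * cis e}"
        using order by (intro tail; simp)+
      with G(2) disc assms(4) show ?thesis by blast
    qed
  qed
  then obtain z where z: "z \<in> path_image F" "z \<in> path_image G"
    by blast
  have zf: "z \<in> path_image f \<or> z \<in> radial_tail a \<or> z \<in> radial_tail c"
    using z F(2) by blast
  have zg: "z \<in> path_image g \<or> z \<in> radial_tail b \<or> z \<in> radial_tail d"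
    using z G(2) by blast
  have tip: "z = cis x" if "z \<in> radial_tail x" "norm z \<le> 1" for x
  proof -
    have "norm z = 1"
      using norm_radial_tail[OF that(1)] that(2) by simp
    with radial_tail_eq[OF that(1)] show ?thesis
      by simp
  qed
  have apart: False if "z \<in> radial_tail x" "z \<in> radial_tail y" "x \<in> {a, c}" "y \<in> {b, d}" for x y
  proof -
    have "of_real (norm z) * cis x = of_real (norm z) * cis y"
      using radial_tail_eq[OF that(1)] radial_tail_eq[OF that(2)] by simp
    moreover have "norm z \<noteq> 0"
      using norm_radial_tail[OF that(1)] by linarith
    ultimately have "cis x = cis y"
      by (metis mult_cancel_left of_real_eq_0_iff)
    moreover have "\<bar>x - y\<bar> < 2 * pi" "x \<noteq> y"
      using that(3,4) order by auto
    ultimately show False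
      using cis_inj by blast
  qed
  \<comment> \<open>Outside the unit disc the common point would lie on one tail of each curve, but
    these tails have different directions. Inside, a point of a tail is its tip and hence an end
    point of the original curve.\<close>
  have "norm z \<le> 1"
  proof (rule ccontr)
    assume "\<not> norm z \<le> 1"
    then have "z \<notin> path_image f" "z \<notin> path_image g"
      using assms(3,4) by auto
    then show False
      using zf zg apart[of a b] apart[of a d] apart[of c b] apart[of c d] by blast
  qed
  moreover have "cis a \<in> path_image f" "cis c \<in> path_image f"
    using pathstart_in_path_image[of f] pathfinish_in_path_image[of f] by (simp_all add: assms(5,6))
  moreover have "cis b \<in> path_image g" "cis d \<in> path_image g"
    using pathstart_in_path_image[of g] pathfinish_in_path_image[of g] by (simp_all add: assms(7,8))
  ultimately have "z \<in> path_image f" "z \<in> path_image g"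
    using zf zg tip[of a] tip[of b] tip[of c] tip[of d] by metis+
  then show ?thesis by blast
qed

section \<open>Embedded walks and the vertices they share\<close>

lemma (in wf_digraph) awalk_curve:
  assumes "awalk u p v" "p \<noteq> []"
    and curves: "\<And>e. e \<in> arcs G \<Longrightarrow> path (\<gamma> e) \<and> pathstart (\<gamma> e) = pos (tail G e) \<and> pathfinish (\<gamma> e) = pos (head G e)"
  shows "\<exists>g. path g \<and> pathstart g = pos u \<and> pathfinish g = pos v \<and> path_image g \<subseteq> (\<Union>e\<in>set p. path_image (\<gamma> e))"
  using assms(1,2)
proof (induction p arbitrary: u)
  case (Cons e p)
  then have e: "e \<in> arcs G" "tail G e = u" "awalk (head G e) p v"
    by (auto simp: awalk_Cons_iff)
  show ?case
  proof (cases "p = []")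
    case True
    with e curves[OF e(1)] show ?thesis
      by (intro exI[of _ "\<gamma> e"]) (auto simp: awalk_Nil_iff)
  next
    case False
    with Cons.IH[OF e(3)] obtain g where "path g" "pathstart g = pos (head G e)" "pathfinish g = pos v"
      "path_image g \<subseteq> (\<Union>e\<in>set p. path_image (\<gamma> e))"
      by blast
    with e curves[OF e(1)] show ?thesis
      by (intro exI[of _ "\<gamma> e +++ g"]) (auto simp: path_image_join)
  qed
qed simp

context planar_network
begin

abbreviation vset :: "nat \<Rightarrow> 'b awalk \<Rightarrow> 'a set" where
  "vset i p \<equiv> set (awalk_verts (s i) p)"

text \<open>A repeated vertex would cut out a closed walk and hence a cycle. So pieces of paths can
  be spliced without checking that vertices stay distinct.\<close>

lemma awalk_imp_apath:
  assumes "awalk u p v"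
  shows "apath u p v"
proof (rule ccontr)
  assume "\<not> apath u p v"
  with assms have "\<not> distinct (awalk_verts u p)"
    by (simp add: apath_def)
  from awalk_not_distinct_decomp[OF assms this] obtain r w where "0 < length r" "awalk w r w"
    by blast
  then have "closed_w r"
    by (auto simp: closed_w_def)
  with closed_w_imp_cycle acyclic show False
    by blast
qed

lemma paths_conv: "paths G u v = {p. awalk u p v}"
  unfolding paths_def using awalk_imp_apath apath_def by blast

text \<open>The clockwise list has the sinks in reverse order after the n sources, so counting from
  0 \<open>s i\<close> stands at position \<open>i - 1\<close> and \<open>t i\<close> at
  \<open>n + (n - i)\<close>.\<close>

lemma boundary_angles:
  obtains pos \<gamma> \<alpha>
  where "disc_embedding G pos \<gamma>"
    and "\<And>i. i \<in> {1..n} \<Longrightarrow> pos (s i) = cis (\<alpha> (i - 1))"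
    and "\<And>i. i \<in> {1..n} \<Longrightarrow> pos (t i) = cis (\<alpha> (2 * n - i))"
    and "\<And>x y. x < y \<Longrightarrow> y < 2 * n \<Longrightarrow> \<alpha> y < \<alpha> x \<and> \<alpha> x - \<alpha> y < 2 * pi"
proof -
  from planar obtain pos \<gamma> where emb: "disc_embedding G pos \<gamma>"
    and cw: "clockwise_on_circle (map (\<lambda>i. pos (s i)) [1..<n+1] @ map (\<lambda>i. pos (t i)) (rev [1..<n+1]))"
    (is "clockwise_on_circle ?zs")
    by blast
  from cw obtain \<alpha>s where zs: "map cis \<alpha>s = ?zs" and sorted: "sorted_wrt (>) \<alpha>s"
    and close: "\<forall>\<alpha>\<in>set \<alpha>s. \<forall>\<beta>\<in>set \<alpha>s. \<bar>\<alpha> - \<beta>\<bar> < 2 * pi"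
    by (auto simp: clockwise_on_circle_def)
  from zs have len: "length \<alpha>s = 2 * n"
    by (auto dest: arg_cong[of _ _ length])
  have nth: "cis (\<alpha>s ! x) = ?zs ! x" if "x < 2 * n" for x
    using that len zs by (metis nth_map)
  show thesis
  proof (rule that[OF emb, of "nth \<alpha>s"])
    fix i assume i: "i \<in> {1..n}"
    then show "pos (s i) = cis (\<alpha>s ! (i - 1))"
      by (subst nth) (auto simp: nth_append simp del: upt_Suc)
    from i show "pos (t i) = cis (\<alpha>s ! (2 * n - i))"
      by (subst nth) (auto simp: nth_append rev_nth simp del: upt_Suc)
  next
    fix x y assume "x < y" "y < 2 * n"
    with sorted len have "\<alpha>s ! y < \<alpha>s ! x"
      by (auto simp: sorted_wrt_iff_nth_less)
    moreover have "\<bar>\<alpha>s ! x - \<alpha>s ! y\<bar> < 2 * pi"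
      using close len \<open>x < y\<close> \<open>y < 2 * n\<close> by auto
    ultimately show "\<alpha>s ! y < \<alpha>s ! x \<and> \<alpha>s ! x - \<alpha>s ! y < 2 * pi"
      by auto
  qed
qed

text \<open>As \<open>m < l\<close>, the points \<open>s i\<close>, \<open>s j\<close>,
  \<open>t l\<close>, \<open>t m\<close> follow each other clockwise, so the curves of the two walks
  interlace and meet. Distinct embedded arcs meet only in common end points, and a common arc shares
  its ends; either way the meeting point yields a common vertex.\<close>

lemma crossing:
  assumes p: "awalk (s i) p (t l)" and q: "awalk (s j) q (t m)"
    and ij: "i \<in> {1..n}" "j \<in> {1..n}" "i < j" and ml: "l \<in> {1..n}" "m \<in> {1..n}" "m < l"
  shows "vset i p \<inter> vset j q \<noteq> {}"
proof -
  obtain pos \<gamma> \<alpha>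
  where emb: "disc_embedding G pos \<gamma>"
    and pos_s: "\<And>i. i \<in> {1..n} \<Longrightarrow> pos (s i) = cis (\<alpha> (i - 1))"
    and pos_t: "\<And>i. i \<in> {1..n} \<Longrightarrow> pos (t i) = cis (\<alpha> (2 * n - i))"
    and dec: "\<And>x y. x < y \<Longrightarrow> y < 2 * n \<Longrightarrow> \<alpha> y < \<alpha> x \<and> \<alpha> x - \<alpha> y < 2 * pi"
    by (rule boundary_angles, rule that)
  have ord: "i - 1 < j - 1" "j - 1 < 2 * n - l" "2 * n - l < 2 * n - m" "2 * n - m < 2 * n"
    using ij ml by auto
  have angles: "\<alpha> (j - 1) < \<alpha> (i - 1)" "\<alpha> (2 * n - l) < \<alpha> (j - 1)" "\<alpha> (2 * n - m) < \<alpha> (2 * n - l)"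
    "\<alpha> (i - 1) - \<alpha> (2 * n - m) < 2 * pi"
    using dec[OF ord(1)] dec[OF ord(2)] dec[OF ord(3)] dec[of "i - 1" "2 * n - m"] ord by linarith+
  \<comment> \<open>This excludes empty walks, which carry no curve.\<close>
  have "s i' \<noteq> t l'" if "i' \<in> {1..n}" "l' \<in> {1..n}" for i' l'
  proof
    assume "s i' = t l'"
    then have "cis (\<alpha> (i' - 1)) = cis (\<alpha> (2 * n - l'))"
      using pos_s[OF that(1)] pos_t[OF that(2)] by simp
    moreover have "i' - 1 < 2 * n - l'" "2 * n - l' < 2 * n"
      using that by auto
    note dec[OF this]
    ultimately show False
      using cis_inj[of "\<alpha> (i' - 1)" "\<alpha> (2 * n - l')"] by auto
  qed
  with p q ij ml have ne: "p \<noteq> []" "q \<noteq> []"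
    by (auto simp: awalk_Nil_iff)
  have curves: "path (\<gamma> e) \<and> pathstart (\<gamma> e) = pos (tail G e) \<and> pathfinish (\<gamma> e) = pos (head G e)"
    and disc: "path_image (\<gamma> e) \<subseteq> cball 0 1" if "e \<in> arcs G" for e
    using emb that by (auto simp: disc_embedding_def arc_imp_path)
  obtain f where f: "path f" "pathstart f = pos (s i)" "pathfinish f = pos (t l)"
    "path_image f \<subseteq> (\<Union>e\<in>set p. path_image (\<gamma> e))"
    using awalk_curve[OF p ne(1) curves] by blast
  obtain g where g: "path g" "pathstart g = pos (s j)" "pathfinish g = pos (t m)"
    "path_image g \<subseteq> (\<Union>e\<in>set q. path_image (\<gamma> e))"
    using awalk_curve[OF q ne(2) curves] by blast
  have arcs: "set p \<subseteq> arcs G" "set q \<subseteq> arcs G"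
    using p q by auto
  have "path_image f \<inter> path_image g \<noteq> {}"
  proof (rule paths_in_disc_cross[OF f(1) g(1) _ _ _ _ _ _ angles])
    show "path_image f \<subseteq> cball 0 1" "path_image g \<subseteq> cball 0 1"
      using f(4) g(4) arcs disc by blast+
    show "pathstart f = cis (\<alpha> (i - 1))" "pathfinish f = cis (\<alpha> (2 * n - l))"
      unfolding f(2,3) by (rule pos_s pos_t, fact)+
    show "pathstart g = cis (\<alpha> (j - 1))" "pathfinish g = cis (\<alpha> (2 * n - m))"
      unfolding g(2,3) by (rule pos_s pos_t, fact)+
  qed
  then obtain z where "z \<in> path_image f" "z \<in> path_image g"
    by blast
  then obtain e e' where e: "e \<in> set p" "z \<in> path_image (\<gamma> e)" and e': "e' \<in> set q" "z \<in> path_image (\<gamma> e')"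
    using f(4) g(4) by blast
  have ends: "{tail G e, head G e} \<subseteq> vset i p" "{tail G e', head G e'} \<subseteq> vset j q"
    using e(1) e'(1) p q by (auto simp: set_awalk_verts)
  show ?thesis
  proof (cases "e = e'")
    case True
    with ends show ?thesis by auto
  next
    case False
    then have "z \<in> pos ` {tail G e, head G e} \<inter> pos ` {tail G e', head G e'}"
    proof -
      have "path_image (\<gamma> e) \<inter> path_image (\<gamma> e') \<subseteq> pos ` {tail G e, head G e} \<inter> pos ` {tail G e', head G e'}"
        using emb False e(1) e'(1) arcs unfolding disc_embedding_def by (meson subsetD)
      with e(2) e'(2) show ?thesis by blast
    qed
    then obtain v w where vw: "v \<in> {tail G e, head G e}" "w \<in> {tail G e', head G e'}" "pos v = pos w"
      by auto
    moreover have "v \<in> verts G" "w \<in> verts G"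
      using vw e e' arcs by auto
    ultimately have "v = w"
      using emb by (auto simp: disc_embedding_def dest: inj_onD)
    with vw ends show ?thesis by auto
  qed
qed

end

section \<open>Tail swapping and principal minors\<close>

text \<open>The part dropped from \<open>ys\<close> is empty or starts where P fails, so a second
  cut falls on the seam of the spliced list. Together with the next lemma this makes swapping tails
  an involution.\<close>

lemma takeWhile_append_dropWhile: "takeWhile P (takeWhile P xs @ dropWhile P ys) = takeWhile P xs"
proof -
  have "takeWhile P (dropWhile P ys) = []"
    by (induction ys) auto
  then show ?thesis
    by (induction xs) auto
qed

lemma dropWhile_append_dropWhile: "dropWhile P (takeWhile P xs @ dropWhile P ys) = dropWhile P ys"
  by (induction xs) auto

context planar_network
begin

text \<open>The cut is made before the first arc leaving v. If v is the last vertex of a path, no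
  arc of the path leaves v and its tail is empty.\<close>

definition swap_tails :: "'a \<Rightarrow> 'b awalk \<Rightarrow> 'b awalk \<Rightarrow> 'b awalk" where
  "swap_tails v p q = takeWhile (\<lambda>e. tail G e \<noteq> v) p @ dropWhile (\<lambda>e. tail G e \<noteq> v) q"

lemma swap_tails_swap_tails: "swap_tails v (swap_tails v p q) (swap_tails v q p) = p"
  by (simp add: swap_tails_def takeWhile_append_dropWhile dropWhile_append_dropWhile)

lemma path_wgt_swap_tails:
  "path_wgt wt (swap_tails v p q) * path_wgt wt (swap_tails v q p) = path_wgt wt p * path_wgt wt q"
proof -
  have "path_wgt wt p = path_wgt wt (takeWhile P p) * path_wgt wt (dropWhile P p)" for P p
    by (metis map_append path_wgt_def prod_list.append takeWhile_dropWhile_id)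
  from this[of p "\<lambda>e. tail G e \<noteq> v"] this[of q "\<lambda>e. tail G e \<noteq> v"] show ?thesis
    by (simp add: swap_tails_def path_wgt_def)
qed

lemma awalk_split_at:
  assumes "awalk u p w" "v \<in> set (awalk_verts u p)"
  shows "awalk u (takeWhile (\<lambda>e. tail G e \<noteq> v) p) v \<and> awalk v (dropWhile (\<lambda>e. tail G e \<noteq> v) p) w"
  using assms
proof (induction p arbitrary: u)
  case Nil
  then show ?case by (auto simp: awalk_Nil_iff)
next
  case (Cons e p)
  show ?case
  proof (cases "tail G e = v")
    case True
    with Cons.prems show ?thesis by (auto simp: awalk_Cons_iff awalk_Nil_iff)
  next
    case False
    with Cons.prems have "awalk (head G e) p w" "v \<in> set (awalk_verts (head G e) p)"
      by (auto simp: awalk_Cons_iff)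
    from Cons.IH[OF this] Cons.prems False show ?thesis
      by (auto simp: awalk_Cons_iff)
  qed
qed

lemma awalk_swap_tails:
  assumes "awalk u p w" "awalk u' q w'" "v \<in> set (awalk_verts u p)" "v \<in> set (awalk_verts u' q)"
  shows "awalk u (swap_tails v p q) w'"
  unfolding swap_tails_def using awalk_split_at[OF assms(1,3)] awalk_split_at[OF assms(2,4)]
  by (blast intro: awalk_appendI)

text \<open>For the third claim: a head and the tail of the same original path share only v, because
  paths do not repeat vertices. Hence the exchange creates no new common vertex of the two
  paths.\<close>

lemma verts_swap_tails:
  assumes "awalk u p w" "awalk u' q w'" "v \<in> set (awalk_verts u p)" "v \<in> set (awalk_verts u' q)"
  defines "p' \<equiv> swap_tails v p q" and "q' \<equiv> swap_tails v q p"
  shows "v \<in> set (awalk_verts u p')"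
    and "set (awalk_verts u p') \<subseteq> set (awalk_verts u p) \<union> set (awalk_verts u' q)"
    and "set (awalk_verts u p') \<inter> set (awalk_verts u' q') \<subseteq> set (awalk_verts u p) \<inter> set (awalk_verts u' q)"
proof -
  define a where "a = takeWhile (\<lambda>e. tail G e \<noteq> v) p"
  define b where "b = dropWhile (\<lambda>e. tail G e \<noteq> v) p"
  define a' where "a' = takeWhile (\<lambda>e. tail G e \<noteq> v) q"
  define b' where "b' = dropWhile (\<lambda>e. tail G e \<noteq> v) q"
  have aw: "awalk u a v" "awalk v b w" "awalk u' a' v" "awalk v b' w'"
    using awalk_split_at[OF assms(1,3)] awalk_split_at[OF assms(2,4)]
    by (simp_all add: a_def b_def a'_def b'_def)
  have eqs: "p = a @ b" "q = a' @ b'" "p' = a @ b'" "q' = a' @ b"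
    by (simp_all add: a_def b_def a'_def b'_def p'_def q'_def swap_tails_def)
  have verts: "set (awalk_verts u p) = set (awalk_verts u a) \<union> set (awalk_verts v b)"
    "set (awalk_verts u' q) = set (awalk_verts u' a') \<union> set (awalk_verts v b')"
    "set (awalk_verts u p') = set (awalk_verts u a) \<union> set (awalk_verts v b')"
    "set (awalk_verts u' q') = set (awalk_verts u' a') \<union> set (awalk_verts v b)"
    unfolding eqs using aw by (auto simp: set_awalk_verts_append simp del: awalk_append_iff)
  have disj: "set (awalk_verts x c) \<inter> set (awalk_verts v d) \<subseteq> {v}" if "awalk x c v" "awalk v d y" for x c d y
  proof -
    have "awalk x (c @ d) y"
      using that by (rule awalk_appendI)
    then have "distinct (awalk_verts x (c @ d))"
      using awalk_imp_apath by (auto simp: apath_def)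
    moreover have "awalk_verts x (c @ d) = awalk_verts x c @ tl (awalk_verts v d)"
      using awalk_verts_append[OF \<open>awalk x (c @ d) y\<close>] that by auto
    moreover have "awalk_verts v d = v # tl (awalk_verts v d)"
      using that(2) by (cases d) (auto simp: awalk_Cons_iff)
    then obtain zs where "awalk_verts v d = v # zs"
      by blast
    ultimately show ?thesis
      by auto
  qed
  have v: "v \<in> set (awalk_verts v b)" "v \<in> set (awalk_verts v b')"
    using aw hd_in_awalk_verts by auto
  show "v \<in> set (awalk_verts u p')" "set (awalk_verts u p') \<subseteq> set (awalk_verts u p) \<union> set (awalk_verts u' q)"
    using verts v by auto
  show "set (awalk_verts u p') \<inter> set (awalk_verts u' q') \<subseteq> set (awalk_verts u p) \<inter> set (awalk_verts u' q)"
    using verts v assms(3,4) disj[OF aw(1,2)] disj[OF aw(3,4)] by blast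
qed

text \<open>If the outer paths shared a vertex v, exchanging tails there would give a path from
  \<open>s i\<close> to \<open>t k\<close>. It must cross the middle path by
  \<open>crossing\<close>, although all its vertices come from the outer two.\<close>

lemma disjoint_trans:
  assumes p: "awalk (s i) p (t i)" and q: "awalk (s j) q (t j)" and r: "awalk (s k) r (t k)"
    and ijk: "i \<in> {1..n}" "j \<in> {1..n}" "k \<in> {1..n}" "i < j" "j < k"
    and disj: "vset i p \<inter> vset j q = {}" "vset j q \<inter> vset k r = {}"
  shows "vset i p \<inter> vset k r = {}"
proof (rule ccontr)
  assume "vset i p \<inter> vset k r \<noteq> {}"
  then obtain v where v: "v \<in> vset i p" "v \<in> vset k r"
    by blast
  have "vset i (swap_tails v p r) \<inter> vset j q \<noteq> {}"
    by (rule crossing[OF awalk_swap_tails[OF p r v] q]) (use ijk in auto)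
  moreover have "vset i (swap_tails v p r) \<subseteq> vset i p \<union> vset k r"
    by (rule verts_swap_tails(2)[OF p r v])
  ultimately show False
    using disj by blast
qed

end

text \<open>The least moved point i is sent above itself, while its preimage is larger than i and is
  sent down to i; these two form an inversion.\<close>

lemma permutes_no_inversion:
  fixes K :: "nat set"
  assumes "finite K" "w permutes K" and mono: "\<And>i j. i \<in> K \<Longrightarrow> j \<in> K \<Longrightarrow> i < j \<Longrightarrow> w i \<le> w j"
  shows "w = id"
proof (rule ccontr)
  assume "w \<noteq> id"
  then obtain i' where "w i' \<noteq> i'"
    by (auto simp: fun_eq_iff)
  define i where "i = (LEAST i. w i \<noteq> i)"
  have i1: "w i \<noteq> i"
    unfolding i_def by (rule LeastI[where P = "\<lambda>i. w i \<noteq> i"]) fact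
  have i2: "w j = j" if "j < i" for j
    using not_less_Least[of j "\<lambda>i. w i \<noteq> i"] that by (simp flip: i_def)
  have "i < w i"
  proof (rule ccontr)
    assume "\<not> i < w i"
    with i1 have "w (w i) = w i"
      by (intro i2) simp
    with permutes_inj[OF assms(2)] i1 show False
      by (simp add: inj_eq)
  qed
  define j where "j = inv w i"
  have j: "w j = i"
    unfolding j_def by (rule permutes_inverses[OF assms(2)])
  have "\<not> j < i" "j \<noteq> i"
    using i2[of j] i1 j by auto
  then have "i < j"
    by simp
  moreover have "i \<in> K"
    using i1 permutes_not_in[OF assms(2), of i] by blast
  moreover have "j \<in> K"
    using \<open>j \<noteq> i\<close> j permutes_not_in[OF assms(2), of j] by auto
  ultimately have "w i \<le> w j"
    using mono by blast
  with j \<open>i < w i\<close> show False by simp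
qed

section \<open>Cancellation of intersecting families in a minor\<close>

definition det_on :: "nat set \<Rightarrow> (nat \<Rightarrow> nat \<Rightarrow> real) \<Rightarrow> real" where
  "det_on K A = (\<Sum>w | w permutes K. of_int (sign w) * (\<Prod>i\<in>K. A i (w i)))"

definition per_on :: "nat set \<Rightarrow> (nat \<Rightarrow> nat \<Rightarrow> real) \<Rightarrow> real" where
  "per_on K A = (\<Sum>w | w permutes K. \<Prod>i\<in>K. A i (w i))"

context planar_network
begin

definition families :: "nat set \<Rightarrow> (nat \<Rightarrow> nat) \<Rightarrow> (nat \<Rightarrow> 'b awalk) set" where
  "families K w = (\<Pi>\<^sub>E i\<in>K. paths G (s i) (t (w i)))"

definition fwgt :: "nat set \<Rightarrow> (nat \<Rightarrow> 'b awalk) \<Rightarrow> real" where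
  "fwgt K \<pi> = (\<Prod>i\<in>K. path_wgt wt (\<pi> i))"

definition meeting_points :: "nat set \<Rightarrow> (nat \<Rightarrow> 'b awalk) \<Rightarrow> 'a set" where
  "meeting_points K \<pi> = {x. \<exists>i\<in>K. \<exists>j\<in>K. i \<noteq> j \<and> x \<in> vset i (\<pi> i) \<inter> vset j (\<pi> j)}"

definition passing :: "nat set \<Rightarrow> (nat \<Rightarrow> 'b awalk) \<Rightarrow> 'a \<Rightarrow> nat set" where
  "passing K \<pi> x = {i \<in> K. x \<in> vset i (\<pi> i)}"

definition swap_at :: "nat \<Rightarrow> nat \<Rightarrow> 'a \<Rightarrow> (nat \<Rightarrow> 'b awalk) \<Rightarrow> nat \<Rightarrow> 'b awalk" where
  "swap_at i j v \<pi> = \<pi>(i := swap_tails v (\<pi> i) (\<pi> j), j := swap_tails v (\<pi> j) (\<pi> i))"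

lemma meeting_pointsI:
  "i \<in> K \<Longrightarrow> j \<in> K \<Longrightarrow> i \<noteq> j \<Longrightarrow> x \<in> vset i (\<pi> i) \<Longrightarrow> x \<in> vset j (\<pi> j) \<Longrightarrow> x \<in> meeting_points K \<pi>"
  unfolding meeting_points_def mem_Collect_eq by (intro bexI[of _ i] bexI[of _ j] conjI IntI)

lemma finite_paths: "finite (paths G u v)"
  unfolding paths_def by (rule apaths_finite)

lemma finite_families: "finite K \<Longrightarrow> finite (families K w)"
  unfolding families_def by (intro finite_PiE finite_paths) auto

lemma families_awalk: "\<pi> \<in> families K w \<Longrightarrow> i \<in> K \<Longrightarrow> awalk (s i) (\<pi> i) (t (w i))"
  unfolding families_def paths_conv by (drule PiE_mem) auto

lemma swap_at_swap_at: "i \<noteq> j \<Longrightarrow> swap_at i j v (swap_at i j v \<pi>) = \<pi>"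
  by (auto simp: swap_at_def swap_tails_swap_tails fun_eq_iff)

context
  fixes K :: "nat set" and w :: "nat \<Rightarrow> nat" and \<pi> :: "nat \<Rightarrow> 'b awalk" and i j :: nat and v :: 'a
  assumes fam: "\<pi> \<in> families K w" and ij: "i \<in> K" "j \<in> K" "i \<noteq> j"
    and v: "v \<in> vset i (\<pi> i)" "v \<in> vset j (\<pi> j)"
begin

lemma swap_at_families: "swap_at i j v \<pi> \<in> families K (w \<circ> Transposition.transpose i j)"
proof -
  note aw = families_awalk[OF fam ij(1)] families_awalk[OF fam ij(2)]
  have "awalk (s a) (swap_at i j v \<pi> a) (t ((w \<circ> Transposition.transpose i j) a))" if "a \<in> K" for a
    using that families_awalk[OF fam that] awalk_swap_tails[OF aw v] awalk_swap_tails[OF aw(2,1) v(2,1)] ij(3)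
    by (cases "a = i"; cases "a = j") (simp_all add: swap_at_def)
  moreover have "swap_at i j v \<pi> a = undefined" if "a \<notin> K" for a
  proof -
    have "\<pi> a = undefined"
      using fam that by (auto simp: families_def PiE_def extensional_def)
    moreover have "a \<noteq> i" "a \<noteq> j"
      using that ij by auto
    ultimately show ?thesis
      by (simp add: swap_at_def)
  qed
  ultimately show ?thesis
    unfolding families_def paths_conv by (intro PiE_I) auto
qed

lemma fwgt_swap_at: "finite K \<Longrightarrow> fwgt K (swap_at i j v \<pi>) = fwgt K \<pi>"
proof -
  assume K: "finite K"
  have split: "fwgt K \<rho> = path_wgt wt (\<rho> i) * path_wgt wt (\<rho> j) * (\<Prod>a\<in>K - {i, j}. path_wgt wt (\<rho> a))" for \<rho>
  proof -
    have "K = insert i (insert j (K - {i, j}))"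
      using ij by auto
    then have "fwgt K \<rho> = (\<Prod>a\<in>insert i (insert j (K - {i, j})). path_wgt wt (\<rho> a))"
      by (simp add: fwgt_def)
    then show ?thesis
      using K ij by (simp add: mult.assoc)
  qed
  have "path_wgt wt (swap_at i j v \<pi> i) * path_wgt wt (swap_at i j v \<pi> j) = path_wgt wt (\<pi> i) * path_wgt wt (\<pi> j)"
    using ij(3) by (simp add: swap_at_def path_wgt_swap_tails)
  moreover have "(\<Prod>a\<in>K - {i, j}. path_wgt wt (swap_at i j v \<pi> a)) = (\<Prod>a\<in>K - {i, j}. path_wgt wt (\<pi> a))"
    by (intro prod.cong) (auto simp: swap_at_def)
  ultimately show ?thesis
    by (simp only: split)
qed

lemma vset_swap_at:
  "v \<in> vset i (swap_at i j v \<pi> i)" "v \<in> vset j (swap_at i j v \<pi> j)"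
  "vset i (swap_at i j v \<pi> i) \<subseteq> vset i (\<pi> i) \<union> vset j (\<pi> j)"
  "vset j (swap_at i j v \<pi> j) \<subseteq> vset i (\<pi> i) \<union> vset j (\<pi> j)"
  "vset i (swap_at i j v \<pi> i) \<inter> vset j (swap_at i j v \<pi> j) \<subseteq> vset i (\<pi> i) \<inter> vset j (\<pi> j)"
  using verts_swap_tails[OF families_awalk[OF fam ij(1)] families_awalk[OF fam ij(2)] v]
    verts_swap_tails[OF families_awalk[OF fam ij(2)] families_awalk[OF fam ij(1)] v(2,1)] ij(3)
  by (auto simp: swap_at_def)

text \<open>Both exchanged paths still run through v and the others are untouched. So a rule that
  selects two paths from \<open>passing\<close> selects the same two after the exchange.\<close>

lemma passing_swap_at: "passing K (swap_at i j v \<pi>) v = passing K \<pi> v"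
proof -
  have "v \<in> vset a (swap_at i j v \<pi> a) \<longleftrightarrow> v \<in> vset a (\<pi> a)" for a
  proof (cases "a = i \<or> a = j")
    case True
    then show ?thesis
      using v vset_swap_at(1,2) by blast
  next
    case False
    then show ?thesis
      by (simp add: swap_at_def)
  qed
  then show ?thesis
    by (simp add: passing_def)
qed

text \<open>A vertex of an exchanged path comes from one of the two originals, which settles
  meetings with a third path; a vertex on both exchanged paths was on both originals by
  \<open>vset_swap_at\<close>.\<close>

lemma meeting_points_swap_at_subset: "meeting_points K (swap_at i j v \<pi>) \<subseteq> meeting_points K \<pi>"
proof
  fix x assume "x \<in> meeting_points K (swap_at i j v \<pi>)"
  then obtain a b where ab: "a \<in> K" "b \<in> K" "a \<noteq> b"
    "x \<in> vset a (swap_at i j v \<pi> a)" "x \<in> vset b (swap_at i j v \<pi> b)"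
    by (auto simp: meeting_points_def)
  have other: "swap_at i j v \<pi> c = \<pi> c" if "c \<notin> {i, j}" for c
    using that by (simp add: swap_at_def)
  have member: "x \<in> vset i (\<pi> i) \<or> x \<in> vset j (\<pi> j)" if "x \<in> vset c (swap_at i j v \<pi> c)" "c \<in> {i, j}" for c
    using that vset_swap_at(3,4) by blast
  have I: "x \<in> meeting_points K \<pi>" if "c \<in> K" "d \<in> K" "c \<noteq> d" "x \<in> vset c (\<pi> c)" "x \<in> vset d (\<pi> d)" for c d
    using that unfolding meeting_points_def by blast
  consider "a \<notin> {i, j}" "b \<notin> {i, j}" | "a \<in> {i, j}" "b \<notin> {i, j}" | "a \<notin> {i, j}" "b \<in> {i, j}"
    | "{a, b} = {i, j}"
    using ab(3) by auto
  then show "x \<in> meeting_points K \<pi>"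
  proof cases
    case 1
    with I[OF ab(1-3)] other[of a] other[of b] ab(4,5) show ?thesis by simp
  next
    case 2
    with member[OF ab(4)] I[of i b] I[of j b] ij ab other[of b] show ?thesis by auto
  next
    case 3
    with member[OF ab(5)] I[of a i] I[of a j] ij ab other[of a] show ?thesis by auto
  next
    case 4
    then have "x \<in> vset i (swap_at i j v \<pi> i) \<inter> vset j (swap_at i j v \<pi> j)"
      using ab(4,5) by (auto simp: doubleton_eq_iff)
    with vset_swap_at(5) have "x \<in> vset i (\<pi> i)" "x \<in> vset j (\<pi> j)"
      by blast+
    with I ij show ?thesis by blast
  qed
qed

end

text \<open>The reverse inclusion is the same lemma for the swapped family, since a second exchange
  restores \<pi>.\<close>

lemma meeting_points_swap_at:
  assumes fam: "\<pi> \<in> families K w" and ij: "i \<in> K" "j \<in> K" "i \<noteq> j"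
    and v: "v \<in> vset i (\<pi> i)" "v \<in> vset j (\<pi> j)"
  shows "meeting_points K (swap_at i j v \<pi>) = meeting_points K \<pi>"
proof
  show "meeting_points K (swap_at i j v \<pi>) \<subseteq> meeting_points K \<pi>"
    by (rule meeting_points_swap_at_subset[OF assms])
  show "meeting_points K \<pi> \<subseteq> meeting_points K (swap_at i j v \<pi>)"
    using meeting_points_swap_at_subset[OF swap_at_families[OF assms] ij vset_swap_at(1,2)[OF assms]]
    by (simp add: swap_at_swap_at[OF ij(3)])
qed

text \<open>Pairs of a permutation and a family with meetings cancel under an exchange of tails,
  which flips the sign and keeps the weight. The vertex and the two paths are read off from
  \<open>meeting_points\<close> and \<open>passing\<close>, which the exchange preserves, so it is
  an involution. Without meetings, \<open>crossing\<close> leaves only the identity.\<close>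

lemma det_on_path_matrix:
  assumes K: "K \<subseteq> {1..n}"
  shows "det_on K (path_matrix G s t wt) =
    (\<Sum>\<pi>\<in>families K id. fwgt K \<pi> * of_bool (\<forall>i\<in>K. \<forall>j\<in>K. i < j \<longrightarrow> vset i (\<pi> i) \<inter> vset j (\<pi> j) = {}))"
proof -
  have fin: "finite K"
    using K finite_subset by blast
  define X where "X = (SIGMA w:{w. w permutes K}. families K w)"
  define X1 where "X1 = {x \<in> X. meeting_points K (snd x) \<noteq> {}}"
  define X0 where "X0 = {x \<in> X. meeting_points K (snd x) = {}}"
  define f where "f = (\<lambda>(w :: nat \<Rightarrow> nat, \<pi>). of_int (sign w) * fwgt K \<pi>)"
  \<comment> \<open>Any fixed choice will do: as a function of the set of meeting points alone it
    returns the same vertex before and after the exchange.\<close>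
  define pt where "pt \<pi> = (SOME v. v \<in> meeting_points K \<pi>)" for \<pi>
  define fst_idx where "fst_idx \<pi> = Min (passing K \<pi> (pt \<pi>))" for \<pi>
  define snd_idx where "snd_idx \<pi> = Min (passing K \<pi> (pt \<pi>) - {fst_idx \<pi>})" for \<pi>
  define \<Phi> where "\<Phi> = (\<lambda>(w :: nat \<Rightarrow> nat, \<pi>). (w \<circ> Transposition.transpose (fst_idx \<pi>) (snd_idx \<pi>),
    swap_at (fst_idx \<pi>) (snd_idx \<pi>) (pt \<pi>) \<pi>))"
  have finX: "finite X"
    unfolding X_def using fin by (intro finite_SigmaI finite_permutations finite_families)
  have "det_on K (path_matrix G s t wt) = (\<Sum>w | w permutes K. \<Sum>\<pi>\<in>families K w. of_int (sign w) * fwgt K \<pi>)"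
    unfolding det_on_def path_matrix_def families_def fwgt_def
    by (simp add: prod_sum_PiE[OF fin finite_paths] sum_distrib_left)
  also have "\<dots> = sum f X"
    unfolding X_def f_def using fin by (subst sum.Sigma) (auto simp: finite_permutations finite_families)
  also have "\<dots> = sum f X1 + sum f X0"
    using finX unfolding X1_def X0_def by (subst sum.union_disjoint [symmetric]) (auto intro!: sum.cong)
  also have "sum f X1 = 0"
  proof -
    have idx: "fst_idx \<pi> \<in> K" "snd_idx \<pi> \<in> K" "fst_idx \<pi> \<noteq> snd_idx \<pi>"
      "pt \<pi> \<in> vset (fst_idx \<pi>) (\<pi> (fst_idx \<pi>))" "pt \<pi> \<in> vset (snd_idx \<pi>) (\<pi> (snd_idx \<pi>))"
      if "meeting_points K \<pi> \<noteq> {}" for \<pi>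
    proof -
      have "pt \<pi> \<in> meeting_points K \<pi>"
        using that unfolding pt_def by (metis some_in_eq)
      then obtain a b where ab: "a \<in> passing K \<pi> (pt \<pi>)" "b \<in> passing K \<pi> (pt \<pi>)" "a \<noteq> b"
        unfolding meeting_points_def passing_def by blast
      have finp: "finite (passing K \<pi> (pt \<pi>))"
        using fin by (simp add: passing_def)
      have "fst_idx \<pi> \<in> passing K \<pi> (pt \<pi>)"
        unfolding fst_idx_def using ab finp by (intro Min_in) auto
      moreover have "passing K \<pi> (pt \<pi>) - {fst_idx \<pi>} \<noteq> {}"
        using ab by blast
      then have "snd_idx \<pi> \<in> passing K \<pi> (pt \<pi>) - {fst_idx \<pi>}"
        unfolding snd_idx_def using finp by (intro Min_in) auto
      ultimately show "fst_idx \<pi> \<in> K" "snd_idx \<pi> \<in> K" "fst_idx \<pi> \<noteq> snd_idx \<pi>"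
      "pt \<pi> \<in> vset (fst_idx \<pi>) (\<pi> (fst_idx \<pi>))" "pt \<pi> \<in> vset (snd_idx \<pi>) (\<pi> (snd_idx \<pi>))"
        by (auto simp: passing_def)
    qed
    have inv: "\<Phi> (w, \<pi>) \<in> X1 \<and> \<Phi> (\<Phi> (w, \<pi>)) = (w, \<pi>) \<and> f (\<Phi> (w, \<pi>)) = - f (w, \<pi>)" if "(w, \<pi>) \<in> X1" for w \<pi>
    proof -
      from that have w: "w permutes K" and fam: "\<pi> \<in> families K w" and ne: "meeting_points K \<pi> \<noteq> {}"
        by (auto simp: X1_def X_def)
      note idx = idx[OF ne]
      define \<pi>' where "\<pi>' = swap_at (fst_idx \<pi>) (snd_idx \<pi>) (pt \<pi>) \<pi>"
      define \<tau> where "\<tau> = Transposition.transpose (fst_idx \<pi>) (snd_idx \<pi>)"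
      have \<Phi>: "\<Phi> (w, \<pi>) = (w \<circ> \<tau>, \<pi>')"
        by (simp add: \<Phi>_def \<pi>'_def \<tau>_def)
      have mp: "meeting_points K \<pi>' = meeting_points K \<pi>"
        unfolding \<pi>'_def by (rule meeting_points_swap_at[OF fam idx])
      then have pt: "pt \<pi>' = pt \<pi>"
        by (simp add: pt_def)
      have "passing K \<pi>' (pt \<pi>) = passing K \<pi> (pt \<pi>)"
        unfolding \<pi>'_def by (rule passing_swap_at[OF fam idx])
      then have same: "fst_idx \<pi>' = fst_idx \<pi>" "snd_idx \<pi>' = snd_idx \<pi>"
        by (simp_all add: fst_idx_def snd_idx_def pt)
      have \<tau>: "\<tau> permutes K"
        unfolding \<tau>_def using idx by (intro permutes_swap_id)
      have "w \<circ> \<tau> permutes K"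
        using \<tau> w by (rule permutes_compose)
      moreover have "\<pi>' \<in> families K (w \<circ> \<tau>)"
        unfolding \<pi>'_def \<tau>_def by (rule swap_at_families[OF fam idx])
      ultimately have 1: "\<Phi> (w, \<pi>) \<in> X1"
        using mp ne by (simp add: \<Phi> X1_def X_def)
      have 2: "\<Phi> (\<Phi> (w, \<pi>)) = (w, \<pi>)"
        unfolding \<Phi> using swap_at_swap_at[OF idx(3)]
        by (simp add: \<Phi>_def same pt o_assoc [symmetric]) (simp add: \<pi>'_def \<tau>_def)
      have "sign (w \<circ> \<tau>) = - sign w"
        using w \<tau> fin idx(3)
        by (subst sign_compose) (auto simp: permutation_permutes \<tau>_def sign_swap_id)
      then have 3: "f (\<Phi> (w, \<pi>)) = - f (w, \<pi>)"
        unfolding \<Phi> using fwgt_swap_at[OF fam idx fin] by (simp add: f_def \<pi>'_def)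
      from 1 2 3 show ?thesis by blast
    qed
    have "sum f X1 = (\<Sum>x\<in>X1. f (\<Phi> x))"
      by (rule sum.reindex_bij_witness[of _ \<Phi> \<Phi>]; use inv in \<open>simp add: split_paired_all\<close>)
    also have "\<dots> = (\<Sum>x\<in>X1. - f x)"
      by (rule sum.cong; use inv in \<open>simp add: split_paired_all\<close>)
    finally show ?thesis
      by (simp add: sum_negf)
  qed
  also have "sum f X0 = (\<Sum>\<pi>\<in>{\<pi> \<in> families K id. meeting_points K \<pi> = {}}. fwgt K \<pi>)"
  proof -
    \<comment> \<open>An inversion of w would force two of the paths to cross.\<close>
    have "w = id" if "(w, \<pi>) \<in> X0" for w \<pi>
    proof (rule permutes_no_inversion[OF fin])
      from that have w: "w permutes K" and fam: "\<pi> \<in> families K w" and ne: "meeting_points K \<pi> = {}"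
        by (auto simp: X0_def X_def)
      show "w permutes K" by fact
      fix i j assume ij: "i \<in> K" "j \<in> K" "i < j"
      show "w i \<le> w j"
      proof (rule ccontr)
        assume "\<not> w i \<le> w j"
        moreover have "w i \<in> K" "w j \<in> K"
          using ij permutes_in_image[OF w] by auto
        ultimately have "vset i (\<pi> i) \<inter> vset j (\<pi> j) \<noteq> {}"
          using K ij by (intro crossing[OF families_awalk[OF fam ij(1)] families_awalk[OF fam ij(2)]]) auto
        then obtain x where "x \<in> vset i (\<pi> i) \<inter> vset j (\<pi> j)"
          by auto
        then have "x \<in> meeting_points K \<pi>"
          using ij by (intro meeting_pointsI[of i K j]) auto
        with ne show False by simp
      qed
    qed
    note type_id = this
    have "X0 = Pair id ` {\<pi> \<in> families K id. meeting_points K \<pi> = {}}"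
    proof (intro equalityI subsetI)
      fix x assume x: "x \<in> X0"
      obtain w \<pi> where "x = (w, \<pi>)"
        by (cases x)
      with x type_id[of w \<pi>] show "x \<in> Pair (id :: nat \<Rightarrow> nat) ` {\<pi> \<in> families K id. meeting_points K \<pi> = {}}"
        by (auto simp: X0_def X_def)
    next
      fix x assume "x \<in> Pair (id :: nat \<Rightarrow> nat) ` {\<pi> \<in> families K id. meeting_points K \<pi> = {}}"
      then show "x \<in> X0"
        by (auto simp: X0_def X_def permutes_id)
    qed
    then show ?thesis
      by (simp add: sum.reindex inj_on_def f_def)
  qed
  also have "\<dots> = (\<Sum>\<pi>\<in>families K id. fwgt K \<pi> * of_bool (meeting_points K \<pi> = {}))"
    using finite_families[OF fin, of id] by (intro sum.mono_neutral_cong_left) auto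
  also have "\<dots> = (\<Sum>\<pi>\<in>families K id. fwgt K \<pi> * of_bool (\<forall>i\<in>K. \<forall>j\<in>K. i < j \<longrightarrow> vset i (\<pi> i) \<inter> vset j (\<pi> j) = {}))"
  proof -
    have "meeting_points K \<pi> = {} \<longleftrightarrow> (\<forall>i\<in>K. \<forall>j\<in>K. i < j \<longrightarrow> vset i (\<pi> i) \<inter> vset j (\<pi> j) = {})"
      (is "?L \<longleftrightarrow> ?R") for \<pi>
    proof
      assume L: ?L
      show ?R
      proof (intro ballI impI equals0I)
        fix i j x assume "i \<in> K" "j \<in> K" "i < j" "x \<in> vset i (\<pi> i) \<inter> vset j (\<pi> j)"
        then have "x \<in> meeting_points K \<pi>"
          by (intro meeting_pointsI[of i K j]) auto
        with L show False by simp
      qed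
    next
      assume R: ?R
      have "vset i (\<pi> i) \<inter> vset j (\<pi> j) = {}" if "i \<in> K" "j \<in> K" "i \<noteq> j" for i j
      proof (cases "i < j")
        case True
        with R that show ?thesis by simp
      next
        case False
        with that have "j < i" by simp
        with R that have "vset j (\<pi> j) \<inter> vset i (\<pi> i) = {}" by simp
        then show ?thesis by (simp add: Int_commute)
      qed
      note disj = this
      show ?L
      proof (rule equals0I)
        fix x assume "x \<in> meeting_points K \<pi>"
        then obtain i j where ij: "i \<in> K" "j \<in> K" "i \<noteq> j" and x: "x \<in> vset i (\<pi> i) \<inter> vset j (\<pi> j)"
          unfolding meeting_points_def mem_Collect_eq by (elim bexE conjE)
        from x show False
          unfolding disj[OF ij] by simp
      qed
    qed
    then show ?thesis by simp
  qed
  finally show ?thesis by simp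
qed

end

section \<open>Traces from dual bases\<close>

lemma additive_sum:
  fixes T :: "'v::comm_monoid_add \<Rightarrow> 'w::comm_monoid_add"
  assumes "T 0 = 0" "\<And>f g. T (f + g) = T f + T g"
  shows "T (sum h A) = (\<Sum>a\<in>A. T (h a))"
  by (induction A rule: infinite_finite_induct) (simp_all add: assms)

lemma fun_scale_0: "fun_scale 0 v = 0"
  by (simp add: fun_scale_def fun_eq_iff)

lemma trace_basis_independent:
  fixes T :: "('x \<Rightarrow> real) \<Rightarrow> 'x \<Rightarrow> real"
  assumes B: "finite B" "fun_space.independent B" "fun_space.span B = V"
    and C: "finite C" "fun_space.independent C" "fun_space.span C = V"
    and add: "\<And>f g. T (f + g) = T f + T g" and scale: "\<And>c f. T (fun_scale c f) = fun_scale c (T f)"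
    and inv: "\<And>f. f \<in> V \<Longrightarrow> T f \<in> V"
  shows "(\<Sum>b\<in>B. fun_space.representation B (T b) b) = (\<Sum>c\<in>C. fun_space.representation C (T c) c)"
proof -
  let ?r = "fun_space.representation"
  have BV: "b \<in> V" if "b \<in> B" for b
    using that B(3) fun_space.span_base by blast
  have CV: "c \<in> V" if "c \<in> C" for c
    using that C(3) fun_space.span_base by blast
  have T0: "T 0 = 0"
    using scale[of 0 0] by (simp add: fun_scale_0)
  have expandC: "(\<Sum>c\<in>C. fun_scale (?r C v c) c) = v" if "v \<in> V" for v
    using fun_space.sum_representation_eq[OF C(2) _ C(1) subset_refl] that C(3) by blast
  have expandB: "(\<Sum>b\<in>B. fun_scale (?r B v b) b) = v" if "v \<in> V" for v
    using fun_space.sum_representation_eq[OF B(2) _ B(1) subset_refl] that B(3) by blast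
  have 1: "?r B (T b) b = (\<Sum>c\<in>C. ?r C b c * ?r B (T c) b)" if b: "b \<in> B" for b
  proof -
    have "T b = T (\<Sum>c\<in>C. fun_scale (?r C b c) c)"
      using expandC[OF BV[OF b]] by simp
    also have "\<dots> = (\<Sum>c\<in>C. fun_scale (?r C b c) (T c))"
      by (simp add: additive_sum[of T, OF T0 add] scale)
    finally have "?r B (T b) b = ?r B (\<Sum>c\<in>C. fun_scale (?r C b c) (T c)) b"
      by simp
    also have "\<dots> = (\<Sum>c\<in>C. ?r B (fun_scale (?r C b c) (T c)) b)"
      using B(3) inv CV by (subst fun_space.representation_sum[OF B(2)]) (auto intro: fun_space.span_scale)
    also have "\<dots> = (\<Sum>c\<in>C. ?r C b c * ?r B (T c) b)"
      using B(3) inv CV by (intro sum.cong refl) (subst fun_space.representation_scale[OF B(2)]; simp)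
    finally show ?thesis .
  qed
  have 2: "?r C (T c) c = (\<Sum>b\<in>B. ?r B (T c) b * ?r C b c)" if c: "c \<in> C" for c
  proof -
    have "?r C (T c) c = ?r C (\<Sum>b\<in>B. fun_scale (?r B (T c) b) b) c"
      using expandB[OF inv[OF CV[OF c]]] by simp
    also have "\<dots> = (\<Sum>b\<in>B. ?r C (fun_scale (?r B (T c) b) b) c)"
      using C(3) BV by (subst fun_space.representation_sum[OF C(2)]) (auto intro: fun_space.span_scale)
    also have "\<dots> = (\<Sum>b\<in>B. ?r B (T c) b * ?r C b c)"
      using C(3) BV by (intro sum.cong refl) (subst fun_space.representation_scale[OF C(2)]; simp)
    finally show ?thesis .
  qed
  have "(\<Sum>b\<in>B. ?r B (T b) b) = (\<Sum>b\<in>B. \<Sum>c\<in>C. ?r C b c * ?r B (T c) b)"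
    by (intro sum.cong refl 1)
  also have "\<dots> = (\<Sum>c\<in>C. \<Sum>b\<in>B. ?r B (T c) b * ?r C b c)"
    by (subst sum.swap) (simp add: mult.commute)
  also have "\<dots> = (\<Sum>c\<in>C. ?r C (T c) c)"
    by (intro sum.cong refl 2 [symmetric])
  finally show ?thesis .
qed

text \<open>A dual system of linear functionals certifies a basis and reads off the diagonal of the matrix.\<close>

lemma trace_on_dual_basis:
  fixes b :: "'i \<Rightarrow> 'x \<Rightarrow> real" and \<phi> :: "'i \<Rightarrow> ('x \<Rightarrow> real) \<Rightarrow> real"
  assumes I: "finite I" and V: "fun_space.span (b ` I) = V"
    and \<phi>_add: "\<And>i f g. \<phi> i (f + g) = \<phi> i f + \<phi> i g"
    and \<phi>_scale: "\<And>i c f. \<phi> i (fun_scale c f) = c * \<phi> i f"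
    and dual: "\<And>i j. i \<in> I \<Longrightarrow> j \<in> I \<Longrightarrow> \<phi> i (b j) = of_bool (i = j)"
    and add: "\<And>f g. T (f + g) = T f + T g" and scale: "\<And>c f. T (fun_scale c f) = fun_scale c (T f)"
    and inv: "\<And>f. f \<in> V \<Longrightarrow> T f \<in> V"
  shows "trace_on V T = (\<Sum>i\<in>I. \<phi> i (T (b i)))"
proof -
  let ?r = "fun_space.representation"
  have inj: "inj_on b I"
  proof (rule inj_onI)
    fix i j assume "i \<in> I" "j \<in> I" "b i = b j"
    then show "i = j"
      using dual[of i i] dual[of i j] by (simp split: if_splits)
  qed
  have \<phi>0: "\<phi> i 0 = 0" for i
    using \<phi>_scale[of i 0 0] by (simp add: fun_scale_0)
  have eval: "\<phi> i (\<Sum>v\<in>b ` I. fun_scale (u v) v) = u (b i)" if i: "i \<in> I" for i u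
  proof -
    have "\<phi> i (\<Sum>v\<in>b ` I. fun_scale (u v) v) = (\<Sum>j\<in>I. u (b j) * \<phi> i (b j))"
      by (simp add: additive_sum[of "\<phi> i", OF \<phi>0 \<phi>_add] sum.reindex[OF inj] \<phi>_scale)
    also have "\<dots> = (\<Sum>j\<in>I. if j = i then u (b j) else 0)"
      using i by (intro sum.cong refl) (simp add: dual)
    finally show ?thesis
      using i I by simp
  qed
  have indep: "fun_space.independent (b ` I)"
  proof (rule fun_space.independent_if_scalars_zero)
    fix u x assume 0: "(\<Sum>x\<in>b ` I. fun_scale (u x) x) = 0" and "x \<in> b ` I"
    then obtain i where "i \<in> I" "x = b i"
      by blast
    with eval[of i u] 0 \<phi>0 show "u x = 0"
      by simp
  qed (use I in simp)
  have rep: "?r (b ` I) v (b i) = \<phi> i v" if "v \<in> V" "i \<in> I" for v i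
    using eval[OF that(2), of "?r (b ` I) v"] I that(1) V
      fun_space.sum_representation_eq[OF indep, of v "b ` I"] by simp
  define B where "B = (SOME B. fun_space.independent B \<and> fun_space.span B = V)"
  have "fun_space.independent B \<and> fun_space.span B = V"
    unfolding B_def by (rule someI[of _ "b ` I"]) (use indep V in simp)
  moreover from this have "finite B"
    using fun_space.independent_span_bound[of "b ` I" B] I V fun_space.span_superset[of B] by simp
  ultimately have "trace_on V T = (\<Sum>v\<in>b ` I. ?r (b ` I) (T v) v)"
    unfolding trace_on_def Let_def B_def [symmetric]
    using I indep V by (intro trace_basis_independent[OF _ _ _ _ _ _ add scale inv]) auto
  also have "\<dots> = (\<Sum>i\<in>I. ?r (b ` I) (T (b i)) (b i))"
    by (simp add: sum.reindex[OF inj])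
  also have "\<dots> = (\<Sum>i\<in>I. \<phi> i (T (b i)))"
    using V by (intro sum.cong refl rep inv) (auto intro: fun_space.span_base)
  finally show ?thesis .
qed

section \<open>Hook Specht modules\<close>

abbreviation transpos :: "nat \<Rightarrow> nat \<Rightarrow> nat \<Rightarrow> nat" where
  "transpos \<equiv> Transposition.transpose"

text \<open>\<open>c\<close> lists the entries of the one-box rows above the first; the first row is
  what remains of S. A hook tabloid thus amounts to the list \<open>c\<close>, and functions on such
  tabloids behave like tensors.\<close>

definition hook_tabloid :: "nat set \<Rightarrow> nat list \<Rightarrow> nat set list" where
  "hook_tabloid S c = (S - set c) # map (\<lambda>x. {x}) c"

text \<open>
  With \<open>B = set c\<close> this is the wedge product of the entries of \<open>c\<close>; with \<open>B = set a\<close> and \<open>c = tl a\<close> it is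
  the polytabloid of a hook tableau with first column \<open>a\<close>.
\<close>

definition alt :: "nat set \<Rightarrow> nat set \<Rightarrow> nat list \<Rightarrow> nat set list \<Rightarrow> real" where
  "alt S B c = (\<lambda>x. \<Sum>q | q permutes B. of_int (sign q) * of_bool (hook_tabloid S (map q c) = x))"

section \<open>Alternating sums of hook tabloids\<close>

lemma hook_tabloid_inj [simp]: "hook_tabloid S c = hook_tabloid S d \<longleftrightarrow> c = d"
proof -
  have "inj (map (\<lambda>x::nat. {x}))"
    by (intro inj_mapI inj_onI) simp
  then show ?thesis
    by (auto simp: hook_tabloid_def inj_eq)
qed

lemma alt_tabloid: "alt S B c (hook_tabloid S d) = (\<Sum>q | q permutes B. of_int (sign q) * of_bool (map q c = d))"
  by (simp add: alt_def)

lemma sign_compose_permutes: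
  "finite A \<Longrightarrow> finite B \<Longrightarrow> p permutes A \<Longrightarrow> q permutes B \<Longrightarrow> sign (p \<circ> q) = sign p * sign q"
  by (intro sign_compose permutes_imp_permutation)

lemma conj_permutes:
  assumes "q permutes A" and hg: "\<And>y. h (g y) = y" and gh: "\<And>y. g (h y) = y"
  shows "g \<circ> q \<circ> h permutes g ` A"
proof (rule bij_imp_permutes)
  have "bij_betw h (g ` A) A" "bij_betw g A (g ` A)"
    by (intro bij_betw_byWitness[of _ g] bij_betw_byWitness[of _ h]; auto simp: hg gh)+
  then show "bij_betw (g \<circ> q \<circ> h) (g ` A) (g ` A)"
    using permutes_imp_bij[OF assms(1)] by (blast intro: bij_betw_trans)
next
  fix y assume "y \<notin> g ` A"
  then have "h y \<notin> A"
    using gh by (metis imageI)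
  then show "(g \<circ> q \<circ> h) y = y"
    by (simp add: permutes_not_in[OF assms(1)] gh)
qed

text \<open>Substitute \<open>q \<circ> p\<close> for q. Rearranging \<open>c\<close> by a
  permutation of B therefore costs only a sign, so sorted lists are enough for spanning
  sets.\<close>

lemma alt_map_permutes:
  assumes "finite B" "p permutes B"
  shows "alt S B (map p c) = fun_scale (of_int (sign p)) (alt S B c)"
proof
  fix x
  have "alt S B c x = (\<Sum>q | q permutes B. of_int (sign (q \<circ> p)) * of_bool (hook_tabloid S (map (q \<circ> p) c) = x))"
    unfolding alt_def by (rule sum_permutations_compose_right[OF assms(2)])
  also have "\<dots> = (\<Sum>q | q permutes B. of_int (sign p) * (of_int (sign q) * of_bool (hook_tabloid S (map q (map p c)) = x)))"
    using assms by (intro sum.cong refl) (simp add: sign_compose_permutes[of B B] mult.assoc)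
  also have "\<dots> = of_int (sign p) * alt S B (map p c) x"
    by (simp add: alt_def sum_distrib_left)
  finally have "alt S B c x = of_int (sign p) * alt S B (map p c) x" .
  moreover have "of_int (sign p) * (of_int (sign p) :: real) = 1"
    by (metis of_int_1 of_int_mult sign_idempotent)
  ultimately show "alt S B (map p c) x = fun_scale (of_int (sign p)) (alt S B c) x"
    by (simp add: fun_scale_def flip: mult.assoc)
qed

text \<open>Conjugation by p matches the permutations of the image of B with those of B and keeps
  signs; afterwards p stands outermost. This form serves both the coset expansion and the group
  action.\<close>

lemma alt_image:
  assumes S: "finite S" "p permutes S" and B: "finite B"
  shows "alt S (p ` B) (map p c) x =
    (\<Sum>q | q permutes B. of_int (sign q) * of_bool (hook_tabloid S (map p (map q c)) = x))"
proof -
  have invp: "inv p permutes S"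
    by (rule permutes_inv[OF S(2)])
  have p: "inv p (p y) = y" "p (inv p y) = y" for y
    using permutes_inverses[OF S(2)] by auto
  show ?thesis
    unfolding alt_def
  proof (rule sum.reindex_bij_witness[of _ "\<lambda>q. p \<circ> q \<circ> inv p" "\<lambda>q. inv p \<circ> q \<circ> p"])
    fix q assume "q \<in> {q. q permutes p ` B}"
    then have q: "q permutes p ` B" by simp
    have "inv p ` p ` B = B"
      by (simp add: image_image p)
    with conj_permutes[OF q p(2,1)] show "inv p \<circ> q \<circ> p \<in> {q. q permutes B}"
      by simp
    show "p \<circ> (inv p \<circ> q \<circ> p) \<circ> inv p = q"
      by (simp add: fun_eq_iff p)
    have "sign (inv p \<circ> q \<circ> p) = sign q"
    proof -
      have perm: "permutation p" "permutation (inv p)" "permutation q"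
        using permutes_imp_permutation[OF S] permutes_imp_permutation[OF S(1) invp]
          permutes_imp_permutation[OF finite_imageI[OF B] q] by auto
      have "sign (inv p \<circ> q \<circ> p) = sign p * sign q * sign p"
        using perm by (simp add: sign_compose permutation_compose sign_inverse)
      also have "\<dots> = sign q * (sign p * sign p)"
        by (simp only: mult_ac)
      finally show ?thesis by simp
    qed
    moreover have "map p (map (inv p \<circ> q \<circ> p) c) = map q (map p c)"
      by (simp add: p)
    ultimately show "of_int (sign (inv p \<circ> q \<circ> p)) * of_bool (hook_tabloid S (map p (map (inv p \<circ> q \<circ> p) c)) = x) =
      of_int (sign q) * (of_bool (hook_tabloid S (map q (map p c)) = x) :: real)"
      by (simp only:)
  next
    fix q assume "q \<in> {q. q permutes B}"
    then have q: "q permutes B" by simp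
    from conj_permutes[OF q p] show "p \<circ> q \<circ> inv p \<in> {q. q permutes p ` B}"
      by simp
    show "inv p \<circ> (p \<circ> q \<circ> inv p) \<circ> p = q"
      by (simp add: fun_eq_iff p)
  qed
qed

lemma sum_apply_fun: "(\<Sum>i\<in>I. f i) x = (\<Sum>i\<in>I. f i x)" for f :: "'i \<Rightarrow> 'x \<Rightarrow> 'w::comm_monoid_add"
  by (induction I rule: infinite_finite_induct) auto

text \<open>Coset decomposition: a permutation of \<open>insert b B\<close> is uniquely
  \<open>transpos b y\<close> after a permutation of B. In the summand for y the element b takes the
  place of y in the set and in the list.\<close>

lemma alt_insert:
  assumes "finite S" "insert b B \<subseteq> S" "b \<notin> B" "b \<notin> set c"
  shows "alt S (insert b B) c =
    (\<Sum>y\<in>insert b B. fun_scale (of_int (sign (transpos b y))) (alt S (transpos b y ` B) (map (transpos b y) c)))"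
proof
  fix x
  have fin: "finite B"
    using assms(1,2) finite_subset by auto
  have "alt S (insert b B) c x = (\<Sum>y\<in>insert b B. \<Sum>q | q permutes B.
      of_int (sign (transpos b y \<circ> q)) * of_bool (hook_tabloid S (map (transpos b y \<circ> q) c) = x))"
    unfolding alt_def by (rule sum_over_permutations_insert[OF fin assms(3)])
  also have "\<dots> = (\<Sum>y\<in>insert b B. of_int (sign (transpos b y)) * alt S (transpos b y ` B) (map (transpos b y) c) x)"
  proof (rule sum.cong[OF refl])
    fix y assume y: "y \<in> insert b B"
    have "transpos b y permutes S"
      using y assms(2) by (intro permutes_swap_id) auto
    note img = alt_image[OF assms(1) this fin]
    show "(\<Sum>q | q permutes B. of_int (sign (transpos b y \<circ> q)) * of_bool (hook_tabloid S (map (transpos b y \<circ> q) c) = x)) =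
      of_int (sign (transpos b y)) * alt S (transpos b y ` B) (map (transpos b y) c) x"
      unfolding img sum_distrib_left using fin
      by (intro sum.cong refl)
        (simp add: sign_compose permutation_swap_id permutes_imp_permutation[OF fin] mult.assoc)
  qed
  finally show "alt S (insert b B) c x =
    (\<Sum>y\<in>insert b B. fun_scale (of_int (sign (transpos b y))) (alt S (transpos b y ` B) (map (transpos b y) c))) x"
    by (simp add: sum_apply_fun fun_scale_def)
qed

text \<open>The transposition of y and z fixes \<open>c\<close> but reverses the sign, so the vector
  is its own negative.\<close>

lemma alt_eq_0:
  assumes "finite B" "y \<in> B" "z \<in> B" "y \<noteq> z" "y \<notin> set c" "z \<notin> set c"
  shows "alt S B c = 0"
proof -
  have "map (transpos y z) c = c"
    using assms by (intro map_idI) (auto simp: Transposition.transpose_def)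
  with alt_map_permutes[OF assms(1) permutes_swap_id[OF assms(2,3)], of S c]
  have "alt S B c = fun_scale (-1) (alt S B c)"
    using assms(4) by (simp add: sign_swap_id)
  then show ?thesis
    by (auto simp: fun_eq_iff fun_scale_def)
qed

lemma perm_action_alt:
  assumes "finite S" "w permutes S" "finite B"
  shows "perm_action w (alt S B c) = alt S (w ` B) (map w c)"
proof
  fix x
  have w: "inv w (w y) = y" "w (inv w y) = y" for y
    using permutes_inverses[OF assms(2)] by auto
  have img: "w ` (S - A) = S - w ` A" for A
    using permutes_image[OF assms(2)] permutes_inj[OF assms(2)] by (simp add: image_set_diff)
  have "hook_tabloid S c = map (image (inv w)) x \<longleftrightarrow> hook_tabloid S (map w c) = x" for c
  proof -
    have "hook_tabloid S (map w c) = map (image w) (hook_tabloid S c)"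
      by (simp add: hook_tabloid_def img)
    moreover have "map (image w) (map (image (inv w)) x) = x" "map (image (inv w)) (map (image w) y) = y" for y
      by (simp_all add: o_def image_image w)
    ultimately show ?thesis
      by metis
  qed
  then show "perm_action w (alt S B c) x = alt S (w ` B) (map w c) x"
    unfolding alt_image[OF assms] by (simp add: perm_action_def alt_def)
qed

text \<open>Contraction of the first slot with the all-ones functional. For each q only
  \<open>y = q (hd c)\<close> can match, so the head disappears while the alternation over B
  stays.\<close>

lemma sum_alt_Cons:
  assumes "finite S" "B \<subseteq> S" "set c \<subseteq> S" "c \<noteq> []"
  shows "(\<Sum>y\<in>S. alt S B c (hook_tabloid S (y # d))) = alt S B (tl c) (hook_tabloid S d)"
proof -
  have "(\<Sum>y\<in>S. alt S B c (hook_tabloid S (y # d))) =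
    (\<Sum>q | q permutes B. \<Sum>y\<in>S. of_int (sign q) * of_bool (map q c = y # d))"
    unfolding alt_tabloid by (rule sum.swap)
  also have "\<dots> = (\<Sum>q | q permutes B. of_int (sign q) * of_bool (map q (tl c) = d))"
  proof (rule sum.cong[OF refl])
    fix q assume "q \<in> {q. q permutes B}"
    then have "q (hd c) \<in> S"
      using assms permutes_in_image[OF permutes_subset[of q B S]] by (cases c) auto
    moreover have "map q c = y # d \<longleftrightarrow> y = q (hd c) \<and> map q (tl c) = d" for y
      using assms(4) by (cases c) auto
    ultimately show "(\<Sum>y\<in>S. of_int (sign q) * of_bool (map q c = y # d)) = of_int (sign q) * (of_bool (map q (tl c) = d) :: real)"
      using assms(1) by (simp add: of_bool_conj flip: sum_distrib_left)
  qed
  finally show ?thesis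
    by (simp add: alt_tabloid)
qed

text \<open>\<open>p\<close> is the leg length: the first column consists of the corner and p
  further boxes. The companion \<open>wedge_space\<close> is the p-th exterior power of the
  permutation module on S.\<close>

definition hook_space :: "nat set \<Rightarrow> nat \<Rightarrow> (nat set list \<Rightarrow> real) set" where
  "hook_space S p = fun_space.span {alt S (set a) (tl a) | a. distinct a \<and> set a \<subseteq> S \<and> length a = Suc p}"

definition wedge_space :: "nat set \<Rightarrow> nat \<Rightarrow> (nat set list \<Rightarrow> real) set" where
  "wedge_space S p = fun_space.span {alt S (set c) c | c. distinct c \<and> set c \<subseteq> S \<and> length c = p}"

lemma ex_permutes_map_eq:
  assumes "distinct c" "distinct d" "set c = set d"
  shows "\<exists>p. p permutes set c \<and> d = map p c"
proof -
  have len: "length c = length d"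
    using assms by (metis distinct_card)
  define p where "p x = (if x \<in> set c then d ! the_inv_into {..<length c} (nth c) x else x)" for x
  have bijc: "bij_betw (nth c) {..<length c} (set c)" and bijd: "bij_betw (nth d) {..<length c} (set c)"
    using assms len by (auto intro!: bij_betw_nth)
  have "bij_betw (\<lambda>x. d ! the_inv_into {..<length c} (nth c) x) (set c) (set c)"
    using bij_betw_trans[OF bij_betw_the_inv_into[OF bijc] bijd] by (simp add: o_def)
  then have "bij_betw p (set c) (set c)"
    by (rule bij_betw_cong[THEN iffD1, rotated]) (simp add: p_def)
  then have "p permutes set c"
    by (rule bij_imp_permutes) (simp add: p_def)
  moreover have "d = map p c"
  proof (intro nth_equalityI)
    fix i assume "i < length d"
    then have "the_inv_into {..<length c} (nth c) (c ! i) = i"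
      using len by (intro the_inv_into_f_f[OF bij_betw_imp_inj_on[OF bijc]]) simp
    then show "d ! i = map p c ! i"
      using \<open>i < length d\<close> len by (simp add: p_def)
  qed (simp add: len)
  ultimately show ?thesis by blast
qed

lemma perm_action_add: "perm_action w (f + g) = perm_action w f + perm_action w g"
  by (simp add: perm_action_def fun_eq_iff)

lemma perm_action_scale: "perm_action w (fun_scale c f) = fun_scale c (perm_action w f)"
  by (simp add: perm_action_def fun_scale_def fun_eq_iff)

lemma perm_action_span:
  assumes "\<And>g. g \<in> A \<Longrightarrow> perm_action w g \<in> fun_space.span A" "f \<in> fun_space.span A"
  shows "perm_action w f \<in> fun_space.span A"
  using assms(2)
proof (induction rule: fun_space.span_induct_alt)
  case base
  have "perm_action w 0 = 0"
    by (simp add: perm_action_def fun_eq_iff)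
  then show ?case
    using fun_space.span_zero by metis
next
  case (step c g f)
  then show ?case
    unfolding perm_action_add perm_action_scale
    by (intro fun_space.span_add fun_space.span_scale assms(1) step)
qed

lemma alt_map_span:
  assumes "finite B" "p permutes B" "alt S B c \<in> fun_space.span A"
  shows "alt S B (map p c) \<in> fun_space.span A"
  unfolding alt_map_permutes[OF assms(1,2)] by (rule fun_space.span_scale[OF assms(3)])

context
  fixes S :: "nat set" and w :: "nat \<Rightarrow> nat"
  assumes S: "finite S" and w: "w permutes S"
begin

lemma perm_action_hook_space:
  assumes "f \<in> hook_space S p"
  shows "perm_action w f \<in> hook_space S p"
  unfolding hook_space_def
proof (rule perm_action_span[OF _ assms[unfolded hook_space_def]])
  fix g assume "g \<in> {alt S (set a) (tl a) | a. distinct a \<and> set a \<subseteq> S \<and> length a = Suc p}"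
  then obtain a where a: "g = alt S (set a) (tl a)" "distinct a" "set a \<subseteq> S" "length a = Suc p"
    by blast
  have "perm_action w g = alt S (set (map w a)) (tl (map w a))"
    unfolding a by (simp add: perm_action_alt[OF S w] map_tl)
  moreover have "distinct (map w a)" "set (map w a) \<subseteq> S" "length (map w a) = Suc p"
    using a(2-4) inj_on_subset[OF permutes_inj[OF w] subset_UNIV]
    by (auto simp: distinct_map permutes_in_image[OF w])
  ultimately show "perm_action w g \<in> fun_space.span {alt S (set a) (tl a) | a. distinct a \<and> set a \<subseteq> S \<and> length a = Suc p}"
    by (intro fun_space.span_base) blast
qed

lemma perm_action_wedge_space:
  assumes "f \<in> wedge_space S p"
  shows "perm_action w f \<in> wedge_space S p"
  unfolding wedge_space_def
proof (rule perm_action_span[OF _ assms[unfolded wedge_space_def]])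
  fix g assume "g \<in> {alt S (set c) c | c. distinct c \<and> set c \<subseteq> S \<and> length c = p}"
  then obtain c where c: "g = alt S (set c) c" "distinct c" "set c \<subseteq> S" "length c = p"
    by blast
  have "perm_action w g = alt S (set (map w c)) (map w c)"
    unfolding c by (simp add: perm_action_alt[OF S w])
  moreover have "distinct (map w c)" "set (map w c) \<subseteq> S" "length (map w c) = p"
    using c(2-4) inj_on_subset[OF permutes_inj[OF w] subset_UNIV]
    by (auto simp: distinct_map permutes_in_image[OF w])
  ultimately show "perm_action w g \<in> fun_space.span {alt S (set c) c | c. distinct c \<and> set c \<subseteq> S \<and> length c = p}"
    by (intro fun_space.span_base) blast
qed

lemma perm_action_tabloid: "perm_action w f (hook_tabloid S d) = f (hook_tabloid S (map (inv w) d))"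
proof -
  have "inv w ` (S - set d) = S - inv w ` set d"
    using permutes_image[OF permutes_inv[OF w]] permutes_inj[OF permutes_inv[OF w]]
    by (simp add: image_set_diff)
  then show ?thesis
    by (simp add: perm_action_def hook_tabloid_def o_def)
qed

end

text \<open>A term q counts only if it carries the sorted list of J' to that of J. Then J lies in B,
  hence in J', and equal sizes give J = J'. So q fixes J' pointwise, and with it the at most one
  remaining point of B.\<close>

lemma alt_dual:
  assumes "finite B" "J' \<subseteq> B" "B \<subseteq> insert x J'" "B \<inter> J \<subseteq> J'" "finite J" "card J = card J'"
  shows "alt S B (sorted_list_of_set J') (hook_tabloid S (sorted_list_of_set J)) = of_bool (J = J')"
proof -
  have fin: "finite J'"
    using assms(1,2) finite_subset by blast
  have "map q (sorted_list_of_set J') = sorted_list_of_set J \<longleftrightarrow> q = id \<and> J = J'" if q: "q permutes B" for q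
  proof
    assume eq: "map q (sorted_list_of_set J') = sorted_list_of_set J"
    from arg_cong[OF this, of set] have img: "q ` J' = J"
      using fin assms(5) by simp
    then have "J \<subseteq> B"
      using assms(2) permutes_in_image[OF q] by blast
    with assms(4) have "J \<subseteq> J'"
      by blast
    with assms(6) fin have J: "J = J'"
      by (simp add: card_subset_eq)
    with eq have "map q (sorted_list_of_set J') = map id (sorted_list_of_set J')"
      by simp
    then have "\<forall>y\<in>set (sorted_list_of_set J'). q y = id y"
      by (simp only: map_eq_conv)
    then have fixed: "q y = y" if "y \<in> J'" for y
      using that fin by simp
    have "q y = y" for y
    proof (cases "y \<in> B - J'")
      case True
      then have "q y \<in> B - J'"
        using permutes_in_image[OF q] fixed permutes_inj[OF q] by (metis Diff_iff injD)
      with True assms(3) show ?thesis by blast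
    next
      case False
      with fixed permutes_not_in[OF q] assms(2) show ?thesis by blast
    qed
    with J show "q = id \<and> J = J'" by auto
  qed auto
  then have "alt S B (sorted_list_of_set J') (hook_tabloid S (sorted_list_of_set J)) =
    (\<Sum>q | q permutes B. if q = id then of_bool (J = J') else 0)"
    unfolding alt_tabloid by (intro sum.cong refl) auto
  then show ?thesis
    using assms(1) by (simp add: finite_permutations permutes_id)
qed

context
  fixes S :: "nat set" and w :: "nat \<Rightarrow> nat"
  assumes S: "finite S" and w: "w permutes S"
begin

lemma trace_wedge_space:
  "trace_on (wedge_space S p) (perm_action w) =
    (\<Sum>K | K \<subseteq> S \<and> card K = p. alt S K (sorted_list_of_set K) (hook_tabloid S (map (inv w) (sorted_list_of_set K))))"
proof -
  let ?I = "{K. K \<subseteq> S \<and> card K = p}" and ?b = "\<lambda>K. alt S K (sorted_list_of_set K)"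
  have fin: "finite K" if "K \<subseteq> S" for K
    using that S finite_subset by blast
  have "trace_on (wedge_space S p) (perm_action w) = (\<Sum>K\<in>?I. perm_action w (?b K) (hook_tabloid S (sorted_list_of_set K)))"
  proof (rule trace_on_dual_basis[of _ ?b _ "\<lambda>K f. f (hook_tabloid S (sorted_list_of_set K))"])
    show "finite ?I"
      using S by simp
    show "fun_space.span (?b ` ?I) = wedge_space S p"
      unfolding wedge_space_def
    proof (rule fun_space.span_eq[THEN iffD2], intro conjI subsetI)
      fix f assume "f \<in> ?b ` ?I"
      then obtain K where K: "K \<subseteq> S" "card K = p" "f = ?b K"
        by blast
      with fin[OF K(1)] have "f = alt S (set (sorted_list_of_set K)) (sorted_list_of_set K)" "distinct (sorted_list_of_set K)" "set (sorted_list_of_set K) \<subseteq> S" "length (sorted_list_of_set K) = p"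
        by auto
      then show "f \<in> fun_space.span {alt S (set c) c | c. distinct c \<and> set c \<subseteq> S \<and> length c = p}"
        by (intro fun_space.span_base) blast
    next
      fix f assume "f \<in> {alt S (set c) c | c. distinct c \<and> set c \<subseteq> S \<and> length c = p}"
      then obtain c where c: "f = alt S (set c) c" "distinct c" "set c \<subseteq> S" "length c = p"
        by blast
      obtain q where q: "q permutes set c" "c = map q (sorted_list_of_set (set c))"
        using ex_permutes_map_eq[of "sorted_list_of_set (set c)" c] c(2) by auto
      have "set c \<in> ?I"
        using c by (simp add: distinct_card)
      then have "alt S (set c) (map q (sorted_list_of_set (set c))) \<in> fun_space.span (?b ` ?I)"
        using q(1) by (intro alt_map_span fun_space.span_base imageI) auto
      then show "f \<in> fun_space.span (?b ` ?I)"
        using q(2) c(1) by simp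
    qed
    \<comment> \<open>The alternation is over K' itself, so the extra point allowed by
      \<open>alt_dual\<close> is a dummy 0.\<close>
    show "?b K' (hook_tabloid S (sorted_list_of_set K)) = of_bool (K = K')" if "K \<in> ?I" "K' \<in> ?I" for K K'
      using that fin by (intro alt_dual[of _ _ 0]) auto
  qed (rule perm_action_add perm_action_scale perm_action_wedge_space[OF S w] | assumption | simp add: fun_scale_def)+
  then show ?thesis
    by (simp add: perm_action_tabloid[OF S w])
qed

end

context
  fixes S :: "nat set" and w :: "nat \<Rightarrow> nat" and x0 :: nat
  assumes S: "finite S" and w: "w permutes S" and x0: "x0 \<in> S"
begin

abbreviation "ksets p \<equiv> {J. J \<subseteq> S - {x0} \<and> card J = p}"
abbreviation "sl \<equiv> sorted_list_of_set :: nat set \<Rightarrow> nat list"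
text \<open>Bases attached to a fixed x0 in S: \<open>hb J\<close> is the polytabloid with first
  column x0 followed by J (a standard one when x0 is least in S), and \<open>wb L\<close> is the
  wedge of x0 with the elements of L.\<close>

abbreviation "hb J \<equiv> alt S (insert x0 J) (sl J)"
abbreviation "wb L \<equiv> alt S (insert x0 L) (x0 # sl L)"

lemma finite_ksets: "finite (ksets p)"
  using S by simp

lemma finite_of_subset: "J \<subseteq> S - {x0} \<Longrightarrow> finite J"
  using S finite_subset by blast

text \<open>A list through x0 is a rearrangement of \<open>x0 # sl J\<close>, so up to sign it gives
  one of the basis vectors.\<close>

lemma alt_head:
  assumes a: "distinct a" "set a \<subseteq> S" "length a = Suc p" "x0 \<in> set a"
  shows "alt S (set a) (tl a) \<in> fun_space.span (hb ` ksets p)"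
    and "alt S (set a) a \<in> fun_space.span (wb ` ksets p)"
proof -
  define J where "J = set a - {x0}"
  have J: "finite J" "x0 \<notin> J" "insert x0 J = set a" "J \<subseteq> S - {x0}"
    using a(2,4) by (auto simp: J_def)
  have "card (set a) = Suc p"
    using a(1,3) by (simp add: distinct_card)
  then have "card J = p"
    using a(4) by (simp add: J_def)
  with J have JI: "J \<in> ksets p"
    by simp
  have "distinct (x0 # sl J)" "set (x0 # sl J) = set a"
    using J by auto
  from ex_permutes_map_eq[OF this(1) a(1) this(2)] obtain q
    where q: "q permutes set (x0 # sl J)" "a = map q (x0 # sl J)"
    by blast
  then have q': "q permutes insert x0 J"
    using J by simp
  have "alt S (insert x0 J) (map q (sl J)) \<in> fun_space.span (hb ` ksets p)"
    using J(1) q' JI by (intro alt_map_span fun_space.span_base imageI) auto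
  then show "alt S (set a) (tl a) \<in> fun_space.span (hb ` ksets p)"
    unfolding J(3) by (subst (2) q(2)) simp
  have "alt S (insert x0 J) (map q (x0 # sl J)) \<in> fun_space.span (wb ` ksets p)"
    using J(1) q' JI by (intro alt_map_span fun_space.span_base imageI) auto
  then show "alt S (set a) a \<in> fun_space.span (wb ` ksets p)"
    unfolding J(3) by (subst (2) q(2))
qed

text \<open>This is \<open>alt_insert\<close> with b = x0, solved for the summand y = x0, whose
  transposition is trivial. All other summands have x0 swapped in, so it works as a straightening
  rule that brings x0 into the column.\<close>

lemma alt_replace_x0:
  assumes c: "x0 \<notin> set c" "set c \<subseteq> S" and d: "set d \<subseteq> set c"
  shows "alt S (set c) d = alt S (insert x0 (set c)) d +
    (\<Sum>y\<in>set c. fun_scale (- of_int (sign (transpos x0 y))) (alt S (set (map (transpos x0 y) c)) (map (transpos x0 y) d)))"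
proof -
  have "alt S (insert x0 (set c)) d = (\<Sum>y\<in>insert x0 (set c). fun_scale (of_int (sign (transpos x0 y)))
      (alt S (transpos x0 y ` set c) (map (transpos x0 y) d)))"
    using c d x0 by (intro alt_insert[OF S]) auto
  also have "\<dots> = alt S (set c) d + (\<Sum>y\<in>set c. fun_scale (of_int (sign (transpos x0 y)))
      (alt S (transpos x0 y ` set c) (map (transpos x0 y) d)))"
  proof -
    have "transpos x0 x0 = id"
      by (simp add: fun_eq_iff Transposition.transpose_def)
    then show ?thesis
      using c(1) by (simp add: fun_scale_def)
  qed
  finally show ?thesis
    by (simp add: fun_eq_iff sum_apply_fun fun_scale_def sum_negf)
qed

lemma swap_list:
  assumes "distinct c" "set c \<subseteq> S" "y \<in> set c"
  shows "distinct (map (transpos x0 y) c)" "set (map (transpos x0 y) c) \<subseteq> S" "x0 \<in> set (map (transpos x0 y) c)"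
proof -
  have "transpos x0 y permutes S"
    using assms x0 by (intro permutes_swap_id) auto
  with assms(2) show "set (map (transpos x0 y) c) \<subseteq> S"
    by (auto simp: permutes_in_image)
  show "distinct (map (transpos x0 y) c)"
    using assms(1) inj_on_subset[OF permutes_inj[OF \<open>transpos x0 y permutes S\<close>] subset_UNIV]
    by (simp add: distinct_map)
  show "x0 \<in> set (map (transpos x0 y) c)"
    using imageI[OF assms(3), of "transpos x0 y"] by simp
qed

text \<open>A column without x0 is straightened by \<open>alt_replace_x0\<close>. The leading term
  there vanishes because x0 and the corner entry are both missing from the leg, so only columns
  through x0 remain.\<close>

lemma span_hook: "fun_space.span (hb ` ksets p) = hook_space S p"
  unfolding hook_space_def
proof (rule fun_space.span_eq[THEN iffD2], intro conjI subsetI)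
  fix f assume "f \<in> hb ` ksets p"
  then obtain J where J: "J \<subseteq> S - {x0}" "card J = p" "f = hb J"
    by blast
  with finite_of_subset[OF J(1)] x0 have "f = alt S (set (x0 # sl J)) (tl (x0 # sl J))" "distinct (x0 # sl J)"
    "set (x0 # sl J) \<subseteq> S" "length (x0 # sl J) = Suc p"
    by auto
  then show "f \<in> fun_space.span {alt S (set a) (tl a) | a. distinct a \<and> set a \<subseteq> S \<and> length a = Suc p}"
    by (intro fun_space.span_base) blast
next
  fix f assume "f \<in> {alt S (set a) (tl a) | a. distinct a \<and> set a \<subseteq> S \<and> length a = Suc p}"
  then obtain a where a: "f = alt S (set a) (tl a)" "distinct a" "set a \<subseteq> S" "length a = Suc p"
    by blast
  show "f \<in> fun_space.span (hb ` ksets p)"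
  proof (cases "x0 \<in> set a")
    case True
    with a alt_head show ?thesis by blast
  next
    case False
    obtain h r where hr: "a = h # r"
      using a(4) by (cases a) auto
    have "alt S (insert x0 (set a)) (tl a) = 0"
      using False a(2) by (intro alt_eq_0[of _ x0 h]) (auto simp: hr)
    moreover have "set (tl a) \<subseteq> set a"
      by (auto simp: hr)
    ultimately have "f = (\<Sum>y\<in>set a. fun_scale (- of_int (sign (transpos x0 y)))
        (alt S (set (map (transpos x0 y) a)) (tl (map (transpos x0 y) a))))"
      using alt_replace_x0[OF False a(3)] unfolding a(1) by (simp add: map_tl)
    also have "\<dots> \<in> fun_space.span (hb ` ksets p)"
      using swap_list[OF a(2,3)] a(4)
      by (intro fun_space.span_sum fun_space.span_scale alt_head) auto
    finally show ?thesis .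
  qed
qed

lemma trace_hook_space:
  "trace_on (hook_space S p) (perm_action w) = (\<Sum>J\<in>ksets p. hb J (hook_tabloid S (map (inv w) (sl J))))"
proof -
  have "trace_on (hook_space S p) (perm_action w) = (\<Sum>J\<in>ksets p. perm_action w (hb J) (hook_tabloid S (sl J)))"
  proof (rule trace_on_dual_basis[of _ hb _ "\<lambda>J f. f (hook_tabloid S (sl J))"])
    show "finite (ksets p)" "fun_space.span (hb ` ksets p) = hook_space S p"
      by (rule finite_ksets, rule span_hook)
    show "hb J' (hook_tabloid S (sl J)) = of_bool (J = J')" if "J \<in> ksets p" "J' \<in> ksets p" for J J'
      using that finite_of_subset by (intro alt_dual[of _ _ x0]) auto
  qed (rule perm_action_add perm_action_scale perm_action_hook_space[OF S w] | assumption | simp add: fun_scale_def)+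
  then show ?thesis
    by (simp add: perm_action_tabloid[OF S w])
qed

text \<open>
  The contraction \<open>f \<mapsto> (d \<mapsto> \<Sum>y\<in>S. f (y # d))\<close> kills every \<open>hb J\<close> and sends \<open>wb L\<close> to \<open>hb L\<close>, so it
  supplies the functionals dual to the \<open>wb L\<close> and identifies the quotient with the next hook module.
\<close>

lemma trace_wedge_hook:
  "trace_on (wedge_space S p) (perm_action w) = trace_on (hook_space S p) (perm_action w) +
    (if p = 0 then 0 else trace_on (hook_space S (p - 1)) (perm_action w))"
proof -
  \<comment> \<open>For p = 0 there is no \<open>wb\<close> vector. The case split is essential:
    \<open>p - 1\<close> would again be 0, and \<open>ksets 0\<close> is not empty.\<close>
  define K where "K = (if p = 0 then {} else ksets (p - 1))"
  define b where "b = case_sum hb wb"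
  define \<phi> :: "nat set + nat set \<Rightarrow> (nat set list \<Rightarrow> real) \<Rightarrow> real" where
    "\<phi> = case_sum (\<lambda>J f. f (hook_tabloid S (sl J))) (\<lambda>L f. \<Sum>y\<in>S. f (hook_tabloid S (y # sl L)))"
  have K: "L \<subseteq> S - {x0}" "finite L" "Suc (card L) = p" "x0 \<notin> L" if "L \<in> K" for L
    using that finite_of_subset by (auto simp: K_def split: if_splits)
  have finK: "finite K"
    using finite_ksets by (simp add: K_def)
  have b_range: "b ` (ksets p <+> K) = hb ` ksets p \<union> wb ` K"
    by (simp add: b_def Plus_def image_Un image_image)
  have "trace_on (wedge_space S p) (perm_action w) = (\<Sum>i\<in>ksets p <+> K. \<phi> i (perm_action w (b i)))"
  proof (rule trace_on_dual_basis)
    show "finite (ksets p <+> K)"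
      using finite_ksets finK by simp
    show "fun_space.span (b ` (ksets p <+> K)) = wedge_space S p"
      unfolding wedge_space_def b_range
    proof (rule fun_space.span_eq[THEN iffD2], intro conjI subsetI)
      let ?W = "{alt S (set c) c | c. distinct c \<and> set c \<subseteq> S \<and> length c = p}"
      have W: "alt S (set c) c \<in> fun_space.span ?W" if "distinct c" "set c \<subseteq> S" "length c = p" for c
        using that by (intro fun_space.span_base) blast
      fix f assume "f \<in> hb ` ksets p \<union> wb ` K"
      then consider J where "J \<in> ksets p" "f = hb J" | L where "L \<in> K" "f = wb L"
        by blast
      then show "f \<in> fun_space.span ?W"
      proof cases
        case 1
        define c where "c = sl J"
        have J: "finite J" "x0 \<notin> J" "J \<subseteq> S" "card J = p"
          using 1 finite_of_subset by auto
        then have c: "distinct c" "set c = J" "length c = p"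
          by (simp_all add: c_def)
        \<comment> \<open>\<open>alt_replace_x0\<close> read backwards turns \<open>hb J\<close>
          into a sum of wedges.\<close>
        have "alt S (insert x0 (set c)) c = alt S (set c) c + (\<Sum>y\<in>set c. fun_scale (of_int (sign (transpos x0 y)))
           (alt S (set (map (transpos x0 y) c)) (map (transpos x0 y) c)))"
          using alt_replace_x0[of c c] J c(2)
          by (simp add: fun_eq_iff sum_apply_fun fun_scale_def sum_negf)
        also have "\<dots> \<in> fun_space.span ?W"
          using swap_list[OF c(1)] c J
          by (intro fun_space.span_add fun_space.span_sum fun_space.span_scale W) auto
        finally show ?thesis
          unfolding 1(2) c_def [symmetric] c(2) .
      next
        case 2
        have "f = alt S (set (x0 # sl L)) (x0 # sl L)"
          using K[OF 2(1)] 2(2) by simp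
        then show ?thesis
          using K[OF 2(1)] x0 W[of "x0 # sl L"] by auto
      qed
    next
      let ?B = "fun_space.span (hb ` ksets p \<union> wb ` K)"
      have mono: "fun_space.span (wb ` K) \<subseteq> ?B" "fun_space.span (hb ` ksets p) \<subseteq> ?B"
        by (intro fun_space.span_mono; blast)+
      have head: "alt S (set c) c \<in> ?B" if "distinct c" "set c \<subseteq> S" "length c = p" "x0 \<in> set c" for c
      proof -
        have "p \<noteq> 0"
          using that by auto
        then have "alt S (set c) c \<in> fun_space.span (wb ` K)"
          unfolding K_def using that alt_head(2)[of c "p - 1"] by simp
        with mono show ?thesis by blast
      qed
      fix f assume "f \<in> {alt S (set c) c | c. distinct c \<and> set c \<subseteq> S \<and> length c = p}"
      then obtain c where c: "f = alt S (set c) c" "distinct c" "set c \<subseteq> S" "length c = p"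
        by blast
      show "f \<in> ?B"
      proof (cases "x0 \<in> set c")
        case True
        with c head show ?thesis by blast
      next
        case False
        obtain q where q: "q permutes set c" "c = map q (sl (set c))"
          using ex_permutes_map_eq[of "sl (set c)" c] c(2) by auto
        \<comment> \<open>The straightening rule writes the wedge of c as an \<open>hb\<close>
          vector, up to sign, plus wedges of lists through x0.\<close>
        have "hb (set c) \<in> fun_space.span (hb ` ksets p)"
          using c False by (intro fun_space.span_base imageI) (auto simp: distinct_card)
        then have "alt S (insert x0 (set c)) (map q (sl (set c))) \<in> fun_space.span (hb ` ksets p)"
          using permutes_subset[OF q(1)] by (intro alt_map_span) auto
        then have "alt S (insert x0 (set c)) c \<in> ?B"
          using q(2) mono by auto
        then show ?thesis
          unfolding c(1) alt_replace_x0[OF False c(3) subset_refl]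
          using swap_list[OF c(2,3)] c(4)
          by (intro fun_space.span_add fun_space.span_sum fun_space.span_scale head) auto
      qed
    qed
    fix i j assume ij: "i \<in> ksets p <+> K" "j \<in> ksets p <+> K"
    show "\<phi> i (b j) = of_bool (i = j)"
    proof (cases i; cases j)
      fix J J' assume i: "i = Inl J" and j: "j = Inl J'"
      then have J: "J \<subseteq> S - {x0}" "J' \<subseteq> S - {x0}" "card J = p" "card J' = p" "finite J" "finite J'"
        using ij finite_of_subset by auto
      have "hb J' (hook_tabloid S (sl J)) = of_bool (J = J')"
        using J by (intro alt_dual[of _ _ x0]) auto
      then show ?thesis
        by (simp add: i j \<phi>_def b_def)
    next
      fix J L assume i: "i = Inl J" and j: "j = Inr L"
      then have J: "x0 \<notin> J" "finite J" and L: "finite L"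
        using ij finite_of_subset K by auto
      \<comment> \<open>Every list occurring in \<open>wb L\<close> contains x0, so none of them is
        \<open>sl J\<close>.\<close>
      have "map q (x0 # sl L) \<noteq> sl J" if q: "q permutes insert x0 L" for q
      proof
        assume "map q (x0 # sl L) = sl J"
        from arg_cong[OF this, of set] have "q ` insert x0 L = J"
          using J L by simp
        then have "insert x0 L = J"
          by (simp only: permutes_image[OF q])
        with J(1) show False by blast
      qed
      then show ?thesis
        unfolding i j \<phi>_def b_def by (simp only: sum.case alt_tabloid) (simp add: sum.neutral)
    next
      fix L J assume i: "i = Inr L" and j: "j = Inl J"
      then have J: "J \<subseteq> S - {x0}" "card J = p" "finite J" and L: "L \<in> K"
        using ij finite_of_subset by auto
      from K(3)[OF L] have p: "p \<noteq> 0"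
        by simp
      with J have "length (sl J) \<noteq> 0"
        by simp
      then obtain h r where hr: "sl J = h # r"
        by (cases "sl J") simp_all
      then have h: "h \<in> J" "h \<notin> set r" "set r \<subseteq> J"
        using J(3) set_sorted_list_of_set[of J] distinct_sorted_list_of_set[of J] by auto
      have "\<phi> i (b j) = alt S (insert x0 J) (tl (sl J)) (hook_tabloid S (sl L))"
        unfolding i j \<phi>_def b_def sum.case using J h x0
        by (intro sum_alt_Cons[OF S]) (auto simp: hr)
      \<comment> \<open>The contraction has removed the head h, so x0 and h are both missing from
        the list.\<close>
      also have "alt S (insert x0 J) (tl (sl J)) = 0"
        using h J by (intro alt_eq_0[of _ x0 h]) (auto simp: hr)
      finally show ?thesis
        by (simp add: i j)
    next
      fix L L' assume i: "i = Inr L" and j: "j = Inr L'"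
      then have L: "L \<in> K" "L' \<in> K"
        using ij by auto
      have "\<phi> i (b j) = alt S (insert x0 L') (tl (x0 # sl L')) (hook_tabloid S (sl L))"
        unfolding i j \<phi>_def b_def sum.case using K[OF L(2)] x0
        by (intro sum_alt_Cons[OF S]) auto
      also have "\<dots> = of_bool (L = L')"
        using K[OF L(1)] K[OF L(2)] unfolding list.sel by (intro alt_dual[of _ _ x0]) auto
      finally show ?thesis
        by (simp add: i j)
    qed
  next
    fix i f g c
    show "\<phi> i (f + g) = \<phi> i f + \<phi> i g"
      by (cases i) (simp_all add: \<phi>_def sum.distrib)
    show "\<phi> i (fun_scale c f) = c * \<phi> i f"
      by (cases i) (simp_all add: \<phi>_def fun_scale_def sum_distrib_left)
  next
    show "perm_action w (f + g) = perm_action w f + perm_action w g" for f g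
      by (rule perm_action_add)
    show "perm_action w (fun_scale c f) = fun_scale c (perm_action w f)" for c f
      by (rule perm_action_scale)
    show "perm_action w f \<in> wedge_space S p" if "f \<in> wedge_space S p" for f
      using that by (rule perm_action_wedge_space[OF S w])
  qed
  also have "\<dots> = (\<Sum>J\<in>ksets p. \<phi> (Inl J) (perm_action w (hb J))) + (\<Sum>L\<in>K. \<phi> (Inr L) (perm_action w (wb L)))"
    by (simp only: sum.Plus[OF finite_ksets finK] o_def b_def sum.case)
  also have "(\<Sum>J\<in>ksets p. \<phi> (Inl J) (perm_action w (hb J))) = trace_on (hook_space S p) (perm_action w)"
    by (simp add: trace_hook_space \<phi>_def perm_action_tabloid[OF S w])
  also have "(\<Sum>L\<in>K. \<phi> (Inr L) (perm_action w (wb L))) = (\<Sum>L\<in>K. hb L (hook_tabloid S (map (inv w) (sl L))))"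
  proof (rule sum.cong[OF refl])
    fix L assume "L \<in> K"
    note L = K[OF this]
    have "\<phi> (Inr L) (perm_action w (wb L)) = (\<Sum>y\<in>S. wb L (hook_tabloid S (inv w y # map (inv w) (sl L))))"
      by (simp add: \<phi>_def perm_action_tabloid[OF S w])
    \<comment> \<open>The all-ones functional is invariant under w, so the contraction commutes with
      the action.\<close>
    also have "\<dots> = (\<Sum>y\<in>S. wb L (hook_tabloid S (y # map (inv w) (sl L))))"
      by (rule sum.permute[OF permutes_inv[OF w], symmetric, unfolded o_def])
    also have "\<dots> = alt S (insert x0 L) (tl (x0 # sl L)) (hook_tabloid S (map (inv w) (sl L)))"
      using L x0 by (intro sum_alt_Cons[OF S]) auto
    finally show "\<phi> (Inr L) (perm_action w (wb L)) = hb L (hook_tabloid S (map (inv w) (sl L)))"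
      by simp
  qed
  also have "\<dots> = (if p = 0 then 0 else trace_on (hook_space S (p - 1)) (perm_action w))"
    by (simp add: K_def trace_hook_space)
  finally show ?thesis .
qed

end

section \<open>Hook immanants as sums of minors\<close>

text \<open>The inner sum is the sign of \<open>inv w\<close> on K if w maps K to itself, and 0
  otherwise: the character that is sign on K and trivial on its complement, induced from the Young
  subgroup.\<close>

lemma trace_wedge_space_sum:
  assumes "finite S" "w permutes S"
  shows "trace_on (wedge_space S p) (perm_action w) =
    (\<Sum>K | K \<subseteq> S \<and> card K = p. \<Sum>q | q permutes K. of_int (sign q) * of_bool (\<forall>x\<in>K. q x = inv w x))"
  unfolding trace_wedge_space[OF assms]
proof (intro sum.cong refl)
  fix K assume "K \<in> {K. K \<subseteq> S \<and> card K = p}"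
  then have "finite K"
    using assms(1) finite_subset by blast
  then have "map q (sorted_list_of_set K) = map (inv w) (sorted_list_of_set K) \<longleftrightarrow> (\<forall>x\<in>K. q x = inv w x)" for q
    unfolding map_eq_conv by simp
  then show "alt S K (sorted_list_of_set K) (hook_tabloid S (map (inv w) (sorted_list_of_set K))) =
    (\<Sum>q | q permutes K. of_int (sign q) * of_bool (\<forall>x\<in>K. q x = inv w x))"
    by (simp only: alt_tabloid)
qed

lemma trace_hook_space_0:
  assumes "finite S" "w permutes S" "S \<noteq> {}"
  shows "trace_on (hook_space S 0) (perm_action w) = 1"
proof -
  obtain x0 where x0: "x0 \<in> S"
    using assms(3) by blast
  have "{J. J \<subseteq> S - {x0} \<and> card J = 0} = {{}}"
    using assms(1) by (auto simp: card_eq_0_iff dest: finite_subset)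
  then show ?thesis
    unfolding trace_hook_space[OF assms(1,2) x0] by (simp add: alt_tabloid)
qed

text \<open>A leg would have to avoid x0 and still have \<open>card S\<close> elements. This is
  where the telescoping sum of the characters ends.\<close>

lemma trace_hook_space_card:
  assumes "finite S" "w permutes S" "S \<noteq> {}"
  shows "trace_on (hook_space S (card S)) (perm_action w) = 0"
proof -
  obtain x0 where x0: "x0 \<in> S"
    using assms(3) by blast
  have "card J \<noteq> card S" if "J \<subseteq> S - {x0}" for J
  proof -
    have "J \<subset> S"
      using that x0 by auto
    from psubset_card_mono[OF assms(1) this] show ?thesis by simp
  qed
  then have "{J. J \<subseteq> S - {x0} \<and> card J = card S} = {}"
    by simp
  then show ?thesis
    unfolding trace_hook_space[OF assms(1,2) x0] by (simp only: sum.empty)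
qed

text \<open>Each wedge trace is the sum of the hook traces for p and p - 1, so the partial sums
  telescope to a single hook trace.\<close>

lemma alternating_trace_wedge_space:
  assumes "finite S" "w permutes S" "S \<noteq> {}"
  shows "(\<Sum>p\<le>card S. (-1) ^ p * trace_on (wedge_space S p) (perm_action w)) = 0"
proof -
  obtain x0 where x0: "x0 \<in> S"
    using assms(3) by blast
  have "(\<Sum>p\<le>m. (-1) ^ p * trace_on (wedge_space S p) (perm_action w)) =
    (-1) ^ m * trace_on (hook_space S m) (perm_action w)" for m
    by (induction m) (simp_all add: trace_wedge_hook[OF assms(1,2) x0] algebra_simps)
  then show ?thesis
    using trace_hook_space_card[OF assms] by simp
qed

text \<open>q agrees with \<open>inv w\<close> on K exactly if w restricts to \<open>inv q\<close>
  there. Then w is \<open>inv q\<close> on K together with \<open>q \<circ> w\<close>, which moves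
  only points outside K. The first factor carries the sign and builds the determinant, the second
  the permanent.\<close>

lemma sum_permutes_det_per:
  fixes A :: "nat \<Rightarrow> nat \<Rightarrow> real"
  assumes S: "finite S" and K: "K \<subseteq> S"
  shows "(\<Sum>w | w permutes S. (\<Sum>q | q permutes K. of_int (sign q) * of_bool (\<forall>x\<in>K. q x = inv w x)) * (\<Prod>i\<in>S. A i (w i))) =
    det_on K A * per_on (S - K) A"
proof -
  have fin: "finite K" "finite (S - K)"
    using S K finite_subset by auto
  define X where "X = {(w, q). w permutes S \<and> q permutes K \<and> (\<forall>x\<in>K. q x = inv w x)}"
  have "(\<Sum>w | w permutes S. (\<Sum>q | q permutes K. of_int (sign q) * of_bool (\<forall>x\<in>K. q x = inv w x)) * (\<Prod>i\<in>S. A i (w i))) =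
    (\<Sum>(w, q)\<in>{w. w permutes S} \<times> {q. q permutes K}. of_int (sign q) * of_bool (\<forall>x\<in>K. q x = inv w x) * (\<Prod>i\<in>S. A i (w i)))"
    by (simp add: sum_distrib_right sum.cartesian_product)
  also have "\<dots> = (\<Sum>(w, q)\<in>X. of_int (sign q) * (\<Prod>i\<in>S. A i (w i)))"
    using S fin by (intro sum.mono_neutral_cong_right) (auto simp: X_def finite_permutations)
  also have "\<dots> = (\<Sum>(q, r)\<in>{q. q permutes K} \<times> {r. r permutes S - K}.
      of_int (sign q) * (\<Prod>i\<in>K. A i (q i)) * (\<Prod>i\<in>S - K. A i (r i)))"
  proof -
    have fwd: "q \<circ> w permutes S - K \<and> inv q permutes K \<and> inv q \<circ> (q \<circ> w) = w \<and> inv (inv q) = q \<and>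
        of_int (sign (inv q)) * (\<Prod>i\<in>K. A i (inv q i)) * (\<Prod>i\<in>S - K. A i (q (w i))) =
        of_int (sign q) * (\<Prod>i\<in>S. A i (w i))"
      if "(w, q) \<in> X" for w q
    proof -
      from that have w: "w permutes S" and q: "q permutes K" and eq: "\<And>x. x \<in> K \<Longrightarrow> q x = inv w x"
        by (auto simp: X_def)
      note invq = permutes_inverses[OF q] and invw = permutes_inverses[OF w]
      have wK: "w y = inv q y" if "y \<in> K" for y
      proof -
        have "inv q y \<in> K"
          using permutes_in_image[OF permutes_inv[OF q]] that by blast
        from eq[OF this] show "w y = inv q y"
          using invq invw by metis
      qed
      have "q \<circ> w permutes S"
        using w permutes_subset[OF q K] by (rule permutes_compose)
      then have r: "q \<circ> w permutes S - K"
        by (rule permutes_superset) (use wK invq in auto)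
      have "(\<Prod>i\<in>S. A i (w i)) = (\<Prod>i\<in>K. A i (w i)) * (\<Prod>i\<in>S - K. A i (w i))"
        using prod.subset_diff[OF K S] by (simp add: mult.commute)
      also have "(\<Prod>i\<in>K. A i (w i)) = (\<Prod>i\<in>K. A i (inv q i))"
        by (intro prod.cong refl) (simp add: wK)
      also have "(\<Prod>i\<in>S - K. A i (w i)) = (\<Prod>i\<in>S - K. A i (q (w i)))"
      proof (rule prod.cong[OF refl])
        fix i assume "i \<in> S - K"
        then have "q (w i) \<notin> K"
          using permutes_in_image[OF r, of i] by simp
        then have "w i \<notin> K"
          using permutes_in_image[OF q] by blast
        then show "A i (w i) = A i (q (w i))"
          by (simp add: permutes_not_in[OF q])
      qed
      moreover have "sign (inv q) = sign q"
        by (rule sign_inverse) (rule permutes_imp_permutation[OF fin(1) q])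
      ultimately show ?thesis
        using r permutes_inv[OF q] permutes_inv_inv[OF q] by (simp add: fun_eq_iff invq)
    qed
    have bwd: "(q \<circ> r, inv q) \<in> X \<and> inv (inv q) = q \<and> inv q \<circ> (q \<circ> r) = r"
      if q: "q permutes K" and r: "r permutes S - K" for q r
    proof -
      note invq = permutes_inverses[OF q]
      have qr: "q \<circ> r permutes S"
        using permutes_subset[OF r] permutes_subset[OF q K] by (intro permutes_compose) auto
      have "inv q x = inv (q \<circ> r) x" if "x \<in> K" for x
      proof -
        have "inv q x \<in> K"
          using permutes_in_image[OF permutes_inv[OF q]] that by blast
        then have "(q \<circ> r) (inv q x) = x"
          using permutes_not_in[OF r] by (simp add: invq)
        then show ?thesis
          by (metis permutes_inverses(2)[OF qr])
      qed
      then show ?thesis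
        using qr permutes_inv[OF q] permutes_inv_inv[OF q] by (simp add: X_def fun_eq_iff invq)
    qed
    show ?thesis
      by (rule sum.reindex_bij_witness[of _ "\<lambda>(q, r). (q \<circ> r, inv q)" "\<lambda>(w, q). (inv q, q \<circ> w)"];
        clarsimp simp: fwd bwd)
  qed
  also have "\<dots> = det_on K A * per_on (S - K) A"
    unfolding det_on_def per_on_def sum_product sum.cartesian_product ..
  finally show ?thesis .
qed

lemma sum_trace_wedge_space:
  fixes A :: "nat \<Rightarrow> nat \<Rightarrow> real"
  assumes S: "finite S"
  shows "(\<Sum>w | w permutes S. trace_on (wedge_space S p) (perm_action w) * (\<Prod>i\<in>S. A i (w i))) =
    (\<Sum>K | K \<subseteq> S \<and> card K = p. det_on K A * per_on (S - K) A)"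
proof -
  have "(\<Sum>w | w permutes S. trace_on (wedge_space S p) (perm_action w) * (\<Prod>i\<in>S. A i (w i))) =
    (\<Sum>w | w permutes S. \<Sum>K | K \<subseteq> S \<and> card K = p.
      (\<Sum>q | q permutes K. of_int (sign q) * of_bool (\<forall>x\<in>K. q x = inv w x)) * (\<Prod>i\<in>S. A i (w i)))"
    by (intro sum.cong refl) (simp add: trace_wedge_space_sum[OF S] sum_distrib_right)
  also have "\<dots> = (\<Sum>K | K \<subseteq> S \<and> card K = p. \<Sum>w | w permutes S.
      (\<Sum>q | q permutes K. of_int (sign q) * of_bool (\<forall>x\<in>K. q x = inv w x)) * (\<Prod>i\<in>S. A i (w i)))"
    by (rule sum.swap)
  also have "\<dots> = (\<Sum>K | K \<subseteq> S \<and> card K = p. det_on K A * per_on (S - K) A)"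
    by (intro sum.cong refl sum_permutes_det_per[OF S]) auto
  finally show ?thesis .
qed

text \<open>Muir's identity. It is the vanishing alternating sum of the exterior power characters,
  weighted with the matrix products and summed over w.\<close>

lemma alternating_det_per:
  fixes A :: "nat \<Rightarrow> nat \<Rightarrow> real"
  assumes S: "finite S" "S \<noteq> {}"
  shows "(\<Sum>K\<in>Pow S. (-1) ^ card K * (det_on K A * per_on (S - K) A)) = 0"
proof -
  have "(\<Sum>K\<in>Pow S. (-1) ^ card K * (det_on K A * per_on (S - K) A)) =
    (\<Sum>p\<le>card S. \<Sum>K | K \<in> Pow S \<and> card K = p. (-1) ^ card K * (det_on K A * per_on (S - K) A))"
    using S(1) by (intro sum.group [symmetric]) (auto intro: card_mono)
  also have "\<dots> = (\<Sum>p\<le>card S. \<Sum>w | w permutes S. (-1) ^ p * (trace_on (wedge_space S p) (perm_action w) * (\<Prod>i\<in>S. A i (w i))))"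
    by (intro sum.cong refl) (simp add: sum_trace_wedge_space[OF S(1)] flip: sum_distrib_left)
  also have "\<dots> = (\<Sum>w | w permutes S. (\<Sum>p\<le>card S. (-1) ^ p * trace_on (wedge_space S p) (perm_action w)) * (\<Prod>i\<in>S. A i (w i)))"
    by (subst sum.swap) (simp add: sum_distrib_right mult.assoc)
  also have "\<dots> = 0"
    by (intro sum.neutral ballI) (simp add: alternating_trace_wedge_space[OF S(1) _ S(2)])
  finally show ?thesis .
qed

section \<open>Polytabloids and immanants of hook shape\<close>

lemma diagram_hook:
  assumes "1 \<le> k" "k \<le> n"
  shows "diagram (hook n k) = {1} \<times> {1..k} \<union> {1..n - k + 1} \<times> {1}"
proof -
  have "hook n k ! i = (if i = 0 then k else 1)" if "i \<le> n - k" for i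
    using that by (simp add: hook_def nth_Cons')
  then show ?thesis
    using assms by (auto simp: diagram_def hook_def split: if_splits)
qed

lemma sum_list_hook: "k \<le> n \<Longrightarrow> sum_list (hook n k) = n"
  by (simp add: hook_def sum_list_replicate)

definition first_column :: "nat \<Rightarrow> nat \<Rightarrow> (nat \<times> nat \<Rightarrow> 'p) \<Rightarrow> 'p list" where
  "first_column n k T = map (\<lambda>i. T (i, 1)) [1..<n - k + 2]"

text \<open>Only the first column of a hook can have more than one box, so the column group consists
  of all permutations of its entries. The rows above the first are its entries after the corner, and
  they determine the tabloid.\<close>

lemma polytabloid_hook:
  assumes k: "1 \<le> k" "k \<le> n" and T: "T \<in> tableaux (hook n k) {1..n}"
  shows "polytabloid (hook n k) T = alt {1..n} (set (first_column n k T)) (tl (first_column n k T))"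
    and "distinct (first_column n k T)" and "set (first_column n k T) \<subseteq> {1..n}"
proof -
  define a where "a = first_column n k T"
  let ?D = "diagram (hook n k)"
  note D = diagram_hook[OF k]
  have bij: "bij_betw T ?D {1..n}"
    using T by (simp add: tableaux_def)
  have inj: "T x = T y \<longleftrightarrow> x = y" if "x \<in> ?D" "y \<in> ?D" for x y
    using bij that by (auto simp: bij_betw_def dest: inj_onD)
  have set_a: "set a = T ` ({1..n - k + 1} \<times> {1})"
    by (auto simp: a_def first_column_def simp del: upt_Suc)
  have upt: "[1..<n - k + 2] = 1 # [2..<n - k + 2]"
    using upt_conv_Cons[of 1 "n - k + 2"] by (simp add: numeral_2_eq_2 del: upt_Suc)
  have tl_a: "tl a = map (\<lambda>i. T (i, 1)) [2..<n - k + 2]"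
    unfolding a_def first_column_def upt by simp
  have dist: "distinct a"
    unfolding a_def first_column_def distinct_map using inj by (auto simp: inj_on_def D)
  have sub: "set a \<subseteq> {1..n}"
    unfolding set_a using bij D by (auto simp: bij_betw_def)
  have img: "T ` ?D = {1..n}"
    using bij by (simp add: bij_betw_def)
  have row1: "T ` ({1} \<times> {1..k}) = {1..n} - set (tl a)"
  proof -
    have "set (tl a) = T ` ({2..n - k + 1} \<times> {1})"
      unfolding tl_a by (auto simp del: upt_Suc)
    moreover have "?D = {1} \<times> {1..k} \<union> {2..n - k + 1} \<times> {1}"
      using k unfolding D by (auto simp: not_less_eq_eq) 
    moreover have "T ` ({1} \<times> {1..k}) \<inter> T ` ({2..n - k + 1} \<times> {1}) = {}"
    proof (rule equals0I)
      fix z assume "z \<in> T ` ({1} \<times> {1..k}) \<inter> T ` ({2..n - k + 1} \<times> {1})"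
      then obtain x y where xy: "x \<in> {1} \<times> {1..k}" "y \<in> {2..n - k + 1} \<times> {1}" "T x = T y"
        by (elim IntE imageE) simp
      then have "x = y"
        using inj[of x y] unfolding D by auto
      with xy show False by auto
    qed
    ultimately show ?thesis
      unfolding img [symmetric] by (simp only: image_Un) blast
  qed
  have group: "column_group (hook n k) T = {q. q permutes set a}"
  proof (intro equalityI subsetI)
    fix q assume q: "q \<in> column_group (hook n k) T"
    then have perm: "q permutes {1..n}"
      and cond: "\<And>i j. (i, j) \<in> ?D \<Longrightarrow> \<exists>i'. (i', j) \<in> ?D \<and> q (T (i, j)) = T (i', j)"
      by (auto simp: column_group_def sum_list_hook[OF k(2)])
    have "q permutes set a"
    proof (rule permutes_superset[OF perm])
      fix x assume x: "x \<in> {1..n} - set a"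
      then obtain i j where ij: "(i, j) \<in> ?D" "x = T (i, j)"
        unfolding img [symmetric] by auto
      have "j \<noteq> 1"
      proof
        assume "j = 1"
        with ij(1) k have "(i, j) \<in> {1..n - k + 1} \<times> {1}"
          unfolding D by auto
        with x ij(2) show False
          unfolding set_a by blast
      qed
      with cond[OF ij(1)] ij show "q x = x"
        unfolding D by auto
    qed
    then show "q \<in> {q. q permutes set a}"
      by simp
  next
    fix q assume "q \<in> {q. q permutes set a}"
    then have q: "q permutes set a"
      by simp
    have "\<exists>i'. (i', j) \<in> ?D \<and> q (T (i, j)) = T (i', j)" if ij: "(i, j) \<in> ?D" for i j
    proof (cases "j = 1")
      case True
      then have "(i, j) \<in> {1..n - k + 1} \<times> {1}"
        using ij k unfolding D by auto
      then have "T (i, j) \<in> set a"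
        unfolding set_a by (rule imageI)
      then have "q (T (i, j)) \<in> set a"
        using permutes_in_image[OF q] by blast
      then obtain i' where "i' \<in> {1..n - k + 1}" "q (T (i, j)) = T (i', 1)"
        unfolding set_a by auto
      with True show ?thesis
        unfolding D by auto
    next
      case False
      have "T (i, j) \<notin> set a"
      proof
        assume "T (i, j) \<in> set a"
        then obtain i' where "i' \<in> {1..n - k + 1}" "T (i, j) = T (i', 1)"
          unfolding set_a by auto
        then have "(i, j) = (i', 1)"
          using inj[OF ij, of "(i', 1)"] unfolding D by auto
        with False show False by simp
      qed
      then have "q (T (i, j)) = T (i, j)"
        by (rule permutes_not_in[OF q])
      with ij show ?thesis by blast
    qed
    then show "q \<in> column_group (hook n k) T"
      using permutes_subset[OF q sub] by (auto simp: column_group_def sum_list_hook[OF k(2)])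
  qed
  have tab: "tabloid (hook n k) (q \<circ> T) = hook_tabloid {1..n} (map q (tl a))" if q: "q permutes set a" for q
  proof -
    have row: "{(q \<circ> T) (i, j) | j. (i, j) \<in> ?D} = (if i = 1 then q ` T ` ({1} \<times> {1..k}) else {q (T (i, 1))})"
      if "i \<in> {1..n - k + 1}" for i
      using that k unfolding D by auto
    have perm: "q permutes {1..n}"
      using q sub by (rule permutes_subset)
    have diff: "q ` ({1..n} - set (tl a)) = {1..n} - q ` set (tl a)"
      unfolding image_set_diff[OF permutes_inj[OF perm]] permutes_image[OF perm] ..
    have "length (hook n k) + 1 = n - k + 2"
      using k by (simp add: hook_def)
    then have "tabloid (hook n k) (q \<circ> T) = {(q \<circ> T) (1, j) | j. (1, j) \<in> ?D} #
        map (\<lambda>i. {(q \<circ> T) (i, j) | j. (i, j) \<in> ?D}) [2..<n - k + 2]"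
      unfolding tabloid_def by (simp only: upt list.map)
    also have "{(q \<circ> T) (1, j) | j. (1, j) \<in> ?D} = {1..n} - set (map q (tl a))"
    proof -
      have "1 \<in> {1..n - k + 1}" by simp
      from row[OF this] show ?thesis
        by (simp only: refl if_True row1 diff set_map)
    qed
    also have "map (\<lambda>i. {(q \<circ> T) (i, j) | j. (i, j) \<in> ?D}) [2..<n - k + 2] = map (\<lambda>x. {x}) (map q (tl a))"
      unfolding tl_a map_map by (intro map_cong refl) (subst row, auto)
    finally show ?thesis
      by (simp only: hook_tabloid_def)
  qed
  show "polytabloid (hook n k) T = alt {1..n} (set (first_column n k T)) (tl (first_column n k T))"
    unfolding a_def [symmetric] polytabloid_def alt_def group by (simp add: tab)
  show "distinct (first_column n k T)" "set (first_column n k T) \<subseteq> {1..n}"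
    using dist sub by (simp_all add: a_def)
qed

text \<open>The polytabloid sees only the first column, so the rest of the first row may be filled
  in any order; the increasing one is taken.\<close>

lemma ex_hook_tableau:
  assumes k: "1 \<le> k" "k \<le> n" and a: "distinct a" "set a \<subseteq> {1..n}" "length a = Suc (n - k)"
  shows "\<exists>T\<in>tableaux (hook n k) {1..n}. first_column n k T = a"
proof -
  let ?D = "diagram (hook n k)"
  note D = diagram_hook[OF k]
  define r where "r = sorted_list_of_set ({1..n} - set a)"
  have len_r: "length r = k - 1"
    using a k by (simp add: r_def card_Diff_subset distinct_card)
  have r: "distinct r" "set r = {1..n} - set a"
    by (simp_all add: r_def)
  \<comment> \<open>\<open>r\<close> fills the first row from column 2 on, hence the offset
    2.\<close>
  define T where "T = (\<lambda>x\<in>?D. if snd x = 1 then a ! (fst x - 1) else r ! (snd x - 2))"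
  have D': "?D = {1..n - k + 1} \<times> {1} \<union> {1} \<times> {2..k}"
    unfolding D using k by (auto simp: not_less_eq_eq)
  have "bij_betw T ({1..n - k + 1} \<times> {1}) (set a)"
  proof -
    have "bij_betw (\<lambda>x. fst x - 1) ({1..n - k + 1} \<times> {1::nat}) {..<length a}"
      by (rule bij_betw_byWitness[of _ "\<lambda>i. (i + 1, 1)"]) (auto simp: a(3))
    from bij_betw_trans[OF this bij_betw_nth[OF a(1) refl refl]]
    show ?thesis
      by (rule bij_betw_cong[THEN iffD1, rotated]) (auto simp: T_def D')
  qed
  moreover have "bij_betw T ({1} \<times> {2..k}) (set r)"
  proof -
    have "bij_betw (\<lambda>x. snd x - 2) ({1::nat} \<times> {2..k}) {..<length r}"
      using k by (intro bij_betw_byWitness[of _ "\<lambda>j. (1, j + 2)"]) (auto simp: len_r)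
    from bij_betw_trans[OF this bij_betw_nth[OF r(1) refl refl]]
    show ?thesis
      by (rule bij_betw_cong[THEN iffD1, rotated]) (auto simp: T_def D')
  qed
  ultimately have "bij_betw T ?D (set a \<union> set r)"
    unfolding D' by (rule bij_betw_combine) (auto simp: r(2))
  moreover have "set a \<union> set r = {1..n}"
    using a(2) r(2) by auto
  ultimately have "T \<in> tableaux (hook n k) {1..n}"
    by (simp add: tableaux_def T_def)
  moreover have "first_column n k T = a"
    using a(3) by (intro nth_equalityI) (auto simp: first_column_def T_def D simp del: upt_Suc)
  ultimately show ?thesis by blast
qed

lemma specht_module_hook:
  assumes k: "1 \<le> k" "k \<le> n"
  shows "specht_module (hook n k) = hook_space {1..n} (n - k)"
proof -
  have len: "length (first_column n k T) = Suc (n - k)" for T :: "nat \<times> nat \<Rightarrow> nat"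
    by (simp add: first_column_def del: upt_Suc)
  have "polytabloid (hook n k) ` tableaux (hook n k) {1..n} =
    {alt {1..n} (set a) (tl a) | a. distinct a \<and> set a \<subseteq> {1..n} \<and> length a = Suc (n - k)}"
  proof (intro equalityI subsetI)
    fix f assume "f \<in> polytabloid (hook n k) ` tableaux (hook n k) {1..n}"
    then obtain T where T: "T \<in> tableaux (hook n k) {1..n}" "f = polytabloid (hook n k) T"
      by blast
    show "f \<in> {alt {1..n} (set a) (tl a) | a. distinct a \<and> set a \<subseteq> {1..n} \<and> length a = Suc (n - k)}"
      unfolding T(2) mem_Collect_eq using polytabloid_hook[OF k T(1)] len by blast
  next
    fix f assume "f \<in> {alt {1..n} (set a) (tl a) | a. distinct a \<and> set a \<subseteq> {1..n} \<and> length a = Suc (n - k)}"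
    then obtain a where a: "f = alt {1..n} (set a) (tl a)" "distinct a" "set a \<subseteq> {1..n}" "length a = Suc (n - k)"
      by blast
    from ex_hook_tableau[OF k a(2-4)] obtain T where T: "T \<in> tableaux (hook n k) {1..n}" "first_column n k T = a"
      by blast
    have "f = polytabloid (hook n k) T"
      unfolding a(1) polytabloid_hook(1)[OF k T(1)] T(2) ..
    with T(1) show "f \<in> polytabloid (hook n k) ` tableaux (hook n k) {1..n}"
      by blast
  qed
  then show ?thesis
    unfolding specht_module_def hook_space_def sum_list_hook[OF k(2)] by simp
qed

lemma irr_character_hook:
  assumes "1 \<le> k" "k \<le> n"
  shows "irr_character (hook n k) w = trace_on (hook_space {1..n} (n - k)) (perm_action w)"
  by (simp add: irr_character_def specht_module_hook[OF assms])

text \<open>The two hooks have legs n - k and n - k - 1, the consecutive terms of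
  \<open>trace_wedge_hook\<close>; \<open>k < n\<close> keeps its p away from 0.\<close>

lemma immanant_hook_add:
  assumes k: "1 \<le> k" "k < n"
  shows "immanant n (irr_character (hook n k)) A + immanant n (irr_character (hook n (k + 1))) A =
    (\<Sum>K | K \<subseteq> {1..n} \<and> card K = n - k. det_on K A * per_on ({1..n} - K) A)"
proof -
  have "irr_character (hook n k) w + irr_character (hook n (k + 1)) w =
    trace_on (wedge_space {1..n} (n - k)) (perm_action w)" if w: "w permutes {1..n}" for w
  proof -
    have "n - k \<noteq> 0" "n - k - 1 = n - (k + 1)"
      using k by auto
    moreover have "1 \<in> {1..n}"
      using k by simp
    ultimately show ?thesis
      using k trace_wedge_hook[OF finite_atLeastAtMost w, of 1 "n - k"]
      by (simp add: irr_character_hook)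
  qed
  then show ?thesis
    unfolding immanant_def sum_trace_wedge_space[OF finite_atLeastAtMost, symmetric] sum.distrib [symmetric]
    by (intro sum.cong refl) (simp flip: distrib_right)
qed

lemma immanant_hook_n:
  assumes "1 \<le> n"
  shows "immanant n (irr_character (hook n n)) A = per_on {1..n} A"
  unfolding immanant_def per_on_def
  using assms by (intro sum.cong refl) (simp add: irr_character_hook trace_hook_space_0)

section \<open>Descent-free rows and chains\<close>

text \<open>Only neighbours are compared, so moving one element between row and chain affects a
  single comparison in each. For the transitive relation of a path family these lists are the chains
  of the poset.\<close>

definition chain_lists :: "('p \<Rightarrow> 'p \<Rightarrow> bool) \<Rightarrow> 'p set \<Rightarrow> 'p list set" where
  "chain_lists R X = {ys. distinct ys \<and> set ys = X \<and> successively R ys}"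

definition descent_free :: "('p \<Rightarrow> 'p \<Rightarrow> bool) \<Rightarrow> 'p set \<Rightarrow> 'p list set" where
  "descent_free R X = {xs. distinct xs \<and> set xs = X \<and> successively (\<lambda>x y. \<not> R y x) xs}"

definition row_chain_pairs :: "('p \<Rightarrow> 'p \<Rightarrow> bool) \<Rightarrow> 'p set \<Rightarrow> nat \<Rightarrow> ('p list \<times> 'p list) set" where
  "row_chain_pairs R X p = {(xs, ys). distinct (xs @ ys) \<and> set (xs @ ys) = X \<and> length ys = p \<and>
     successively (\<lambda>x y. \<not> R y x) xs \<and> successively R ys}"

text \<open>Reading of a hook tableau: \<open>xs\<close> is the first row including the corner,
  \<open>ys\<close> the first column above the corner.\<close>

definition hook_pairs :: "('p \<Rightarrow> 'p \<Rightarrow> bool) \<Rightarrow> 'p set \<Rightarrow> nat \<Rightarrow> ('p list \<times> 'p list) set" where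
  "hook_pairs R X p = {(xs, ys) \<in> row_chain_pairs R X p. xs \<noteq> [] \<and> (ys = [] \<or> R (hd xs) (hd ys))}"

lemma finite_row_chain_pairs: "finite X \<Longrightarrow> finite (row_chain_pairs R X p)"
proof -
  assume "finite X"
  then have "finite ({xs. set xs \<subseteq> X \<and> distinct xs} \<times> {xs. set xs \<subseteq> X \<and> distinct xs})"
    by (intro finite_cartesian_product finite_subset_distinct)
  then show ?thesis
    by (rule rev_finite_subset) (auto simp: row_chain_pairs_def)
qed

text \<open>The first element of the chain is moved in front of the row whenever it cannot stay above it.\<close>

lemma card_row_chain_pairs:
  assumes X: "finite X" "X \<noteq> {}"
  shows "card (row_chain_pairs R X p) = card (hook_pairs R X p) + (if p = 0 then 0 else card (hook_pairs R X (p - 1)))"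
proof -
  \<comment> \<open>The pairs that are not hooks. Failure of \<open>R (hd xs) (hd ys)\<close> says
    precisely that \<open>hd ys\<close> can precede \<open>xs\<close> without a descent, and the
    chain condition on \<open>ys\<close> then makes the result a hook.\<close>
  define N where "N = {(xs, ys) \<in> row_chain_pairs R X p. xs = [] \<or> ys \<noteq> [] \<and> \<not> R (hd xs) (hd ys)}"
  have "row_chain_pairs R X p = hook_pairs R X p \<union> N" "hook_pairs R X p \<inter> N = {}"
    by (auto simp: hook_pairs_def N_def)
  then have "card (row_chain_pairs R X p) = card (hook_pairs R X p) + card N"
    using finite_row_chain_pairs[OF X(1), of R p] by (metis card_Un_disjoint finite_Un)
  also have "card N = (if p = 0 then 0 else card (hook_pairs R X (p - 1)))"
  proof (cases p)
    case 0
    then have "N = {}"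
      using X(2) by (auto simp: N_def row_chain_pairs_def)
    with 0 show ?thesis by simp
  next
    case (Suc m)
    have "bij_betw (\<lambda>(xs, ys). (hd ys # xs, tl ys)) N (hook_pairs R X m)"
    proof (rule bij_betw_byWitness[of _ "\<lambda>(xs, ys). (tl xs, hd xs # ys)"])
      show "\<forall>a\<in>N. (case case a of (xs, ys) \<Rightarrow> (hd ys # xs, tl ys) of (xs, ys) \<Rightarrow> (tl xs, hd xs # ys)) = a"
        using Suc by (auto simp: N_def row_chain_pairs_def length_Suc_conv)
      show "\<forall>a\<in>hook_pairs R X m. (case case a of (xs, ys) \<Rightarrow> (tl xs, hd xs # ys) of (xs, ys) \<Rightarrow> (hd ys # xs, tl ys)) = a"
        by (auto simp: hook_pairs_def)
      show "(\<lambda>(xs, ys). (hd ys # xs, tl ys)) ` N \<subseteq> hook_pairs R X m"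
        using Suc by (auto simp: N_def hook_pairs_def row_chain_pairs_def length_Suc_conv successively_Cons)
      show "(\<lambda>(xs, ys). (tl xs, hd xs # ys)) ` hook_pairs R X m \<subseteq> N"
      proof clarify
        fix xs ys assume h: "(xs, ys) \<in> hook_pairs R X m"
        then obtain x xs' where "xs = x # xs'"
          by (cases xs) (auto simp: hook_pairs_def)
        with h Suc show "(tl xs, hd xs # ys) \<in> N"
          by (auto simp: N_def hook_pairs_def row_chain_pairs_def successively_Cons)
      qed
    qed
    from bij_betw_same_card[OF this] Suc show ?thesis
      by simp
  qed
  finally show ?thesis .
qed

lemma hook_pairs_card: "hook_pairs R X (card X) = {}"
proof -
  have False if "distinct (xs @ ys)" "set (xs @ ys) = X" "length ys = card X" "xs \<noteq> []" for xs ys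
    using that distinct_card[of "xs @ ys"] by auto
  then show ?thesis
    by (auto simp: hook_pairs_def row_chain_pairs_def simp del: distinct_append set_append)
qed

text \<open>The telescoping of the characters again, with hook counts in place of hook traces; at
  \<open>card X\<close> the chain would leave nothing for the row.\<close>

lemma alternating_row_chain_pairs:
  assumes "finite X" "X \<noteq> {}"
  shows "(\<Sum>p\<le>card X. (-1) ^ p * real (card (row_chain_pairs R X p))) = 0"
proof -
  have "(\<Sum>p\<le>m. (-1) ^ p * real (card (row_chain_pairs R X p))) = (-1) ^ m * real (card (hook_pairs R X m))" for m
    by (induction m) (simp_all add: card_row_chain_pairs[OF assms] algebra_simps)
  then show ?thesis
    by (simp add: hook_pairs_card)
qed

text \<open>Grouping by the set K of chain entries gives the combinatorial counterpart of the
  products of minors and permanents.\<close>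

lemma card_row_chain_pairs_sum:
  assumes "finite X"
  shows "card (row_chain_pairs R X p) =
    (\<Sum>K | K \<subseteq> X \<and> card K = p. card (chain_lists R K) * card (descent_free R (X - K)))"
proof -
  have fin: "finite (chain_lists R K)" "finite (descent_free R (X - K))" if "K \<subseteq> X" for K
  proof -
    have "finite {xs. set xs \<subseteq> X \<and> distinct xs}"
      using assms by (rule finite_subset_distinct)
    then show "finite (chain_lists R K)" "finite (descent_free R (X - K))"
      using that by (auto simp: chain_lists_def descent_free_def elim: rev_finite_subset)
  qed
  have "row_chain_pairs R X p = (\<Union>K\<in>{K. K \<subseteq> X \<and> card K = p}. descent_free R (X - K) \<times> chain_lists R K)"
  proof (intro equalityI subsetI)
    fix z assume "z \<in> row_chain_pairs R X p"
    then obtain xs ys where z: "z = (xs, ys)" "distinct (xs @ ys)" "set (xs @ ys) = X" "length ys = p"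
      "successively (\<lambda>x y. \<not> R y x) xs" "successively R ys"
      by (auto simp: row_chain_pairs_def)
    then have "set ys \<subseteq> X" "card (set ys) = p" "xs \<in> descent_free R (X - set ys)" "ys \<in> chain_lists R (set ys)"
      by (auto simp: descent_free_def chain_lists_def distinct_card)
    with z(1) show "z \<in> (\<Union>K\<in>{K. K \<subseteq> X \<and> card K = p}. descent_free R (X - K) \<times> chain_lists R K)"
      by blast
  next
    fix z assume "z \<in> (\<Union>K\<in>{K. K \<subseteq> X \<and> card K = p}. descent_free R (X - K) \<times> chain_lists R K)"
    then show "z \<in> row_chain_pairs R X p"
      by (auto simp: row_chain_pairs_def descent_free_def chain_lists_def distinct_card)
  qed
  then have "card (row_chain_pairs R X p) = (\<Sum>K | K \<subseteq> X \<and> card K = p. card (descent_free R (X - K) \<times> chain_lists R K))"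
    using assms fin
    by (simp only:, intro card_UN_disjoint) (auto simp: chain_lists_def)
  then show ?thesis
    by (simp add: card_cartesian_product mult.commute)
qed

text \<open>Transfer between indices and paths: an injective relabelling that respects the relation
  keeps the count.\<close>

lemma card_hook_pairs_image:
  assumes f: "inj_on f X" and R: "\<And>x y. x \<in> X \<Longrightarrow> y \<in> X \<Longrightarrow> R' (f x) (f y) = R x y"
  shows "card (hook_pairs R' (f ` X) p) = card (hook_pairs R X p)"
proof -
  have succ: "successively (\<lambda>x y. R' (f x) (f y)) zs = successively R zs"
    "successively (\<lambda>x y. \<not> R' (f y) (f x)) zs = successively (\<lambda>x y. \<not> R y x) zs" if "set zs \<subseteq> X" for zs
    using that R by (auto intro!: successively_cong simp: subset_iff)
  have "inj_on (map_prod (map f) (map f)) (hook_pairs R X p)"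
  proof (rule inj_onI)
    fix u v assume u: "u \<in> hook_pairs R X p" and v: "v \<in> hook_pairs R X p"
      and eq: "map_prod (map f) (map f) u = map_prod (map f) (map f) v"
    have sub: "set (fst z) \<subseteq> X" "set (snd z) \<subseteq> X" if "z \<in> hook_pairs R X p" for z
      using that by (auto simp: hook_pairs_def row_chain_pairs_def)
    have inj: "xs = ys" if "set xs \<subseteq> X" "set ys \<subseteq> X" "map f xs = map f ys" for xs ys
      using that f by (intro map_inj_on[OF that(3)] inj_on_subset[OF f]) auto
    have "map f (fst u) = map f (fst v)" "map f (snd u) = map f (snd v)"
      using eq by (metis fst_map_prod, metis snd_map_prod)
    then show "u = v"
      using inj sub[OF u] sub[OF v] by (intro prod_eqI) blast+
  qed
  moreover have "map_prod (map f) (map f) ` hook_pairs R X p = hook_pairs R' (f ` X) p"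
  proof (intro equalityI subsetI)
    fix z assume "z \<in> map_prod (map f) (map f) ` hook_pairs R X p"
    then obtain xs ys where z: "z = (map f xs, map f ys)" and h: "(xs, ys) \<in> hook_pairs R X p"
      by auto
    have sub: "set xs \<subseteq> X" "set ys \<subseteq> X" "set (xs @ ys) = X"
      using h by (auto simp: hook_pairs_def row_chain_pairs_def)
    have "distinct (map f (xs @ ys))" "set (map f (xs @ ys)) = f ` X"
      using h f sub(3) by (auto simp: distinct_map hook_pairs_def row_chain_pairs_def simp del: set_append distinct_append map_append)
    moreover have "R' (hd (map f xs)) (hd (map f ys)) = R (hd xs) (hd ys)" if "xs \<noteq> []" "ys \<noteq> []"
      using that sub(1,2) R by (simp add: hd_map subset_iff)
    ultimately show "z \<in> hook_pairs R' (f ` X) p"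
      using h sub unfolding z hook_pairs_def row_chain_pairs_def
      by (auto simp: successively_map succ)
  next
    fix z assume z: "z \<in> hook_pairs R' (f ` X) p"
    then obtain us vs where uv: "z = (us, vs)" "set (us @ vs) = f ` X"
      by (auto simp: hook_pairs_def row_chain_pairs_def)
    define xs where "xs = map (inv_into X f) us"
    define ys where "ys = map (inv_into X f) vs"
    have mem: "u \<in> f ` X" if "u \<in> set us \<union> set vs" for u
      using that uv(2) by auto
    have eq: "us = map f xs" "vs = map f ys"
      unfolding xs_def ys_def map_map using mem by (auto intro!: map_idI [symmetric] simp: f_inv_into_f)
    have sub: "set xs \<subseteq> X" "set ys \<subseteq> X"
      unfolding xs_def ys_def using mem by (auto intro: inv_into_into)
    have "f ` set (xs @ ys) = f ` X"
      using uv(2) by (simp add: eq image_Un)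
    then have set: "set (xs @ ys) = X"
      using sub f by (simp add: inj_on_image_eq_iff[OF f])
    have "distinct (map f (xs @ ys))"
      using z unfolding uv(1) eq by (simp add: hook_pairs_def row_chain_pairs_def)
    then have "distinct (xs @ ys)"
      by (simp only: distinct_map)
    moreover have "R' (hd (map f xs)) (hd (map f ys)) = R (hd xs) (hd ys)" if "xs \<noteq> []" "ys \<noteq> []"
      using that sub(1,2) R by (simp add: hd_map subset_iff)
    ultimately have "(xs, ys) \<in> hook_pairs R X p"
      using z set sub unfolding uv(1) hook_pairs_def row_chain_pairs_def eq
      by (auto simp: successively_map succ)
    then show "z \<in> map_prod (map f) (map f) ` hook_pairs R X p"
      unfolding uv(1) eq by (rule rev_image_eqI) simp
  qed
  ultimately show ?thesis
    by (metis card_image)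
qed

lemma card_descent_free_hook_pairs:
  assumes "X \<noteq> {}"
  shows "card (hook_pairs R X 0) = card (descent_free R X)"
proof -
  have "hook_pairs R X 0 = (\<lambda>xs. (xs, [])) ` descent_free R X"
    using assms by (auto simp: hook_pairs_def row_chain_pairs_def descent_free_def)
  then show ?thesis
    by (simp add: card_image inj_on_def)
qed

lemma descent_free_permutations_eq: "descent_free_permutations X lt = descent_free lt X"
  by (auto simp: descent_free_permutations_def descent_free_def permutations_of_set_def successively_conv_nth)

text \<open>As R implies the order of numbers, only the increasing listing of K can be a chain, and
  transitivity extends R from neighbours to all pairs. The count is thus the indicator that occurs
  in \<open>det_on_path_matrix\<close>.\<close>

lemma card_chain_lists:
  fixes K :: "nat set"
  assumes K: "finite K" and less: "\<And>i j. R i j \<Longrightarrow> i < j"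
    and trans: "\<And>i j k. i \<in> K \<Longrightarrow> j \<in> K \<Longrightarrow> k \<in> K \<Longrightarrow> R i j \<Longrightarrow> R j k \<Longrightarrow> R i k"
  shows "card (chain_lists R K) = of_bool (\<forall>i\<in>K. \<forall>j\<in>K. i < j \<longrightarrow> R i j)"
proof -
  have sorted: "sorted_wrt R ys" if "ys \<in> chain_lists R K" for ys
  proof -
    from that have ys: "set ys = K" "successively R ys"
      by (auto simp: chain_lists_def)
    then show ?thesis
      using trans successively_iff_sorted_wrt_strong[of ys R] by blast
  qed
  show ?thesis
  proof (cases "\<forall>i\<in>K. \<forall>j\<in>K. i < j \<longrightarrow> R i j")
    case True
    have "chain_lists R K = {sorted_list_of_set K}"
    proof (intro equalityI subsetI)
      fix ys assume ys: "ys \<in> chain_lists R K"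
      have "sorted_wrt (<) ys"
        using sorted[OF ys] by (rule sorted_wrt_mono_rel[rotated]) (rule less)
      moreover have "set ys = K"
        using ys by (simp add: chain_lists_def)
      ultimately show "ys \<in> {sorted_list_of_set K}"
        using sorted_list_of_set.idem_if_sorted_distinct[of ys] by (auto simp: strict_sorted_iff)
    next
      fix ys assume "ys \<in> {sorted_list_of_set K}"
      then have ys: "ys = sorted_list_of_set K" by simp
      have "sorted_wrt (<) ys"
        by (simp add: ys)
      then have "sorted_wrt R ys"
        by (rule sorted_wrt_mono_rel[rotated]) (use True K in \<open>auto simp: ys\<close>)
      then have "successively R ys"
        by (rule successively_if_sorted_wrt)
      with K show "ys \<in> chain_lists R K"
        by (simp add: chain_lists_def ys)
    qed
    with True show ?thesis by simp
  next
    case False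
    have "ys \<notin> chain_lists R K" for ys
    proof
      assume ys: "ys \<in> chain_lists R K"
      from False obtain i j where ij: "i \<in> K" "j \<in> K" "i < j" "\<not> R i j"
        by blast
      with ys obtain a b where ab: "a < length ys" "b < length ys" "ys ! a = i" "ys ! b = j"
        by (auto simp: chain_lists_def in_set_conv_nth)
      then have "a \<noteq> b"
        using ij by auto
      then consider "a < b" | "b < a"
        by linarith
      then show False
      proof cases
        case 1
        with sorted[OF ys] ab ij show False
          by (auto simp: sorted_wrt_iff_nth_less)
      next
        case 2
        with sorted[OF ys] ab have "R j i"
          by (auto simp: sorted_wrt_iff_nth_less)
        with less[of j i] ij show False by simp
      qed
    qed
    then have "chain_lists R K = {}" by blast
    with False show ?thesis by simp
  qed
qed

text \<open>Cutting off the first column above the corner leaves the first row; column strictness at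
  the corner becomes the relation between the heads of the two lists.\<close>

lemma card_standard_tableaux_hook:
  assumes k: "1 \<le> k" "k \<le> n" and X: "card X = n"
  shows "card (standard_tableaux (hook n k) X lt) = card (hook_pairs lt X (n - k))"
proof -
  let ?D = "diagram (hook n k)"
  note D = diagram_hook[OF k]
  have D': "?D = {1} \<times> {1..k} \<union> {2..n - k + 1} \<times> {1}"
    unfolding D using k by (auto simp: not_less_eq_eq)
  define row where "row U = map (\<lambda>j. U (1, j)) [1..<k + 1]" for U :: "nat \<times> nat \<Rightarrow> 'a"
  define col where "col U = map (\<lambda>i. U (i, 1)) [2..<n - k + 2]" for U :: "nat \<times> nat \<Rightarrow> 'a"
  \<comment> \<open>\<open>ys\<close> starts in row 2, hence the offset 2; outside the diagram the
    value is \<open>undefined\<close>, as \<open>tableaux\<close> demands.\<close>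
  define build where "build = (\<lambda>(xs, ys). \<lambda>x\<in>?D. if fst x = 1 then xs ! (snd x - 1) else (ys :: 'a list) ! (fst x - 2))"
  have len: "length (row U) = k" "length (col U) = n - k" for U
    by (simp_all add: row_def col_def del: upt_Suc)
  have row_nth: "row U ! j = U (1, j + 1)" if "j < k" for U j
    using that by (simp add: row_def del: upt_Suc)
  have col_nth: "col U ! i = U (i + 2, 1)" if "i < n - k" for U i
    using that by (simp add: col_def add.commute del: upt_Suc)
  have hd_row: "hd (row U) = U (1, 1)" for U
  proof -
    have "row U \<noteq> []"
      using k(1) len(1)[of U] by (metis list.size(3) not_one_le_zero)
    then show ?thesis
      using k(1) row_nth[of 0 U] by (simp add: hd_conv_nth)
  qed
  have hd_col: "hd (col U) = U (2, 1)" if "0 < n - k" for U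
  proof -
    have "col U \<noteq> []"
      using that len(2)[of U] by (metis list.size(3) less_irrefl)
    then show ?thesis
      using that col_nth[of 0 U] by (simp add: hd_conv_nth numeral_2_eq_2)
  qed
  have bij_iff: "bij_betw U ?D X \<longleftrightarrow> distinct (row U @ col U) \<and> set (row U @ col U) = X" for U
  proof -
    \<comment> \<open>Every box occurs once in \<open>idx\<close>, which turns bijectivity of U into
      a property of the reading word.\<close>
    define idx where "idx = map (\<lambda>j. (1 :: nat, j)) [1..<k + 1] @ map (\<lambda>i. (i, 1 :: nat)) [2..<n - k + 2]"
    have "distinct idx" "set idx = ?D"
      unfolding idx_def D' by (auto simp: distinct_map inj_on_def simp del: upt_Suc)
    moreover have "row U @ col U = map U idx"
      by (simp add: row_def col_def idx_def o_def del: upt_Suc)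
    ultimately show ?thesis
      by (simp add: bij_betw_def distinct_map del: set_append distinct_append map_append)
  qed
  have semi: "row_semistrict lt (hook n k) U \<longleftrightarrow> successively (\<lambda>x y. \<not> lt y x) (row U)" for U
  proof
    assume L: "row_semistrict lt (hook n k) U"
    have "\<not> lt (U (1, j + 2)) (U (1, j + 1))" if "Suc j < k" for j
    proof -
      have "(1, j + 1) \<in> ?D" "(1, j + 1 + 1) \<in> ?D"
        using that unfolding D by auto
      with L have "\<not> lt (U (1, j + 1 + 1)) (U (1, j + 1))"
        unfolding row_semistrict_def by blast
      then show ?thesis by simp
    qed
    then show "successively (\<lambda>x y. \<not> lt y x) (row U)"
      by (simp add: successively_conv_nth len row_nth)
  next
    assume R: "successively (\<lambda>x y. \<not> lt y x) (row U)"
    show "row_semistrict lt (hook n k) U"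
      unfolding row_semistrict_def
    proof (intro allI impI)
      fix i j assume "(i, j) \<in> ?D \<and> (i, j + 1) \<in> ?D"
      then have ij: "i = 1" "1 \<le> j" "Suc (j - 1) < k"
        unfolding D by auto
      then have "\<not> lt (row U ! Suc (j - 1)) (row U ! (j - 1))"
        using successively_nth[OF R, of "j - 1"] by (simp add: len)
      with ij show "\<not> lt (U (i, j + 1)) (U (i, j))"
        by (simp add: row_nth)
    qed
  qed
  have strict: "column_strict lt (hook n k) U \<longleftrightarrow>
      successively lt (col U) \<and> (col U = [] \<or> lt (hd (row U)) (hd (col U)))" for U
  proof
    assume L: "column_strict lt (hook n k) U"
    have step: "lt (U (i, 1)) (U (i + 1, 1))" if "1 \<le> i" "i \<le> n - k" for i
    proof -
      have "(i, 1) \<in> ?D" "(i + 1, 1) \<in> ?D"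
        using that unfolding D by auto
      with L show ?thesis
        unfolding column_strict_def by blast
    qed
    have "successively lt (col U)"
      unfolding successively_conv_nth len
    proof (intro allI impI)
      fix i assume "Suc i < n - k"
      with step[of "i + 2"] show "lt (col U ! i) (col U ! Suc i)"
        by (simp add: col_nth)
    qed
    moreover have "lt (hd (row U)) (hd (col U))" if "col U \<noteq> []"
    proof -
      have nk: "0 < n - k"
        using that len(2)[of U] by (cases "n - k") auto
      with step[of 1] show ?thesis
        unfolding hd_row hd_col[OF nk] by (simp add: numeral_2_eq_2)
    qed
    ultimately show "successively lt (col U) \<and> (col U = [] \<or> lt (hd (row U)) (hd (col U)))"
      by blast
  next
    assume R: "successively lt (col U) \<and> (col U = [] \<or> lt (hd (row U)) (hd (col U)))"
    show "column_strict lt (hook n k) U"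
      unfolding column_strict_def
    proof (intro allI impI)
      fix i j assume "(i, j) \<in> ?D \<and> (i + 1, j) \<in> ?D"
      then have ij: "j = 1" "1 \<le> i" "i \<le> n - k"
        unfolding D by auto
      show "lt (U (i, j)) (U (i + 1, j))"
      proof (cases "i = 1")
        case True
        then have "col U \<noteq> []" "row U \<noteq> []"
          using ij k len[of U] by auto
        with R have "lt (U (1, 1)) (U (2, 1))"
          using hd_row hd_col ij True by simp
        with True ij show ?thesis
          by (simp add: numeral_2_eq_2)
      next
        case False
        then have "Suc (i - 2) < n - k"
          using ij by auto
        then have "lt (col U ! (i - 2)) (col U ! Suc (i - 2))"
          using successively_nth[OF conjunct1[OF R], of "i - 2"] by (simp add: len)
        moreover have "i - 2 + 2 = i" "Suc (i - 2) + 2 = i + 1"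
          using False ij by auto
        ultimately show ?thesis
          using col_nth[of "i - 2" U] col_nth[of "Suc (i - 2)" U] \<open>Suc (i - 2) < n - k\<close> ij by simp
      qed
    qed
  qed
  have mem: "(row U, col U) \<in> hook_pairs lt X (n - k) \<longleftrightarrow>
      bij_betw U ?D X \<and> row_semistrict lt (hook n k) U \<and> column_strict lt (hook n k) U" for U
  proof -
    have "row U \<noteq> []"
      using k len(1)[of U] by auto
    then show ?thesis
      unfolding bij_iff semi strict hook_pairs_def row_chain_pairs_def by (auto simp: len)
  qed
  have build: "row (build (xs, ys)) = xs" "col (build (xs, ys)) = ys" if "(xs, ys) \<in> hook_pairs lt X (n - k)" for xs ys
  proof -
    have "length ys = n - k" "length (xs @ ys) = n"
      using that X distinct_card[of "xs @ ys"] by (auto simp: hook_pairs_def row_chain_pairs_def)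
    then have l: "length ys = n - k" "length xs = k"
      using k by auto
    show "row (build (xs, ys)) = xs"
      using l by (intro nth_equalityI) (auto simp: len row_nth build_def D)
    show "col (build (xs, ys)) = ys"
      using l by (intro nth_equalityI) (auto simp: len col_nth build_def D)
  qed
  have build_ext: "build z \<in> extensional ?D" for z
    by (cases z) (simp add: build_def)
  have build_id: "build (row U, col U) = U" if "U \<in> extensional ?D" for U
  proof
    fix x :: "nat \<times> nat"
    show "build (row U, col U) x = U x"
    proof (cases "x \<in> ?D")
      case True
      then consider j where "x = (1, j)" "1 \<le> j" "j \<le> k" | i where "x = (i, 1)" "2 \<le> i" "i \<le> n - k + 1"
        unfolding D' by auto
      then show ?thesis
      proof cases
        case 1
        with True row_nth[of "j - 1" U] show ?thesis
          by (simp add: build_def)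
      next
        case 2
        then have "i - 2 < n - k" "i - 2 + 2 = i"
          by auto
        with True 2 col_nth[of "i - 2" U] show ?thesis
          by (simp add: build_def)
      qed
    next
      case False
      have "build (row U, col U) x = undefined"
        unfolding build_def prod.case by (rule restrict_apply[THEN trans]) (simp only: False if_False)
      with extensional_arb[OF that False] show ?thesis
        by (simp only:)
    qed
  qed
  have "bij_betw (\<lambda>U. (row U, col U)) (standard_tableaux (hook n k) X lt) (hook_pairs lt X (n - k))"
  proof (rule bij_betw_byWitness[of _ build])
    show "\<forall>U\<in>standard_tableaux (hook n k) X lt. build (row U, col U) = U"
      using build_id by (auto simp: standard_tableaux_def tableaux_def)
    show "\<forall>z\<in>hook_pairs lt X (n - k). (row (build z), col (build z)) = z"
      using build by auto
    show "(\<lambda>U. (row U, col U)) ` standard_tableaux (hook n k) X lt \<subseteq> hook_pairs lt X (n - k)"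
      using mem by (auto simp: standard_tableaux_def tableaux_def)
    show "build ` hook_pairs lt X (n - k) \<subseteq> standard_tableaux (hook n k) X lt"
    proof
      fix U assume "U \<in> build ` hook_pairs lt X (n - k)"
      then obtain xs ys where h: "(xs, ys) \<in> hook_pairs lt X (n - k)" and U: "U = build (xs, ys)"
        by auto
      have "(row U, col U) \<in> hook_pairs lt X (n - k)"
        unfolding U build[OF h] by (rule h)
      with mem[of U] build_ext[of "(xs, ys)"] show "U \<in> standard_tableaux (hook n k) X lt"
        by (simp add: standard_tableaux_def tableaux_def U)
    qed
  qed
  then show ?thesis
    by (rule bij_betw_same_card)
qed

section \<open>Expansion over path families\<close>

context planar_network
begin

text \<open>The order of the poset pulled back to indices, so that a subfamily on K needs no poset
  of its own.\<close>

definition below :: "(nat \<Rightarrow> 'b awalk) \<Rightarrow> nat \<Rightarrow> nat \<Rightarrow> bool" where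
  "below \<pi> i j \<longleftrightarrow> i < j \<and> vset i (\<pi> i) \<inter> vset j (\<pi> j) = {}"

lemma below_trans:
  assumes "K \<subseteq> {1..n}" "\<pi> \<in> families K id" "i \<in> K" "j \<in> K" "k \<in> K" "below \<pi> i j" "below \<pi> j k"
  shows "below \<pi> i k"
proof -
  have "awalk (s a) (\<pi> a) (t a)" if "a \<in> K" for a
    using families_awalk[OF assms(2) that] by simp
  note aw = this[OF assms(3)] this[OF assms(4)] this[OF assms(5)]
  have mem: "i \<in> {1..n}" "j \<in> {1..n}" "k \<in> {1..n}"
    using assms(1,3-5) by blast+
  have less: "i < j" "j < k" and disj: "vset i (\<pi> i) \<inter> vset j (\<pi> j) = {}" "vset j (\<pi> j) \<inter> vset k (\<pi> k) = {}"
    using assms(6,7) by (simp_all add: below_def)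
  show ?thesis
    unfolding below_def using disjoint_trans[OF aw mem less disj] less by simp
qed

lemma below_cong: "\<pi> i = \<rho> i \<Longrightarrow> \<pi> j = \<rho> j \<Longrightarrow> below \<pi> i j = below \<rho> i j"
  by (simp add: below_def)

lemma det_on_path_matrix_chains:
  assumes K: "K \<subseteq> {1..n}"
  shows "det_on K (path_matrix G s t wt) = (\<Sum>\<pi>\<in>families K id. fwgt K \<pi> * real (card (chain_lists (below \<pi>) K)))"
  unfolding det_on_path_matrix[OF K]
proof (intro sum.cong refl)
  fix \<pi> assume \<pi>: "\<pi> \<in> families K id"
  have "finite K"
    using K finite_subset by blast
  then have "card (chain_lists (below \<pi>) K) = of_bool (\<forall>i\<in>K. \<forall>j\<in>K. i < j \<longrightarrow> below \<pi> i j)"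
    by (rule card_chain_lists) (simp add: below_def, rule below_trans[OF K \<pi>])
  then show "fwgt K \<pi> * of_bool (\<forall>i\<in>K. \<forall>j\<in>K. i < j \<longrightarrow> vset i (\<pi> i) \<inter> vset j (\<pi> j) = {}) =
      fwgt K \<pi> * real (card (chain_lists (below \<pi>) K))"
    by (simp add: below_def)
qed

lemma chain_lists_cong:
  assumes "\<And>i. i \<in> K \<Longrightarrow> \<pi> i = \<rho> i"
  shows "chain_lists (below \<pi>) K = chain_lists (below \<rho>) K"
proof -
  have "successively (below \<pi>) ys = successively (below \<rho>) ys" if "set ys = K" for ys
    using that assms by (intro successively_cong below_cong refl) auto
  then show ?thesis
    by (auto simp: chain_lists_def)
qed

lemma descent_free_cong:
  assumes "\<And>i. i \<in> K \<Longrightarrow> \<pi> i = \<rho> i"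
  shows "descent_free (below \<pi>) K = descent_free (below \<rho>) K"
proof -
  have "successively (\<lambda>x y. \<not> below \<pi> y x) ys = successively (\<lambda>x y. \<not> below \<rho> y x) ys" if "set ys = K" for ys
    using that assms below_cong[of \<pi> _ \<rho>] by (intro successively_cong refl) metis
  then show ?thesis
    by (auto simp: descent_free_def)
qed

text \<open>A family of identity type on J is a free choice of families on K and on J - K, and each
  of the two statistics sees only its own part.\<close>

lemma sum_families_split:
  assumes J: "finite J" and K: "K \<subseteq> J"
    and f: "\<And>\<pi> \<rho>. (\<And>i. i \<in> K \<Longrightarrow> \<pi> i = \<rho> i) \<Longrightarrow> f \<pi> = (f \<rho> :: real)"
    and g: "\<And>\<pi> \<rho>. (\<And>i. i \<in> J - K \<Longrightarrow> \<pi> i = \<rho> i) \<Longrightarrow> g \<pi> = (g \<rho> :: real)"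
  shows "(\<Sum>\<pi>\<in>families K id. fwgt K \<pi> * f \<pi>) * (\<Sum>\<pi>\<in>families (J - K) id. fwgt (J - K) \<pi> * g \<pi>) =
    (\<Sum>\<pi>\<in>families J id. fwgt J \<pi> * (f \<pi> * g \<pi>))"
proof -
  define join where "join = (\<lambda>(\<pi>, \<rho>). \<lambda>i. if i \<in> K then \<pi> i else (\<rho> :: nat \<Rightarrow> 'b awalk) i)"
  have memK: "restrict \<pi> K \<in> families K id" and memJ: "restrict \<pi> (J - K) \<in> families (J - K) id"
    if "\<pi> \<in> families J id" for \<pi>
    using that K by (auto simp: families_def PiE_iff)
  have join: "join (\<pi>, \<rho>) \<in> families J id" "restrict (join (\<pi>, \<rho>)) K = \<pi>" "restrict (join (\<pi>, \<rho>)) (J - K) = \<rho>"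
    if "\<pi> \<in> families K id" "\<rho> \<in> families (J - K) id" for \<pi> \<rho>
    using that K by (auto simp: families_def join_def PiE_iff extensional_def fun_eq_iff)
  have join_restrict: "join (restrict \<pi> K, restrict \<pi> (J - K)) = \<pi>" if "\<pi> \<in> families J id" for \<pi>
  proof
    fix i
    have "\<pi> i = undefined" if "i \<notin> J"
      using that \<open>\<pi> \<in> families J id\<close> by (auto simp: families_def PiE_iff extensional_def)
    then show "join (restrict \<pi> K, restrict \<pi> (J - K)) i = \<pi> i"
      by (auto simp: join_def)
  qed
  have val: "fwgt J \<pi> * (f \<pi> * g \<pi>) =
      fwgt K (restrict \<pi> K) * f (restrict \<pi> K) * (fwgt (J - K) (restrict \<pi> (J - K)) * g (restrict \<pi> (J - K)))" for \<pi>
  proof -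
    have "fwgt J \<pi> = fwgt K (restrict \<pi> K) * fwgt (J - K) (restrict \<pi> (J - K))"
      unfolding fwgt_def using prod.subset_diff[OF K J] by (simp add: mult.commute)
    moreover have "f (restrict \<pi> K) = f \<pi>" "g (restrict \<pi> (J - K)) = g \<pi>"
      by (rule f, simp, rule g, simp)
    ultimately show ?thesis
      by (simp only: mult_ac)
  qed
  have "(\<Sum>\<pi>\<in>families J id. fwgt J \<pi> * (f \<pi> * g \<pi>)) =
    (\<Sum>(\<pi>, \<rho>)\<in>families K id \<times> families (J - K) id. fwgt K \<pi> * f \<pi> * (fwgt (J - K) \<rho> * g \<rho>))"
    by (rule sum.reindex_bij_witness[of _ join "\<lambda>\<pi>. (restrict \<pi> K, restrict \<pi> (J - K))"])
      (auto simp only: join_restrict memK memJ join val prod.case mem_Sigma_iff)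
  then show ?thesis
    by (simp add: sum_product sum.cartesian_product)
qed

text \<open>\<open>alternating_det_per\<close> and \<open>alternating_row_chain_pairs\<close>
  express their terms for the empty chain set through nonempty K. There J - K is smaller than J, so
  the induction hypothesis together with the chain expansion of the minor makes the two sums
  agree.\<close>

lemma per_on_path_matrix:
  assumes "J \<subseteq> {1..n}"
  shows "per_on J (path_matrix G s t wt) = (\<Sum>\<pi>\<in>families J id. fwgt J \<pi> * real (card (descent_free (below \<pi>) J)))"
proof -
  let ?A = "path_matrix G s t wt"
  have "finite J"
    using assms finite_subset by blast
  then show ?thesis
    using assms
  proof (induction J rule: finite_psubset_induct)
    case (psubset J)
    show ?case
    proof (cases "J = {}")
      case True
      have "descent_free R {} = {[]}" for R :: "nat \<Rightarrow> nat \<Rightarrow> bool"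
        by (auto simp: descent_free_def)
      then show ?thesis
        by (simp add: True per_on_def families_def fwgt_def)
    next
      case False
      \<comment> \<open>The empty set is split off because its term contains the permanent on J to
        be solved for.\<close>
      define rest where "rest = Pow J - {{}}"
      have Pow: "Pow J = insert {} rest" "{} \<notin> rest" "finite rest"
        using psubset.hyps by (auto simp: rest_def)
      define c where "c \<pi> K = (-1) ^ card K * real (card (chain_lists (below \<pi>) K) * card (descent_free (below \<pi>) (J - K)))" for \<pi> K
      have expand: "(-1) ^ card K * (det_on K ?A * per_on (J - K) ?A) = (\<Sum>\<pi>\<in>families J id. fwgt J \<pi> * c \<pi> K)" if "K \<in> rest" for K
      proof -
        have K: "K \<subseteq> J" "K \<noteq> {}" "J - K \<subset> J"
          using that by (auto simp: rest_def)
        then have "per_on (J - K) ?A = (\<Sum>\<pi>\<in>families (J - K) id. fwgt (J - K) \<pi> * real (card (descent_free (below \<pi>) (J - K))))"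
          using psubset.prems by (intro psubset.IH) auto
        moreover have "det_on K ?A = (\<Sum>\<pi>\<in>families K id. fwgt K \<pi> * real (card (chain_lists (below \<pi>) K)))"
          using psubset.prems K by (intro det_on_path_matrix_chains) auto
        ultimately have "det_on K ?A * per_on (J - K) ?A = (\<Sum>\<pi>\<in>families J id. fwgt J \<pi> *
            (real (card (chain_lists (below \<pi>) K)) * real (card (descent_free (below \<pi>) (J - K)))))"
          by (simp only:, intro sum_families_split[OF psubset.hyps K(1)] arg_cong[of _ _ "\<lambda>X. real (card X)"]
              chain_lists_cong descent_free_cong) auto
        then show ?thesis
          by (simp add: c_def sum_distrib_left mult_ac)
      qed
      have "0 = (\<Sum>K\<in>Pow J. (-1) ^ card K * (det_on K ?A * per_on (J - K) ?A))"
        using alternating_det_per[OF psubset.hyps False] by simp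
      also have "\<dots> = per_on J ?A + (\<Sum>K\<in>rest. \<Sum>\<pi>\<in>families J id. fwgt J \<pi> * c \<pi> K)"
        using Pow expand by (simp add: det_on_def)
      also have "\<dots> = per_on J ?A + (\<Sum>\<pi>\<in>families J id. fwgt J \<pi> * (\<Sum>K\<in>rest. c \<pi> K))"
        by (subst sum.swap) (simp add: sum_distrib_left)
      finally have per: "per_on J ?A = - (\<Sum>\<pi>\<in>families J id. fwgt J \<pi> * (\<Sum>K\<in>rest. c \<pi> K))"
        by linarith
      \<comment> \<open>The counting identity holds for each family separately.\<close>
      have "(\<Sum>K\<in>rest. c \<pi> K) = - real (card (descent_free (below \<pi>) J))" for \<pi>
      proof -
        have "(\<Sum>K\<in>Pow J. c \<pi> K) = (\<Sum>p\<le>card J. \<Sum>K | K \<in> Pow J \<and> card K = p. c \<pi> K)"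
          using psubset.hyps by (intro sum.group [symmetric]) (auto intro: card_mono)
        also have "\<dots> = (\<Sum>p\<le>card J. (-1) ^ p * real (card (row_chain_pairs (below \<pi>) J p)))"
          by (intro sum.cong refl)
            (simp add: card_row_chain_pairs_sum[OF psubset.hyps] c_def sum_distrib_left)
        also have "\<dots> = 0"
          by (rule alternating_row_chain_pairs[OF psubset.hyps False])
        finally have "c \<pi> {} + (\<Sum>K\<in>rest. c \<pi> K) = 0"
          using Pow by simp
        moreover have "chain_lists (below \<pi>) {} = {[]}"
          by (auto simp: chain_lists_def)
        ultimately show ?thesis
          by (simp add: c_def)
      qed
      with per show ?thesis
        by (simp add: sum_negf id_def)
    qed
  qed
qed

text \<open>Induction on the leg length p, from the single row, whose immanant is the permanent.
  Immanants and weighted counts have equal sums over the legs p and p + 1, so the equality for p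
  passes to p + 1.\<close>

lemma immanant_hook_pairs:
  assumes "p < n"
  shows "immanant n (irr_character (hook n (n - p))) (path_matrix G s t wt) =
    (\<Sum>\<pi>\<in>families {1..n} id. fwgt {1..n} \<pi> * real (card (hook_pairs (below \<pi>) {1..n} p)))"
  using assms
proof (induction p)
  case 0
  then have "{1..n} \<noteq> {}" "1 \<le> n"
    by auto
  then show ?case
    using immanant_hook_n[of n] per_on_path_matrix[of "{1..n}"] card_descent_free_hook_pairs[of "{1..n}"]
    by (simp add: id_def)
next
  case (Suc p)
  let ?A = "path_matrix G s t wt" and ?N = "{1..n}"
  have k: "1 \<le> n - Suc p" "n - Suc p < n" "n - Suc p + 1 = n - p" "n - (n - Suc p) = Suc p"
    using Suc.prems by auto
  have ne: "?N \<noteq> {}"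
    using Suc.prems by auto
  have "immanant n (irr_character (hook n (n - Suc p))) ?A + immanant n (irr_character (hook n (n - p))) ?A =
    (\<Sum>K | K \<subseteq> ?N \<and> card K = Suc p. det_on K ?A * per_on (?N - K) ?A)"
    using immanant_hook_add[OF k(1,2), of ?A] unfolding k(3,4) .
  also have "\<dots> = (\<Sum>K | K \<subseteq> ?N \<and> card K = Suc p. \<Sum>\<pi>\<in>families ?N id. fwgt ?N \<pi> *
      (real (card (chain_lists (below \<pi>) K)) * real (card (descent_free (below \<pi>) (?N - K)))))"
  proof (intro sum.cong refl)
    fix K assume "K \<in> {K. K \<subseteq> ?N \<and> card K = Suc p}"
    then have K: "K \<subseteq> ?N" by simp
    show "det_on K ?A * per_on (?N - K) ?A = (\<Sum>\<pi>\<in>families ?N id. fwgt ?N \<pi> *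
        (real (card (chain_lists (below \<pi>) K)) * real (card (descent_free (below \<pi>) (?N - K)))))"
      unfolding det_on_path_matrix_chains[OF K] per_on_path_matrix[OF Diff_subset]
      by (intro sum_families_split[OF finite_atLeastAtMost K] arg_cong[of _ _ "\<lambda>X. real (card X)"]
          chain_lists_cong descent_free_cong) auto
  qed
  also have "\<dots> = (\<Sum>\<pi>\<in>families ?N id. fwgt ?N \<pi> * real (card (row_chain_pairs (below \<pi>) ?N (Suc p))))"
    by (subst sum.swap) (simp add: card_row_chain_pairs_sum[OF finite_atLeastAtMost] sum_distrib_left)
  also have "\<dots> = (\<Sum>\<pi>\<in>families ?N id. fwgt ?N \<pi> * real (card (hook_pairs (below \<pi>) ?N (Suc p)))) +
      (\<Sum>\<pi>\<in>families ?N id. fwgt ?N \<pi> * real (card (hook_pairs (below \<pi>) ?N p)))"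
    unfolding card_row_chain_pairs[OF finite_atLeastAtMost ne] by (simp add: distrib_left sum.distrib)
  finally show ?case
    using Suc.IH Suc.prems by (simp add: id_def)
qed

section \<open>From indices back to paths\<close>

lemma source_neq_sink:
  assumes "i \<in> {1..n}" "j \<in> {1..n}"
  shows "s i \<noteq> t j"
proof
  assume eq: "s i = t j"
  obtain pos \<gamma> \<alpha> where "disc_embedding G pos \<gamma>"
    and pos_s: "\<And>i. i \<in> {1..n} \<Longrightarrow> pos (s i) = cis (\<alpha> (i - 1))"
    and pos_t: "\<And>i. i \<in> {1..n} \<Longrightarrow> pos (t i) = cis (\<alpha> (2 * n - i))"
    and dec: "\<And>x y. x < y \<Longrightarrow> y < 2 * n \<Longrightarrow> \<alpha> y < \<alpha> x \<and> \<alpha> x - \<alpha> y < 2 * pi"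
    by (rule boundary_angles, rule that)
  have "i - 1 < 2 * n - j" "2 * n - j < 2 * n"
    using assms by auto
  from dec[OF this] have "cis (\<alpha> (i - 1)) \<noteq> cis (\<alpha> (2 * n - j))"
    using cis_inj[of "\<alpha> (i - 1)" "\<alpha> (2 * n - j)"] by auto
  with eq pos_s[OF assms(1)] pos_t[OF assms(2)] show False
    by simp
qed

lemma inj_on_sources: "inj_on s {1..n}"
proof -
  obtain pos \<gamma> \<alpha> where "disc_embedding G pos \<gamma>"
    and pos_s: "\<And>i. i \<in> {1..n} \<Longrightarrow> pos (s i) = cis (\<alpha> (i - 1))"
    and pos_t: "\<And>i. i \<in> {1..n} \<Longrightarrow> pos (t i) = cis (\<alpha> (2 * n - i))"
    and dec: "\<And>x y. x < y \<Longrightarrow> y < 2 * n \<Longrightarrow> \<alpha> y < \<alpha> x \<and> \<alpha> x - \<alpha> y < 2 * pi"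
    by (rule boundary_angles, rule that)
  have "s i \<noteq> s j" if "i \<in> {1..n}" "j \<in> {1..n}" "i < j" for i j
  proof
    assume eq: "s i = s j"
    have "i - 1 < j - 1" "j - 1 < 2 * n"
      using that by auto
    from dec[OF this] have "cis (\<alpha> (i - 1)) \<noteq> cis (\<alpha> (j - 1))"
      using cis_inj[of "\<alpha> (i - 1)" "\<alpha> (j - 1)"] by auto
    with eq pos_s[OF that(1)] pos_s[OF that(2)] show False
      by simp
  qed
  then show ?thesis
    by (intro linorder_inj_onI') auto
qed

text \<open>An empty arc list would not reveal its start vertex. As sources differ from sinks, every
  path has a first arc, whose tail is its source. So the poset of paths has n elements and
  \<open>family_less\<close> can be read on indices.\<close>

lemma inj_on_family:
  assumes \<pi>: "\<pi> \<in> families {1..n} id"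
  shows "inj_on \<pi> {1..n}"
proof (rule inj_onI)
  fix i j assume ij: "i \<in> {1..n}" "j \<in> {1..n}" and eq: "\<pi> i = \<pi> j"
  have aw: "awalk (s a) (\<pi> a) (t a)" if "a \<in> {1..n}" for a
    using families_awalk[OF \<pi> that] by simp
  obtain e p where \<pi>i: "\<pi> i = e # p"
    using aw[OF ij(1)] source_neq_sink[OF ij(1) ij(1)] by (cases "\<pi> i") (auto simp: awalk_Nil_iff)
  then have "s i = s j"
    using aw[OF ij(1)] aw[OF ij(2)] unfolding eq [symmetric] by (simp add: \<pi>i awalk_Cons_iff)
  from inj_onD[OF inj_on_sources this ij] show "i = j" .
qed

lemma family_less_iff_below:
  assumes \<pi>: "\<pi> \<in> families {1..n} id" and ij: "i \<in> {1..n}" "j \<in> {1..n}"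
  shows "family_less G n s \<pi> (\<pi> i) (\<pi> j) \<longleftrightarrow> below \<pi> i j"
proof
  assume "family_less G n s \<pi> (\<pi> i) (\<pi> j)"
  then obtain i' j' where ij': "i' \<in> {1..n}" "j' \<in> {1..n}" "\<pi> i = \<pi> i'" "\<pi> j = \<pi> j'" "i' < j'"
    "vset i' (\<pi> i) \<inter> vset j' (\<pi> j) = {}"
    unfolding family_less_def by (elim bexE conjE)
  have "i = i'" "j = j'"
    using inj_onD[OF inj_on_family[OF \<pi>] ij'(3) ij(1) ij'(1)]
      inj_onD[OF inj_on_family[OF \<pi>] ij'(4) ij(2) ij'(2)] by blast+
  with ij'(5,6) show "below \<pi> i j"
    by (simp only: below_def)
next
  assume "below \<pi> i j"
  then show "family_less G n s \<pi> (\<pi> i) (\<pi> j)"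
    unfolding family_less_def below_def using ij by (intro bexI[of _ i] bexI[of _ j]) simp_all
qed

lemma card_hook_pairs_family:
  assumes \<pi>: "\<pi> \<in> families {1..n} id"
  shows "card (hook_pairs (family_less G n s \<pi>) (\<pi> ` {1..n}) p) = card (hook_pairs (below \<pi>) {1..n} p)"
  by (rule card_hook_pairs_image[OF inj_on_family[OF \<pi>]]) (rule family_less_iff_below[OF \<pi>])

lemma hook_immanant_expansion:
  assumes k: "1 \<le> k" "k \<le> n"
  shows "immanant n (irr_character (hook n k)) (path_matrix G s t wt) =
    (\<Sum>\<pi>\<in>path_families G n s t id. family_wgt n wt \<pi> *
      real (card (standard_tableaux (hook n k) (\<pi> ` {1..n}) (family_less G n s \<pi>))))"
proof -
  have "n - k < n" "n - (n - k) = k"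
    using k by auto
  then have "immanant n (irr_character (hook n k)) (path_matrix G s t wt) =
    (\<Sum>\<pi>\<in>families {1..n} id. fwgt {1..n} \<pi> * real (card (hook_pairs (below \<pi>) {1..n} (n - k))))"
    using immanant_hook_pairs[of "n - k"] by simp
  also have "\<dots> = (\<Sum>\<pi>\<in>families {1..n} id. fwgt {1..n} \<pi> *
      real (card (standard_tableaux (hook n k) (\<pi> ` {1..n}) (family_less G n s \<pi>))))"
  proof (intro sum.cong refl)
    fix \<pi> assume \<pi>: "\<pi> \<in> families {1..n} id"
    have "card (\<pi> ` {1..n}) = n"
      using card_image[OF inj_on_family[OF \<pi>]] by simp
    from card_standard_tableaux_hook[OF k this] card_hook_pairs_family[OF \<pi>]
    show "fwgt {1..n} \<pi> * real (card (hook_pairs (below \<pi>) {1..n} (n - k))) =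
      fwgt {1..n} \<pi> * real (card (standard_tableaux (hook n k) (\<pi> ` {1..n}) (family_less G n s \<pi>)))"
      by (simp only:)
  qed
  finally show ?thesis
    by (simp add: path_families_def families_def family_wgt_def fwgt_def)
qed

lemma permanent_expansion:
  assumes n: "1 \<le> n"
  shows "permanent n (path_matrix G s t wt) =
    (\<Sum>\<pi>\<in>path_families G n s t id. family_wgt n wt \<pi> *
      real (card (descent_free_permutations (\<pi> ` {1..n}) (family_less G n s \<pi>))))"
proof -
  have ne: "{1..n} \<noteq> {}"
    using n by simp
  have "permanent n (path_matrix G s t wt) =
    (\<Sum>\<pi>\<in>families {1..n} id. fwgt {1..n} \<pi> * real (card (descent_free (below \<pi>) {1..n})))"
    using per_on_path_matrix[of "{1..n}"] by (simp add: permanent_def per_on_def)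
  also have "\<dots> = (\<Sum>\<pi>\<in>families {1..n} id. fwgt {1..n} \<pi> *
      real (card (descent_free_permutations (\<pi> ` {1..n}) (family_less G n s \<pi>))))"
  proof (intro sum.cong refl)
    fix \<pi> assume \<pi>: "\<pi> \<in> families {1..n} id"
    have "card (descent_free (below \<pi>) {1..n}) = card (hook_pairs (below \<pi>) {1..n} 0)"
      using card_descent_free_hook_pairs[OF ne] by simp
    also have "\<dots> = card (hook_pairs (family_less G n s \<pi>) (\<pi> ` {1..n}) 0)"
      by (rule card_hook_pairs_family[OF \<pi>, symmetric])
    also have "\<dots> = card (descent_free (family_less G n s \<pi>) (\<pi> ` {1..n}))"
      using ne by (intro card_descent_free_hook_pairs) blast
    finally show "fwgt {1..n} \<pi> * real (card (descent_free (below \<pi>) {1..n})) =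
      fwgt {1..n} \<pi> * real (card (descent_free_permutations (\<pi> ` {1..n}) (family_less G n s \<pi>)))"
      by (simp add: descent_free_permutations_eq)
  qed
  finally show ?thesis
    by (simp add: path_families_def families_def family_wgt_def fwgt_def)
qed

end

theorem theorem4p11:
  fixes G :: "('a, 'b) pre_digraph" and n k :: nat
    and s t :: "nat \<Rightarrow> 'a" and wt :: "'b \<Rightarrow> real" and A :: "nat \<Rightarrow> nat \<Rightarrow> real"
  assumes "planar_network G n s t wt"
    and "A = path_matrix G s t wt"
    and "1 \<le> k" and "k \<le> n"
  shows "immanant n (irr_character (hook n k)) A =
           (\<Sum>\<pi>\<in>path_families G n s t id.
              family_wgt n wt \<pi> *
              real (card (standard_tableaux (hook n k) (\<pi> ` {1..n}) (family_less G n s \<pi>))))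
       \<and> permanent n A =
           (\<Sum>\<pi>\<in>path_families G n s t id.
              family_wgt n wt \<pi> *
              real (card (descent_free_permutations (\<pi> ` {1..n}) (family_less G n s \<pi>))))"
proof -
  interpret planar_network G n s t wt
    by fact
  have "1 \<le> n"
    using assms by simp
  then show ?thesis
    unfolding assms(2) using hook_immanant_expansion[OF assms(3,4)] permanent_expansion by blast
qed

end
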